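(* Let $n\ge2$. There is an isomorphism of associative $\mathbb{C}$-algebras $W(\mathfrak{sp}_{2n},e)\cong C_{U_S}(B)$.
   Context: Fix an integer $n\ge 2$ and let $J_n=\begin{pmatrix}0&I_n\\-I_n&0\end{pmatrix}$, $\mathfrak{sp}_{2n}=\{A\in\mathfrak{gl}_{2n}(\mathbb{C})\mid A^tJ_n+J_nA=0\}$. With $e_{i,j}$ the matrix units of $\mathfrak{gl}_{2n}$, put $h_i=e_{i,i}-e_{n+i,n+i}$ ($1\le i\le n$); $X_{\epsilon_i-\epsilon_j}=e_{i,j}-e_{n+j,n+i}$ ($i\ne j$); $X_{\epsilon_i+\epsilon_j}=e_{i,n+j}+e_{j,n+i}$ and $X_{-\epsilon_i-\epsilon_j}=e_{n+j,i}+e_{n+i,j}$ ($1\le i\le j\le n$); in particular $X_{2\epsilon_1}=2e_{1,n+1}$. Localization: $S=\{X_{2\epsilon_1}^{i_1}X_{\epsilon_1-\epsilon_2}^{i_2}\cdots X_{\epsilon_1-\epsilon_n}^{i_n}\mid i_1,\dots,i_n\in\mathbb{Z}_{\ge0}\}$, which is an Ore subset of $U(\mathfrak{sp}_{2n})$; $U_S$ is the localization of $U(\mathfrak{sp}_{2n})$ with respect to $S$. $B$ is the subalgebra of $U_S$ generated by $h_1,\dots,h_n,X_{\epsilon_1-\epsilon_2}^{\pm1},\dots,X_{\epsilon_1-\epsilon_n}^{\pm1},X_{2\epsilon_1}^{\pm1}$, and $C_{U_S}(B)=\{u\in U_S\mid [u,b]=0\ \forall b\in B\}$. Finite $W$-algebra: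 $e=e_{n+1,1}$ (a minimal nilpotent element). Let $\mathfrak{m}_n=\left(\bigoplus_{j=2}^n\mathbb{C}X_{\epsilon_1-\epsilon_j}\right)\oplus\mathbb{C}X_{2\epsilon_1}$, a commutative subalgebra, and $\theta:\mathfrak{m}_n\to\mathbb{C}$, $\theta(X)=\frac12\mathrm{tr}(Xe)$, so $\theta(X_{2\epsilon_1})=1$ and $\theta(X_{\epsilon_1-\epsilon_j})=0$ for $j\ne1$. Let $\mathbb{C}_\theta$ be the one-dimensional $\mathfrak{m}_n$-module given by $\theta$, $Q_e=U(\mathfrak{sp}_{2n})\otimes_{U(\mathfrak{m}_n)}\mathbb{C}_\theta$, and $W(\mathfrak{sp}_{2n},e)=\mathrm{End}_{\mathfrak{sp}_{2n}}(Q_e)^{\mathrm{op}}$. *)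

theory Defs
  imports
    "Jordan_Normal_Form.Matrix"
    "HOL-Algebra.QuotRing"
    "HOL-Algebra.Free_Abelian_Groups"
    "HOL-Library.Poly_Mapping"
begin

section \<open>Associative algebras over the complex numbers\<close>

text \<open>An algebra is carried by the record type of HOL-Algebra modules, whose ring part provides the
  multiplication.  The locale \<^locale>\<open>algebra\<close> of HOL-Algebra is commutative, hence not usable here.\<close>

definition complex_algebra :: "(complex, complex) module" where
  "complex_algebra =
    \<lparr>carrier = UNIV, mult = (*), one = 1, ring.zero = 0, add = (+), smult = (*)\<rparr>"

locale calgebra = ring A + module complex_algebra A
  for A :: "(complex, 'a, 'm) module_scheme" (structure) +
  assumes smult_mult_left:
      "\<lbrakk>x \<in> carrier A; y \<in> carrier A\<rbrakk> \<Longrightarrow> c \<odot> (x \<otimes> y) = (c \<odot> x) \<otimes> y"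
    and smult_mult_right:
      "\<lbrakk>x \<in> carrier A; y \<in> carrier A\<rbrakk> \<Longrightarrow> c \<odot> (x \<otimes> y) = x \<otimes> (c \<odot> y)"

definition calgebra_hom ::
    "(complex, 'a, 'm) module_scheme \<Rightarrow> (complex, 'b, 'n) module_scheme \<Rightarrow> ('a \<Rightarrow> 'b) set" where
  "calgebra_hom A B =
    {f \<in> ring_hom A B. \<forall>c. \<forall>x \<in> carrier A. f (c \<odot>\<^bsub>A\<^esub> x) = c \<odot>\<^bsub>B\<^esub> f x}"

definition calgebra_isomorphic ::
    "(complex, 'a, 'm) module_scheme \<Rightarrow> (complex, 'b, 'n) module_scheme \<Rightarrow> bool" where
  "calgebra_isomorphic A B \<longleftrightarrow> calgebra A \<and> calgebra B \<and>
    (\<exists>f \<in> calgebra_hom A B. bij_betw f (carrier A) (carrier B))"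

definition quotient_algebra ::
    "(complex, 'a, 'm) module_scheme \<Rightarrow> 'a set \<Rightarrow> (complex, 'a set) module" where
  "quotient_algebra A I =
    ring.extend (A Quot I) (module.fields (\<lambda>c X. I <+>\<^bsub>A\<^esub> ((\<lambda>x. c \<odot>\<^bsub>A\<^esub> x) ` X)))"

inductive_set generated_subalgebra ::
    "(complex, 'a, 'm) module_scheme \<Rightarrow> 'a set \<Rightarrow> 'a set" for A and H where
  one: "\<one>\<^bsub>A\<^esub> \<in> generated_subalgebra A H"
| incl: "h \<in> H \<Longrightarrow> h \<in> generated_subalgebra A H"
| add: "x \<in> generated_subalgebra A H \<Longrightarrow> y \<in> generated_subalgebra A H
    \<Longrightarrow> x \<oplus>\<^bsub>A\<^esub> y \<in> generated_subalgebra A H"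
| mult: "x \<in> generated_subalgebra A H \<Longrightarrow> y \<in> generated_subalgebra A H
    \<Longrightarrow> x \<otimes>\<^bsub>A\<^esub> y \<in> generated_subalgebra A H"
| smult: "x \<in> generated_subalgebra A H \<Longrightarrow> c \<odot>\<^bsub>A\<^esub> x \<in> generated_subalgebra A H"

definition centralizer ::
    "(complex, 'a, 'm) module_scheme \<Rightarrow> 'a set \<Rightarrow> (complex, 'a, 'm) module_scheme" where
  "centralizer A B =
    A\<lparr>carrier := {u \<in> carrier A. \<forall>b \<in> B. u \<otimes>\<^bsub>A\<^esub> b \<ominus>\<^bsub>A\<^esub> b \<otimes>\<^bsub>A\<^esub> u = \<zero>\<^bsub>A\<^esub>}\<rparr>"


section \<open>Free algebras\<close>

text \<open>Words form a type of their own because \<open>+\<close> on lists is used for other purposes.  With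
  concatenation as \<open>+\<close>, the convolution product on finitely supported functions on words is the
  product of noncommutative polynomials.\<close>

datatype 'x word = Word (letters: "'x list")

instantiation word :: (type) monoid_add
begin
definition zero_word :: "'a word" where "0 = Word []"
definition plus_word :: "'a word \<Rightarrow> 'a word \<Rightarrow> 'a word" where
  "v + w = Word (letters v @ letters w)"
instance by standard (auto simp: zero_word_def plus_word_def)
end

type_synonym 'x ncpoly = "'x word \<Rightarrow>\<^sub>0 complex"

definition free_algebra :: "'x set \<Rightarrow> (complex, 'x ncpoly) module" where
  "free_algebra X =
    \<lparr>carrier = {p. \<forall>w \<in> Poly_Mapping.keys p. set (letters w) \<subseteq> X},
     mult = (*), one = 1, ring.zero = 0, add = (+),
     smult = (\<lambda>c p. Poly_Mapping.single 0 c * p)\<rparr>"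

definition letter :: "'x \<Rightarrow> 'x ncpoly" where
  "letter x = Poly_Mapping.single (Word [x]) 1"


section \<open>Universal enveloping algebras of matrix Lie algebras\<close>

text \<open>A matrix Lie algebra is given by its underlying set of square matrices, with the commutator as
  bracket.  The first two kinds of relations turn the free algebra on that set into the tensor
  algebra of the vector space.\<close>

definition env_relations :: "complex mat set \<Rightarrow> complex mat ncpoly set" where
  "env_relations g =
     {letter (x + y) - letter x - letter y | x y. x \<in> g \<and> y \<in> g}
   \<union> {letter (c \<cdot>\<^sub>m x) - Poly_Mapping.single 0 c * letter x | c x. x \<in> g}
   \<union> {letter x * letter y - letter y * letter x - letter (x * y - y * x) | x y. x \<in> g \<and> y \<in> g}"

definition env_ideal :: "complex mat set \<Rightarrow> complex mat ncpoly set" where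
  "env_ideal g = genideal (free_algebra g) (env_relations g)"

type_synonym env = "complex mat ncpoly set"

definition univ_env :: "complex mat set \<Rightarrow> (complex, env) module" where
  "univ_env g = quotient_algebra (free_algebra g) (env_ideal g)"

definition env_of :: "complex mat set \<Rightarrow> complex mat \<Rightarrow> env" where
  "env_of g x = env_ideal g +>\<^bsub>free_algebra g\<^esub> letter x"

text \<open>The extension of a Lie algebra map \<open>f\<close> into \<open>A\<close> to an algebra homomorphism on the universal
  enveloping algebra; extensionality makes it unique as a HOL function.\<close>

definition env_lift ::
    "complex mat set \<Rightarrow> (complex, 'a, 'm) module_scheme \<Rightarrow> (complex mat \<Rightarrow> 'a) \<Rightarrow> env \<Rightarrow> 'a" where
  "env_lift g A f = (THE F. F \<in> calgebra_hom (univ_env g) A \<inter> extensional (carrier (univ_env g))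
      \<and> (\<forall>x \<in> g. F (env_of g x) = f x))"


section \<open>Localization at an Ore set\<close>

text \<open>The pair \<open>(s, u)\<close> stands for the left fraction \<open>s\<^sup>-\<^sup>1 u\<close>.  The operations are written without
  choosing representatives: sums use a common denominator, and products use numerators adapted to
  the next denominator, \<open>(s\<^sup>-\<^sup>1 (u t)) (t\<^sup>-\<^sup>1 v) = s\<^sup>-\<^sup>1 (u v)\<close>.  The left Ore condition supplies such
  representatives for any two fractions.\<close>

definition fraction_rel ::
    "(complex, 'a, 'm) module_scheme \<Rightarrow> 'a set \<Rightarrow> (('a \<times> 'a) \<times> ('a \<times> 'a)) set" where
  "fraction_rel A S =
    {((s, u), (t, v)) | s u t v. s \<in> S \<and> t \<in> S \<and> u \<in> carrier A \<and> v \<in> carrier A \<and>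
      (\<exists>a \<in> carrier A. \<exists>b \<in> carrier A.
        a \<otimes>\<^bsub>A\<^esub> s = b \<otimes>\<^bsub>A\<^esub> t \<and> a \<otimes>\<^bsub>A\<^esub> s \<in> S \<and> a \<otimes>\<^bsub>A\<^esub> u = b \<otimes>\<^bsub>A\<^esub> v)}"

definition localization ::
    "(complex, 'a, 'm) module_scheme \<Rightarrow> 'a set \<Rightarrow> (complex, ('a \<times> 'a) set) module" where
  "localization A S =
    \<lparr>carrier = (S \<times> carrier A) // fraction_rel A S,
     mult = (\<lambda>P Q. fraction_rel A S ``
       {(s, u \<otimes>\<^bsub>A\<^esub> v) | s u t v. u \<in> carrier A \<and> (s, u \<otimes>\<^bsub>A\<^esub> t) \<in> P \<and> (t, v) \<in> Q}),
     one = fraction_rel A S `` {(\<one>\<^bsub>A\<^esub>, \<one>\<^bsub>A\<^esub>)},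
     ring.zero = fraction_rel A S `` {(\<one>\<^bsub>A\<^esub>, \<zero>\<^bsub>A\<^esub>)},
     add = (\<lambda>P Q. fraction_rel A S `` {(s, u \<oplus>\<^bsub>A\<^esub> v) | s u v. (s, u) \<in> P \<and> (s, v) \<in> Q}),
     smult = (\<lambda>c P. fraction_rel A S `` {(s, c \<odot>\<^bsub>A\<^esub> u) | s u. (s, u) \<in> P})\<rparr>"

definition to_localization ::
    "(complex, 'a, 'm) module_scheme \<Rightarrow> 'a set \<Rightarrow> 'a \<Rightarrow> ('a \<times> 'a) set" where
  "to_localization A S u = fraction_rel A S `` {(\<one>\<^bsub>A\<^esub>, u)}"


section \<open>Tensor products over a noncommutative ring\<close>

text \<open>\<open>M\<close> is a right \<open>R\<close>-module with action \<open>ra\<close> and \<open>N\<close> a left \<open>R\<close>-module with action \<open>la\<close>; only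
  the additive groups of the records \<open>M\<close> and \<open>N\<close> matter.  The result is an abelian group in
  multiplicative notation.\<close>

definition tensor_relations ::
    "('r, 'k) ring_scheme \<Rightarrow> ('m, 'l) ring_scheme \<Rightarrow> ('m \<Rightarrow> 'r \<Rightarrow> 'm) \<Rightarrow>
     ('n, 'o) ring_scheme \<Rightarrow> ('r \<Rightarrow> 'n \<Rightarrow> 'n) \<Rightarrow> (('m \<times> 'n) \<Rightarrow>\<^sub>0 int) set" where
  "tensor_relations R M ra N la =
     {frag_of (x \<oplus>\<^bsub>M\<^esub> y, z) - frag_of (x, z) - frag_of (y, z) | x y z.
        x \<in> carrier M \<and> y \<in> carrier M \<and> z \<in> carrier N}
   \<union> {frag_of (x, y \<oplus>\<^bsub>N\<^esub> z) - frag_of (x, y) - frag_of (x, z) | x y z.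
        x \<in> carrier M \<and> y \<in> carrier N \<and> z \<in> carrier N}
   \<union> {frag_of (ra x r, z) - frag_of (x, la r z) | x r z.
        x \<in> carrier M \<and> r \<in> carrier R \<and> z \<in> carrier N}"

definition tensor_kernel ::
    "('r, 'k) ring_scheme \<Rightarrow> ('m, 'l) ring_scheme \<Rightarrow> ('m \<Rightarrow> 'r \<Rightarrow> 'm) \<Rightarrow>
     ('n, 'o) ring_scheme \<Rightarrow> ('r \<Rightarrow> 'n \<Rightarrow> 'n) \<Rightarrow> (('m \<times> 'n) \<Rightarrow>\<^sub>0 int) set" where
  "tensor_kernel R M ra N la =
    generate (free_Abelian_group (carrier M \<times> carrier N)) (tensor_relations R M ra N la)"

definition tensor_product ::
    "('r, 'k) ring_scheme \<Rightarrow> ('m, 'l) ring_scheme \<Rightarrow> ('m \<Rightarrow> 'r \<Rightarrow> 'm) \<Rightarrow>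
     ('n, 'o) ring_scheme \<Rightarrow> ('r \<Rightarrow> 'n \<Rightarrow> 'n) \<Rightarrow> (('m \<times> 'n) \<Rightarrow>\<^sub>0 int) set monoid" where
  "tensor_product R M ra N la =
    free_Abelian_group (carrier M \<times> carrier N) Mod tensor_kernel R M ra N la"

text \<open>If \<open>M\<close> is an algebra, it acts on the tensor product by left multiplication on the first factor.
  The fields \<open>mult\<close> and \<open>one\<close> of this module record play no role.\<close>

definition induced_module ::
    "('r, 'k) ring_scheme \<Rightarrow> ('m, 'l) ring_scheme \<Rightarrow> ('m \<Rightarrow> 'r \<Rightarrow> 'm) \<Rightarrow>
     ('n, 'o) ring_scheme \<Rightarrow> ('r \<Rightarrow> 'n \<Rightarrow> 'n) \<Rightarrow> ('m, (('m \<times> 'n) \<Rightarrow>\<^sub>0 int) set) module" where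
  "induced_module R M ra N la =
    \<lparr>carrier = carrier (tensor_product R M ra N la),
     mult = undefined, one = undefined,
     ring.zero = \<one>\<^bsub>tensor_product R M ra N la\<^esub>,
     add = mult (tensor_product R M ra N la),
     smult = (\<lambda>u X. tensor_kernel R M ra N la
       <#>\<^bsub>free_Abelian_group (carrier M \<times> carrier N)\<^esub>
       (frag_extend (\<lambda>(x, z). frag_of (u \<otimes>\<^bsub>M\<^esub> x, z)) ` X))\<rparr>"


section \<open>Endomorphism algebras\<close>

text \<open>A \<open>U(g)\<close>-module \<open>Q\<close> is regarded as a complex vector space through the scalars in \<open>U(g)\<close> and as
  a \<open>g\<close>-module through \<^const>\<open>env_of\<close>.  The multiplication is that of the opposite of the
  endomorphism algebra.\<close>

definition module_scalar ::
    "complex mat set \<Rightarrow> (env, 'q, 'm) module_scheme \<Rightarrow> complex \<Rightarrow> 'q \<Rightarrow> 'q" where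
  "module_scalar g Q c q = (c \<odot>\<^bsub>univ_env g\<^esub> \<one>\<^bsub>univ_env g\<^esub>) \<odot>\<^bsub>Q\<^esub> q"

definition lie_endomorphisms ::
    "complex mat set \<Rightarrow> (env, 'q, 'm) module_scheme \<Rightarrow> ('q \<Rightarrow> 'q) set" where
  "lie_endomorphisms g Q = {f \<in> carrier Q \<rightarrow>\<^sub>E carrier Q.
     (\<forall>p \<in> carrier Q. \<forall>q \<in> carrier Q. f (p \<oplus>\<^bsub>Q\<^esub> q) = f p \<oplus>\<^bsub>Q\<^esub> f q) \<and>
     (\<forall>c. \<forall>q \<in> carrier Q. f (module_scalar g Q c q) = module_scalar g Q c (f q)) \<and>
     (\<forall>x \<in> g. \<forall>q \<in> carrier Q. f (env_of g x \<odot>\<^bsub>Q\<^esub> q) = env_of g x \<odot>\<^bsub>Q\<^esub> f q)}"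

definition op_endomorphism_algebra ::
    "complex mat set \<Rightarrow> (env, 'q, 'm) module_scheme \<Rightarrow> (complex, 'q \<Rightarrow> 'q) module" where
  "op_endomorphism_algebra g Q =
    \<lparr>carrier = lie_endomorphisms g Q,
     mult = (\<lambda>f f'. compose (carrier Q) f' f),
     one = (\<lambda>q \<in> carrier Q. q),
     ring.zero = (\<lambda>q \<in> carrier Q. \<zero>\<^bsub>Q\<^esub>),
     add = (\<lambda>f f'. \<lambda>q \<in> carrier Q. f q \<oplus>\<^bsub>Q\<^esub> f' q),
     smult = (\<lambda>c f. \<lambda>q \<in> carrier Q. module_scalar g Q c (f q))\<rparr>"


section \<open>The symplectic Lie algebra\<close>

definition symplectic_form :: "nat \<Rightarrow> complex mat" where
  "symplectic_form n = four_block_mat (0\<^sub>m n n) (1\<^sub>m n) (- 1\<^sub>m n) (0\<^sub>m n n)"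

definition sp :: "nat \<Rightarrow> complex mat set" where
  "sp n = {A \<in> carrier_mat (2 * n) (2 * n).
     transpose_mat A * symplectic_form n + symplectic_form n * A = 0\<^sub>m (2 * n) (2 * n)}"

text \<open>From here on, row and column numbers start at 1, whereas entries of matrices are addressed
  from 0 in the library.\<close>

definition mat_unit :: "nat \<Rightarrow> nat \<Rightarrow> nat \<Rightarrow> complex mat" where
  "mat_unit n i j =
    mat (2 * n) (2 * n) (\<lambda>(r, c). if Suc r = i \<and> Suc c = j then 1 else 0)"

definition h_mat :: "nat \<Rightarrow> nat \<Rightarrow> complex mat" where
  "h_mat n i = mat_unit n i i - mat_unit n (n + i) (n + i)"

text \<open>The root vectors \<open>X_diff n i j\<close> and \<open>X_sum n i j\<close> have roots \<open>\<epsilon>\<^sub>i - \<epsilon>\<^sub>j\<close> (for \<open>i \<noteq> j\<close>) and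
  \<open>\<epsilon>\<^sub>i + \<epsilon>\<^sub>j\<close>; in particular \<open>X_sum n 1 1\<close> has root \<open>2 \<epsilon>\<^sub>1\<close>.\<close>

definition X_diff :: "nat \<Rightarrow> nat \<Rightarrow> nat \<Rightarrow> complex mat" where
  "X_diff n i j = mat_unit n i j - mat_unit n (n + j) (n + i)"

definition X_sum :: "nat \<Rightarrow> nat \<Rightarrow> nat \<Rightarrow> complex mat" where
  "X_sum n i j = mat_unit n i (n + j) + mat_unit n j (n + i)"


section \<open>The centralizer in the localized enveloping algebra\<close>

definition ore_set :: "nat \<Rightarrow> env set" where
  "ore_set n =
    {env_of (sp n) (X_sum n 1 1) [^]\<^bsub>univ_env (sp n)\<^esub> k 1 \<otimes>\<^bsub>univ_env (sp n)\<^esub>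
     foldr (\<otimes>\<^bsub>univ_env (sp n)\<^esub>)
       (map (\<lambda>j. env_of (sp n) (X_diff n 1 j) [^]\<^bsub>univ_env (sp n)\<^esub> k j) [2..<Suc n])
       \<one>\<^bsub>univ_env (sp n)\<^esub> | k :: nat \<Rightarrow> nat. True}"

definition U_loc :: "nat \<Rightarrow> (complex, (env \<times> env) set) module" where
  "U_loc n = localization (univ_env (sp n)) (ore_set n)"

definition loc_of :: "nat \<Rightarrow> complex mat \<Rightarrow> (env \<times> env) set" where
  "loc_of n x = to_localization (univ_env (sp n)) (ore_set n) (env_of (sp n) x)"

definition B_alg :: "nat \<Rightarrow> (env \<times> env) set set" where
  "B_alg n = generated_subalgebra (U_loc n)
     ({loc_of n (h_mat n i) | i. i \<in> {1..n}}
    \<union> {loc_of n (X_diff n 1 j) | j. j \<in> {2..n}}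
    \<union> {inv\<^bsub>U_loc n\<^esub> (loc_of n (X_diff n 1 j)) | j. j \<in> {2..n}}
    \<union> {loc_of n (X_sum n 1 1), inv\<^bsub>U_loc n\<^esub> (loc_of n (X_sum n 1 1))})"

definition C_alg :: "nat \<Rightarrow> (complex, (env \<times> env) set) module" where
  "C_alg n = centralizer (U_loc n) (B_alg n)"


section \<open>The finite W-algebra of a minimal nilpotent element\<close>

definition mat_trace :: "complex mat \<Rightarrow> complex" where
  "mat_trace A = (\<Sum>i<dim_row A. A $$ (i, i))"

definition min_nilpotent :: "nat \<Rightarrow> complex mat" where
  "min_nilpotent n = mat_unit n (n + 1) 1"

definition m_alg :: "nat \<Rightarrow> complex mat set" where
  "m_alg n =
    {(\<Oplus>\<^bsub>module_mat TYPE(complex) (2 * n) (2 * n)\<^esub>j \<in> {2..n}. a j \<cdot>\<^sub>m X_diff n 1 j)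
       + a 1 \<cdot>\<^sub>m X_sum n 1 1 | a :: nat \<Rightarrow> complex. True}"

definition theta :: "nat \<Rightarrow> complex mat \<Rightarrow> complex" where
  "theta n X = mat_trace (X * min_nilpotent n) / 2"

definition Q_module :: "nat \<Rightarrow> (env, ((env \<times> complex) \<Rightarrow>\<^sub>0 int) set) module" where
  "Q_module n = induced_module (univ_env (m_alg n))
     (univ_env (sp n))
       (\<lambda>u r. u \<otimes>\<^bsub>univ_env (sp n)\<^esub> env_lift (m_alg n) (univ_env (sp n)) (env_of (sp n)) r)
     complex_algebra
       (\<lambda>r z. env_lift (m_alg n) complex_algebra (theta n) r * z)"

definition W_alg ::
    "nat \<Rightarrow> (complex, ((env \<times> complex) \<Rightarrow>\<^sub>0 int) set \<Rightarrow> ((env \<times> complex) \<Rightarrow>\<^sub>0 int) set) module" where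
  "W_alg n = op_endomorphism_algebra (sp n) (Q_module n)"

end

theory Submission
  imports Defs
begin

text \<open>Write \<open>x\<^sub>1 = X\<^bsub>2\<epsilon>\<^sub>1\<^esub>\<close> and \<open>x\<^sub>j = X\<^bsub>\<epsilon>\<^sub>1 - \<epsilon>\<^sub>j\<^esub>\<close>, and let \<open>I\<close> be the left ideal of \<open>U(sp)\<close> generated by the
  \<open>x\<^sub>j - 1\<close>.  Conjugation by an element of the symplectic group turns \<open>\<theta>\<close> into the character with
  value 1 on all \<open>x\<^sub>j\<close>, so that the finite W-algebra becomes the algebra of classes \<open>u + I\<close> with
  \<open>[x\<^sub>j, u] \<in> I\<close> for all \<open>j\<close>.  The weights of the \<open>x\<^sub>j\<close> form a basis of the root lattice, hence every
  \<open>u\<close> is congruent modulo \<open>I\<close> to a weight vector, obtained by multiplying its weight components by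
  monomials in the \<open>x\<^sub>j\<close>; and a weight vector in \<open>I\<close> is annihilated by some monomial from the right,
  because the homogenization at a large weight kills \<open>I\<close>.  An element of \<open>C\<close> is a fraction
  \<open>s\<^sup>-\<^sup>1 u\<close> with \<open>s\<close> a monomial and \<open>u\<close> a vector of the same weight commuting with the \<open>x\<^sub>j\<close>, and sending
  it to \<open>u + I\<close> is the isomorphism.  No basis theorem for \<open>U(sp)\<close> is needed.\<close>

section \<open>Algebras\<close>

text \<open>The conjugation is needed because \<theta> vanishes on \<open>x\<^sub>j\<close> for j
  \<ge> 2: right multiplication by such an \<open>x\<^sub>j\<close> annihilates every class modulo
  the left ideal belonging to \<theta>. Once every \<open>x\<^sub>j\<close> is congruent to 1, right
  multiplication by a monomial changes no class, and weights can be shifted upwards in every basis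
  direction at no cost. Setting all \<open>x\<^sub>j\<close> to 1 then works like dehomogenization
  in a graded ring: a fraction of weight 0 is recovered from the class of its numerator. Zero
  divisors in U(sp) are never excluded, so equations between weight vectors are obtained only up to
  a monomial factor, which the localization absorbs. Torsion from the right, as it comes out of
  \<open>I\<close>, becomes the torsion from the left that fractions see, because the numerators in
  question commute with the \<open>x\<^sub>j\<close>. The Ore conditions come from the nilpotency of
  ad \<open>x\<^sub>j\<close>. On the module side an endomorphism is right multiplication by a
  representative of the image of the cyclic generator; right multiplications compose in reverse
  order, whence the opposite algebra.\<close>

lemma complex_algebra_simps [simp]:
  "carrier complex_algebra = UNIV" "a \<otimes>\<^bsub>complex_algebra\<^esub> b = a * b"
  "\<one>\<^bsub>complex_algebra\<^esub> = 1" "\<zero>\<^bsub>complex_algebra\<^esub> = 0" "a \<oplus>\<^bsub>complex_algebra\<^esub> b = a + b"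
  "a \<odot>\<^bsub>complex_algebra\<^esub> b = a * b"
  by (simp_all add: complex_algebra_def)

lemma cring_complex_algebra: "cring complex_algebra"
proof (rule cringI)
  show "abelian_group complex_algebra"
    by (rule abelian_groupI) (auto intro: exI[of _ "- x" for x :: complex])
  show "Group.comm_monoid complex_algebra"
    by (rule comm_monoidI) auto
qed (auto simp: algebra_simps)

lemma calgebraI:
  fixes A (structure)
  assumes "ring A"
    and "\<And>c x. x \<in> carrier A \<Longrightarrow> c \<odot> x \<in> carrier A"
    and "\<And>c d x. x \<in> carrier A \<Longrightarrow> (c + d) \<odot> x = c \<odot> x \<oplus> d \<odot> x"
    and "\<And>c x y. x \<in> carrier A \<Longrightarrow> y \<in> carrier A \<Longrightarrow> c \<odot> (x \<oplus> y) = c \<odot> x \<oplus> c \<odot> y"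
    and "\<And>c d x. x \<in> carrier A \<Longrightarrow> (c * d) \<odot> x = c \<odot> (d \<odot> x)"
    and "\<And>x. x \<in> carrier A \<Longrightarrow> 1 \<odot> x = x"
    and "\<And>c x y. x \<in> carrier A \<Longrightarrow> y \<in> carrier A \<Longrightarrow> c \<odot> (x \<otimes> y) = (c \<odot> x) \<otimes> y"
    and "\<And>c x y. x \<in> carrier A \<Longrightarrow> y \<in> carrier A \<Longrightarrow> c \<odot> (x \<otimes> y) = x \<otimes> (c \<odot> y)"
  shows "calgebra A"
proof -
  interpret A: ring A by fact
  have "module complex_algebra A"
    by (rule moduleI) (use assms cring_complex_algebra A.abelian_group_axioms in auto)
  then show ?thesis
    by (intro calgebra.intro calgebra_axioms.intro) (use assms in auto)
qed

lemma calgebra_complex_algebra: "calgebra complex_algebra"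
  using cring_complex_algebra by (intro calgebraI) (auto simp: cring_def algebra_simps)

text \<open>The locale \<^locale>\<open>calgebra\<close> inherits the ring facts twice, and the unqualified names denote those
  of the scalars.\<close>

locale calg =
  fixes A :: "(complex, 'a, 'm) module_scheme" (structure)
  assumes is_calgebra: "calgebra A"

sublocale calg \<subseteq> ring A
  using is_calgebra by (simp add: calgebra_def)

context calg
begin

lemma scale_closed [simp, intro]: "x \<in> carrier A \<Longrightarrow> c \<odot> x \<in> carrier A"
  and scale_add_left: "x \<in> carrier A \<Longrightarrow> (c + d) \<odot> x = c \<odot> x \<oplus> d \<odot> x"
  and scale_add_right: "x \<in> carrier A \<Longrightarrow> y \<in> carrier A \<Longrightarrow> c \<odot> (x \<oplus> y) = c \<odot> x \<oplus> c \<odot> y"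
  and scale_scale: "x \<in> carrier A \<Longrightarrow> c \<odot> (d \<odot> x) = (c * d) \<odot> x"
  and scale_one [simp]: "x \<in> carrier A \<Longrightarrow> 1 \<odot> x = x"
proof -
  interpret M: module complex_algebra A
    using is_calgebra by (simp add: calgebra_def)
  show "x \<in> carrier A \<Longrightarrow> c \<odot> x \<in> carrier A"
    "x \<in> carrier A \<Longrightarrow> (c + d) \<odot> x = c \<odot> x \<oplus> d \<odot> x"
    "x \<in> carrier A \<Longrightarrow> y \<in> carrier A \<Longrightarrow> c \<odot> (x \<oplus> y) = c \<odot> x \<oplus> c \<odot> y"
    "x \<in> carrier A \<Longrightarrow> c \<odot> (d \<odot> x) = (c * d) \<odot> x"
    "x \<in> carrier A \<Longrightarrow> 1 \<odot> x = x"
    using M.smult_closed[of c x] M.smult_l_distr[of c d x] M.smult_r_distr[of c x y]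
      M.smult_assoc1[of c d x] M.smult_one[of x] by simp_all
qed

lemma scale_zero [simp]: "c \<odot> \<zero> = \<zero>"
  using scale_add_right[of \<zero> \<zero> c] add.l_cancel_one[of "c \<odot> \<zero>" "c \<odot> \<zero>"] by simp

lemma zero_scale [simp]: "x \<in> carrier A \<Longrightarrow> 0 \<odot> x = \<zero>"
  using scale_add_left[of x 0 0] add.l_cancel_one[of "0 \<odot> x" "0 \<odot> x"] by simp

lemma scale_minus: "x \<in> carrier A \<Longrightarrow> c \<odot> (\<ominus> x) = \<ominus> (c \<odot> x)"
  using scale_add_right[of "\<ominus> x" x c] minus_equality[of "c \<odot> (\<ominus> x)" "c \<odot> x"] by (simp add: l_neg)

lemma minus_scale: "x \<in> carrier A \<Longrightarrow> (- c) \<odot> x = \<ominus> (c \<odot> x)"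
  using scale_add_left[of x "- c" c] minus_equality[of "(- c) \<odot> x" "c \<odot> x"] by simp

lemma scale_diff: "x \<in> carrier A \<Longrightarrow> y \<in> carrier A \<Longrightarrow> c \<odot> (x \<ominus> y) = c \<odot> x \<ominus> c \<odot> y"
  by (simp add: a_minus_def scale_add_right scale_minus)

lemma diff_scale: "x \<in> carrier A \<Longrightarrow> (c - d) \<odot> x = c \<odot> x \<ominus> d \<odot> x"
  using scale_add_left[of x c "- d"] by (simp add: a_minus_def minus_scale)

lemma scale_mult_left: "x \<in> carrier A \<Longrightarrow> y \<in> carrier A \<Longrightarrow> (c \<odot> x) \<otimes> y = c \<odot> (x \<otimes> y)"
  and scale_mult_right: "x \<in> carrier A \<Longrightarrow> y \<in> carrier A \<Longrightarrow> x \<otimes> (c \<odot> y) = c \<odot> (x \<otimes> y)"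
  using calgebra.smult_mult_left[OF is_calgebra] calgebra.smult_mult_right[OF is_calgebra] by auto

lemma scale_eq_zero: "x \<in> carrier A \<Longrightarrow> c \<noteq> 0 \<Longrightarrow> c \<odot> x = \<zero> \<Longrightarrow> x = \<zero>"
  using scale_scale[of x "inverse c" c] by simp

lemma diff_eq_zero_iff: "x \<in> carrier A \<Longrightarrow> y \<in> carrier A \<Longrightarrow> x \<ominus> y = \<zero> \<longleftrightarrow> x = y"
  using minus_equality[of x "\<ominus> y"] by (auto simp: a_minus_def r_neg)

lemma generated_subalgebra_closed:
  assumes "H \<subseteq> carrier A" "x \<in> generated_subalgebra A H"
  shows "x \<in> carrier A"
  using assms(2) by induction (use assms(1) in auto)

lemma commutes_generated_subalgebra:
  assumes "H \<subseteq> carrier A" "u \<in> carrier A" "\<And>h. h \<in> H \<Longrightarrow> u \<otimes> h = h \<otimes> u"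
    and "x \<in> generated_subalgebra A H"
  shows "u \<otimes> x = x \<otimes> u"
  using assms(4)
proof induction
  case (mult x y)
  then have "x \<in> carrier A" "y \<in> carrier A"
    using assms(1) generated_subalgebra_closed by auto
  then show ?case
    using mult assms(2) by (metis m_assoc)
qed (use assms generated_subalgebra_closed in
    \<open>auto simp: r_distr l_distr scale_mult_left scale_mult_right\<close>)

lemma centralizer_carrier:
  assumes "H \<subseteq> carrier A"
  shows "carrier (centralizer A (generated_subalgebra A H))
    = {u \<in> carrier A. \<forall>h \<in> H. u \<otimes> h = h \<otimes> u}"
proof -
  have "(\<forall>b \<in> generated_subalgebra A H. u \<otimes> b \<ominus> b \<otimes> u = \<zero>) \<longleftrightarrow> (\<forall>h \<in> H. u \<otimes> h = h \<otimes> u)"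
    if "u \<in> carrier A" for u
    using that assms generated_subalgebra_closed[OF assms]
      commutes_generated_subalgebra[OF assms that]
    by (metis diff_eq_zero_iff generated_subalgebra.incl m_closed)
  then show ?thesis
    by (auto simp: centralizer_def)
qed

text \<open>Zero and negatives are the scalings by 0 and -1, so closure under \<open>\<odot>\<close>
  supplies the additive group.\<close>

lemma calgebra_subalgebra:
  assumes "C \<subseteq> carrier A" "\<one> \<in> C" "\<And>x y. x \<in> C \<Longrightarrow> y \<in> C \<Longrightarrow> x \<oplus> y \<in> C"
    "\<And>x y. x \<in> C \<Longrightarrow> y \<in> C \<Longrightarrow> x \<otimes> y \<in> C" "\<And>c x. x \<in> C \<Longrightarrow> c \<odot> x \<in> C"
  shows "calgebra (A\<lparr>carrier := C\<rparr>)"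
proof -
  note C = assms(2-5) subsetD[OF assms(1)]
  have z: "\<zero> \<in> C"
    using C(1,4,5) zero_scale by (metis)
  have "ring (A\<lparr>carrier := C\<rparr>)"
  proof (rule ringI)
    show "abelian_group (A\<lparr>carrier := C\<rparr>)"
    proof (rule abelian_groupI)
      fix x assume "x \<in> carrier (A\<lparr>carrier := C\<rparr>)"
      then have x: "x \<in> C" by simp
      have "(- 1) \<odot> x \<in> C" using C(4)[OF x] .
      moreover have "(- 1) \<odot> x \<oplus> x = \<zero>"
        using C(5)[OF x] minus_scale[of x 1] by (simp add: l_neg)
      ultimately show "\<exists>y \<in> carrier (A\<lparr>carrier := C\<rparr>). y \<oplus>\<^bsub>A\<lparr>carrier := C\<rparr>\<^esub> x = \<zero>\<^bsub>A\<lparr>carrier := C\<rparr>\<^esub>"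
        by auto
    qed (use C z in \<open>auto simp: a_ac\<close>)
    show "Group.monoid (A\<lparr>carrier := C\<rparr>)"
      by (rule monoidI) (use C in \<open>auto simp: m_assoc\<close>)
  qed (use C in \<open>auto simp: l_distr r_distr\<close>)
  then show ?thesis
    by (rule calgebraI) (use C in \<open>auto simp: scale_add_left scale_add_right scale_scale
      scale_mult_left scale_mult_right\<close>)
qed

lemma calgebra_centralizer:
  assumes "H \<subseteq> carrier A"
  shows "calgebra (centralizer A (generated_subalgebra A H))"
proof -
  have "centralizer A (generated_subalgebra A H)
    = A\<lparr>carrier := {u \<in> carrier A. \<forall>h \<in> H. u \<otimes> h = h \<otimes> u}\<rparr>"
    using centralizer_carrier[OF assms] by (simp add: centralizer_def)
  moreover have "calgebra (A\<lparr>carrier := {u \<in> carrier A. \<forall>h \<in> H. u \<otimes> h = h \<otimes> u}\<rparr>)"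
  proof (rule calgebra_subalgebra, goal_cases)
    case (4 x y)
    then show ?case using assms by (auto simp: subset_iff) (metis m_assoc)
  qed (use assms in \<open>auto simp: r_distr l_distr scale_mult_left scale_mult_right subset_iff\<close>)
  ultimately show ?thesis by simp
qed

end

lemma calgebra_homI:
  fixes A (structure) and B (structure)
  assumes "\<And>x. x \<in> carrier A \<Longrightarrow> f x \<in> carrier B"
    and "\<And>x y. x \<in> carrier A \<Longrightarrow> y \<in> carrier A \<Longrightarrow> f (x \<otimes>\<^bsub>A\<^esub> y) = f x \<otimes>\<^bsub>B\<^esub> f y"
    and "\<And>x y. x \<in> carrier A \<Longrightarrow> y \<in> carrier A \<Longrightarrow> f (x \<oplus>\<^bsub>A\<^esub> y) = f x \<oplus>\<^bsub>B\<^esub> f y"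
    and "f \<one>\<^bsub>A\<^esub> = \<one>\<^bsub>B\<^esub>" and "\<And>c x. x \<in> carrier A \<Longrightarrow> f (c \<odot>\<^bsub>A\<^esub> x) = c \<odot>\<^bsub>B\<^esub> f x"
  shows "f \<in> calgebra_hom A B"
  unfolding calgebra_hom_def using assms by (auto intro!: ring_hom_memI)

lemma calgebra_homD:
  assumes "f \<in> calgebra_hom A B"
  shows "x \<in> carrier A \<Longrightarrow> f x \<in> carrier B"
    and "x \<in> carrier A \<Longrightarrow> y \<in> carrier A \<Longrightarrow> f (x \<otimes>\<^bsub>A\<^esub> y) = f x \<otimes>\<^bsub>B\<^esub> f y"
    and "x \<in> carrier A \<Longrightarrow> y \<in> carrier A \<Longrightarrow> f (x \<oplus>\<^bsub>A\<^esub> y) = f x \<oplus>\<^bsub>B\<^esub> f y"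
    and "f \<one>\<^bsub>A\<^esub> = \<one>\<^bsub>B\<^esub>" and "x \<in> carrier A \<Longrightarrow> f (c \<odot>\<^bsub>A\<^esub> x) = c \<odot>\<^bsub>B\<^esub> f x"
  using assms unfolding calgebra_hom_def
  by (auto simp: ring_hom_closed ring_hom_mult ring_hom_add ring_hom_one)

lemma calgebra_hom_zero:
  assumes "calgebra A" "calgebra B" "f \<in> calgebra_hom A B"
  shows "f \<zero>\<^bsub>A\<^esub> = \<zero>\<^bsub>B\<^esub>"
proof -
  interpret A: calg A using assms(1) by (rule calg.intro)
  interpret B: calg B using assms(2) by (rule calg.intro)
  show ?thesis
    using calgebra_homD(5)[OF assms(3), of "\<zero>\<^bsub>A\<^esub>" 0] calgebra_homD(1)[OF assms(3), of "\<zero>\<^bsub>A\<^esub>"]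
    by simp
qed

lemma calgebra_hom_diff:
  assumes "calgebra A" "calgebra B" "f \<in> calgebra_hom A B" "x \<in> carrier A" "y \<in> carrier A"
  shows "f (x \<ominus>\<^bsub>A\<^esub> y) = f x \<ominus>\<^bsub>B\<^esub> f y"
proof -
  interpret A: calg A using assms(1) by (rule calg.intro)
  interpret B: calg B using assms(2) by (rule calg.intro)
  note h = calgebra_homD[OF assms(3)]
  have "x \<ominus>\<^bsub>A\<^esub> y = x \<oplus>\<^bsub>A\<^esub> (- 1) \<odot>\<^bsub>A\<^esub> y" "f x \<ominus>\<^bsub>B\<^esub> f y = f x \<oplus>\<^bsub>B\<^esub> (- 1) \<odot>\<^bsub>B\<^esub> f y"
    using assms(4,5) h(1) by (simp_all add: A.minus_scale B.minus_scale a_minus_def)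
  then show ?thesis
    using assms(4,5) h by simp
qed

lemma calgebra_hom_compose:
  assumes "f \<in> calgebra_hom A B" "g \<in> calgebra_hom B C"
  shows "(\<lambda>x. g (f x)) \<in> calgebra_hom A C"
  by (rule calgebra_homI) (use calgebra_homD[OF assms(1)] calgebra_homD[OF assms(2)] in auto)

lemma calgebra_hom_eq_on_generated:
  assumes "calgebra A" "H \<subseteq> carrier A" "f \<in> calgebra_hom A B" "g \<in> calgebra_hom A B"
    and "\<And>h. h \<in> H \<Longrightarrow> f h = g h" and "x \<in> generated_subalgebra A H"
  shows "f x = g x"
proof -
  interpret A: calg A using assms(1) by (rule calg.intro)
  note f = calgebra_homD[OF assms(3)] and g = calgebra_homD[OF assms(4)]
  show ?thesis
    using assms(6) by induction (use assms(5) A.generated_subalgebra_closed[OF assms(2)] f g in auto)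
qed

text \<open>Every axiom of \<open>B\<close> is the image of one of \<open>A\<close>. This serves for
  quotients and for the far end of an isomorphism. The premise on zero matters: as long as
  \<open>B\<close> is a mere record, a ring homomorphism does not constrain its zero.\<close>

lemma calgebra_hom_surj_imp_calgebra:
  fixes B (structure)
  assumes A: "calgebra A" and f: "f \<in> calgebra_hom A B" and surj: "f ` carrier A = carrier B"
    and z: "f \<zero>\<^bsub>A\<^esub> = \<zero>\<^bsub>B\<^esub>"
  shows "calgebra B"
proof -
  interpret A: calg A using A by (rule calg.intro)
  note h = calgebra_homD[OF f]
  have "ring B"
    using A.ring_hom_imp_img_ring[of f B] f surj z unfolding calgebra_hom_def by auto
  then show ?thesis
    by (rule calgebraI)
      (auto simp flip: surj h(2,3,5)
        simp: A.scale_add_left A.scale_add_right A.scale_scale A.scale_mult_left A.scale_mult_right)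
qed

section \<open>Universal enveloping algebras\<close>

lemma single_add_induct [case_names zero add]:
  fixes p :: "'a \<Rightarrow>\<^sub>0 'b :: comm_monoid_add"
  assumes "P 0"
    and "\<And>w c p. w \<notin> Poly_Mapping.keys p \<Longrightarrow> c \<noteq> 0 \<Longrightarrow> P p \<Longrightarrow> P (Poly_Mapping.single w c + p)"
  shows "P p"
proof (induction p rule: Poly_Mapping.update_induct)
  case (update p w c)
  have "Poly_Mapping.update w c p = Poly_Mapping.single w c + p"
    using update(1)
    by (intro poly_mapping_eqI) (auto simp: lookup_update lookup_add lookup_single in_keys_iff)
  then show ?case
    using assms(2) update by simp
qed (fact assms(1))

lemma keys_single_add:
  assumes "w \<notin> Poly_Mapping.keys p" "c \<noteq> 0"
  shows "Poly_Mapping.keys (Poly_Mapping.single w c + p) = insert w (Poly_Mapping.keys p)"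
  using assms by (auto simp: in_keys_iff lookup_add lookup_single when_def split: if_splits)

lemma free_algebra_carrier:
  "carrier (free_algebra X) = {p. \<forall>w \<in> Poly_Mapping.keys p. set (letters w) \<subseteq> X}"
  by (simp add: free_algebra_def)

lemma free_algebra_simps [simp]:
  "p \<otimes>\<^bsub>free_algebra X\<^esub> q = p * q" "\<one>\<^bsub>free_algebra X\<^esub> = 1" "\<zero>\<^bsub>free_algebra X\<^esub> = 0"
  "p \<oplus>\<^bsub>free_algebra X\<^esub> q = p + q" "c \<odot>\<^bsub>free_algebra X\<^esub> p = Poly_Mapping.single 0 c * p"
  by (simp_all add: free_algebra_def)

lemma free_algebra_add_closed:
  "p \<in> carrier (free_algebra X) \<Longrightarrow> q \<in> carrier (free_algebra X) \<Longrightarrow> p + q \<in> carrier (free_algebra X)"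
  using Poly_Mapping.keys_add[of p q] by (auto simp: free_algebra_carrier)

lemma free_algebra_mult_closed:
  assumes "p \<in> carrier (free_algebra X)" "q \<in> carrier (free_algebra X)"
  shows "p * q \<in> carrier (free_algebra X)"
  using assms keys_mult[of p q] by (force simp: plus_word_def free_algebra_carrier)

lemma free_algebra_single_closed:
  "set (letters w) \<subseteq> X \<Longrightarrow> Poly_Mapping.single w c \<in> carrier (free_algebra X)"
  by (auto simp: free_algebra_carrier)

lemma free_algebra_one_closed: "1 \<in> carrier (free_algebra X)"
  by (simp add: free_algebra_carrier zero_word_def flip: single_one)

text \<open>Scalars sit at the empty word, which commutes with every word. Multiplication by them is
  therefore compatible with both factors of a product.\<close>

lemma single_zero_commutes:
  fixes p :: "'x ncpoly"
  shows "Poly_Mapping.single 0 c * p = p * Poly_Mapping.single 0 c"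
  by (induction p rule: single_add_induct)
    (simp_all add: mult_single mult.commute distrib_left distrib_right)

lemma calgebra_free_algebra: "calgebra (free_algebra X)"
proof (rule calgebraI)
  show "ring (free_algebra X)"
  proof (rule ringI)
    show "abelian_group (free_algebra X)"
    proof (rule abelian_groupI)
      fix p assume "p \<in> carrier (free_algebra X)"
      then show "\<exists>q \<in> carrier (free_algebra X). q \<oplus>\<^bsub>free_algebra X\<^esub> p = \<zero>\<^bsub>free_algebra X\<^esub>"
        by (intro bexI[of _ "- p"]) (auto simp: free_algebra_carrier)
    next
      show "\<zero>\<^bsub>free_algebra X\<^esub> \<in> carrier (free_algebra X)"
        by (simp add: free_algebra_carrier)
    qed (auto simp: ac_simps intro: free_algebra_add_closed)
    show "Group.monoid (free_algebra X)"
      by (rule monoidI)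
        (auto simp: mult.assoc intro: free_algebra_mult_closed free_algebra_one_closed)
  qed (auto simp: algebra_simps)
next
  fix c p assume "p \<in> carrier (free_algebra X)"
  then show "c \<odot>\<^bsub>free_algebra X\<^esub> p \<in> carrier (free_algebra X)"
    using free_algebra_mult_closed[OF free_algebra_single_closed[of 0 X c], of p]
    by (simp add: zero_word_def)
next
  fix c and p q :: "'a ncpoly"
  show "c \<odot>\<^bsub>free_algebra X\<^esub> (p \<otimes>\<^bsub>free_algebra X\<^esub> q)
    = p \<otimes>\<^bsub>free_algebra X\<^esub> (c \<odot>\<^bsub>free_algebra X\<^esub> q)"
    by (simp add: single_zero_commutes mult.assoc)
qed (auto simp: algebra_simps single_add simp flip: mult_single[of 0 _ 0, simplified])

lemma letter_closed: "x \<in> X \<Longrightarrow> letter x \<in> carrier (free_algebra X)"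
  by (auto simp: letter_def free_algebra_carrier)

lemma free_algebra_generated:
  assumes "p \<in> carrier (free_algebra X)"
  shows "p \<in> generated_subalgebra (free_algebra X) (letter ` X)"
proof -
  let ?G = "generated_subalgebra (free_algebra X) (letter ` X)"
  have word: "Poly_Mapping.single (Word xs) 1 \<in> ?G" if "set xs \<subseteq> X" for xs
    using that
  proof (induction xs)
    case Nil
    then show ?case
      using generated_subalgebra.one[of "free_algebra X" "letter ` X"] by (simp flip: zero_word_def)
  next
    case (Cons x xs)
    have "Poly_Mapping.single (Word (x # xs)) 1 = letter x * Poly_Mapping.single (Word xs) 1"
      by (simp add: letter_def mult_single plus_word_def)
    then show ?case
      using Cons generated_subalgebra.mult[of "letter x" "free_algebra X" "letter ` X"]
        generated_subalgebra.incl[of "letter x" "letter ` X" "free_algebra X"] by auto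
  qed
  have single: "Poly_Mapping.single w c \<in> ?G" if "set (letters w) \<subseteq> X" for w c
    using generated_subalgebra.smult[OF word[OF that], of c] by (simp add: mult_single)
  show ?thesis
    using assms
  proof (induction p rule: single_add_induct)
    case zero
    show ?case using single[of 0 0] by (simp add: zero_word_def)
  next
    case (add w c p)
    then show ?case
      using generated_subalgebra.add[of "Poly_Mapping.single w c" "free_algebra X" "letter ` X" p]
        single[of w c] by (simp add: keys_single_add free_algebra_carrier)
  qed
qed

context calg
begin

definition word_eval :: "('x \<Rightarrow> 'a) \<Rightarrow> 'x word \<Rightarrow> 'a" where
  "word_eval f w = foldr (\<lambda>x a. f x \<otimes> a) (letters w) \<one>"

text \<open>Substitution of \<open>f x\<close> for the letter \<open>x\<close>, the homomorphism of
  the universal property of the free algebra.\<close>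

definition ncpoly_eval :: "('x \<Rightarrow> 'a) \<Rightarrow> 'x ncpoly \<Rightarrow> 'a" where
  "ncpoly_eval f p = (\<Oplus>w \<in> Poly_Mapping.keys p. Poly_Mapping.lookup p w \<odot> word_eval f w)"

context
  fixes f :: "'x \<Rightarrow> 'a"
  assumes f: "\<And>x. f x \<in> carrier A"
begin

lemma word_eval_closed [simp]: "word_eval f w \<in> carrier A"
proof -
  have "foldr (\<lambda>x a. f x \<otimes> a) xs \<one> \<in> carrier A" for xs
    by (induction xs) (use f in auto)
  then show ?thesis by (simp add: word_eval_def)
qed

lemma word_eval_plus: "word_eval f (v + w) = word_eval f v \<otimes> word_eval f w"
proof -
  have "foldr (\<lambda>x a. f x \<otimes> a) xs (word_eval f w) = foldr (\<lambda>x a. f x \<otimes> a) xs \<one> \<otimes> word_eval f w"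
    and "foldr (\<lambda>x a. f x \<otimes> a) xs \<one> \<in> carrier A" for xs
    by (induction xs) (use f in \<open>auto simp: m_assoc\<close>)
  then show ?thesis by (simp add: word_eval_def plus_word_def)
qed

lemma ncpoly_eval_closed [simp]: "ncpoly_eval f p \<in> carrier A"
  unfolding ncpoly_eval_def by (intro finsum_closed) auto

text \<open>Polynomials with different supports become summable termwise over a common finite index
  set.\<close>

lemma ncpoly_eval_superset:
  assumes "finite K" "Poly_Mapping.keys p \<subseteq> K"
  shows "ncpoly_eval f p = (\<Oplus>w \<in> K. Poly_Mapping.lookup p w \<odot> word_eval f w)"
  unfolding ncpoly_eval_def
  by (rule add.finprod_mono_neutral_cong_left) (use assms in \<open>auto simp: in_keys_iff\<close>)

lemma ncpoly_eval_add: "ncpoly_eval f (p + q) = ncpoly_eval f p \<oplus> ncpoly_eval f q"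
proof -
  let ?K = "Poly_Mapping.keys p \<union> Poly_Mapping.keys q"
  have "ncpoly_eval f (p + q) = (\<Oplus>w \<in> ?K. Poly_Mapping.lookup (p + q) w \<odot> word_eval f w)"
    by (rule ncpoly_eval_superset) (use Poly_Mapping.keys_add[of p q] in auto)
  also have "\<dots> = (\<Oplus>w \<in> ?K. Poly_Mapping.lookup p w \<odot> word_eval f w
      \<oplus> Poly_Mapping.lookup q w \<odot> word_eval f w)"
    by (simp add: lookup_add scale_add_left)
  also have "\<dots> = ncpoly_eval f p \<oplus> ncpoly_eval f q"
    by (subst finsum_addf) (auto simp: ncpoly_eval_superset[of ?K])
  finally show ?thesis .
qed

lemma ncpoly_eval_single: "ncpoly_eval f (Poly_Mapping.single w c) = c \<odot> word_eval f w"
  by (subst ncpoly_eval_superset[of "{w}"]) auto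

lemma ncpoly_eval_zero [simp]: "ncpoly_eval f 0 = \<zero>"
  by (simp add: ncpoly_eval_def)

lemma ncpoly_eval_mult: "ncpoly_eval f (p * q) = ncpoly_eval f p \<otimes> ncpoly_eval f q"
proof (induction p rule: single_add_induct)
  case (add v c p)
  have "ncpoly_eval f (Poly_Mapping.single v c * q)
      = ncpoly_eval f (Poly_Mapping.single v c) \<otimes> ncpoly_eval f q"
    by (induction q rule: single_add_induct)
      (simp_all add: mult_single ncpoly_eval_single ncpoly_eval_add word_eval_plus distrib_left
        r_distr scale_mult_left scale_mult_right scale_scale mult.commute)
  then show ?case
    using add by (simp add: ncpoly_eval_add distrib_right l_distr)
qed simp

lemma ncpoly_eval_letter [simp]: "ncpoly_eval f (letter x) = f x"
  by (simp add: letter_def ncpoly_eval_single word_eval_def f)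

lemma ncpoly_eval_hom: "ncpoly_eval f \<in> calgebra_hom (free_algebra X) A"
proof (rule calgebra_homI)
  show "ncpoly_eval f \<one>\<^bsub>free_algebra X\<^esub> = \<one>"
    by (simp add: word_eval_def zero_word_def ncpoly_eval_single flip: single_one)
qed (simp_all add: ncpoly_eval_add ncpoly_eval_mult ncpoly_eval_single scale_mult_left
    word_eval_def zero_word_def)

end

end


section \<open>Quotient algebras\<close>

lemma quotient_algebra_simps:
  "carrier (quotient_algebra A I) = a_rcosets\<^bsub>A\<^esub> I"
  "X \<otimes>\<^bsub>quotient_algebra A I\<^esub> Y = rcoset_mult A I X Y"
  "X \<oplus>\<^bsub>quotient_algebra A I\<^esub> Y = X <+>\<^bsub>A\<^esub> Y"
  "\<one>\<^bsub>quotient_algebra A I\<^esub> = I +>\<^bsub>A\<^esub> \<one>\<^bsub>A\<^esub>" "\<zero>\<^bsub>quotient_algebra A I\<^esub> = I"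
  "c \<odot>\<^bsub>quotient_algebra A I\<^esub> X = I <+>\<^bsub>A\<^esub> ((\<lambda>x. c \<odot>\<^bsub>A\<^esub> x) ` X)"
  by (simp_all add: quotient_algebra_def FactRing_def ring.extend_def module.fields_def)

context calg
begin

text \<open>Scaling by \<open>c\<close> is multiplication by \<open>c \<odot> \<one>\<close>, which
  a ring ideal absorbs.\<close>

lemma ideal_scale:
  assumes "ideal I A" "x \<in> I"
  shows "c \<odot> x \<in> I"
proof -
  interpret I: ideal I A by fact
  have "(c \<odot> \<one>) \<otimes> x \<in> I"
    using assms I.I_l_closed by simp
  then show ?thesis
    using I.a_Hcarr[OF assms(2)] by (simp add: scale_mult_left)
qed

lemma coset_hom:
  assumes "ideal I A"
  shows "(\<lambda>x. I +> x) \<in> calgebra_hom A (quotient_algebra A I)"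
proof -
  interpret I: ideal I A by fact
  have h: "(+>) I \<in> ring_hom A (A Quot I)"
    by (rule I.rcos_ring_hom)
  show ?thesis
  proof (rule calgebra_homI)
    fix c x assume x: "x \<in> carrier A"
    show "I +> c \<odot> x = c \<odot>\<^bsub>quotient_algebra A I\<^esub> (I +> x)"
    proof
      show "I +> c \<odot> x \<subseteq> c \<odot>\<^bsub>quotient_algebra A I\<^esub> (I +> x)"
      proof
        fix y assume "y \<in> I +> c \<odot> x"
        then obtain i where i: "i \<in> I" "y = i \<oplus> c \<odot> x"
          by (auto simp: a_r_coset_def')
        have "x \<in> I +> x"
          using x I.a_rcos_self by simp
        with i show "y \<in> c \<odot>\<^bsub>quotient_algebra A I\<^esub> (I +> x)"
          by (auto simp: quotient_algebra_simps set_add_def')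
      qed
      show "c \<odot>\<^bsub>quotient_algebra A I\<^esub> (I +> x) \<subseteq> I +> c \<odot> x"
      proof
        fix y assume "y \<in> c \<odot>\<^bsub>quotient_algebra A I\<^esub> (I +> x)"
        then obtain i j where ij: "i \<in> I" "j \<in> I" "y = i \<oplus> c \<odot> (j \<oplus> x)"
          by (auto simp: quotient_algebra_simps set_add_def' a_r_coset_def')
        then have "y = (i \<oplus> c \<odot> j) \<oplus> c \<odot> x" "i \<oplus> c \<odot> j \<in> I"
          using x I.a_Hcarr ideal_scale[OF assms] by (auto simp: scale_add_right a_assoc)
        then show "y \<in> I +> c \<odot> x"
          by (auto simp: a_r_coset_def')
      qed
    qed
  next
    show "I +> \<one> = \<one>\<^bsub>quotient_algebra A I\<^esub>"
      by (simp add: quotient_algebra_simps)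
  next
    have Q: "carrier (quotient_algebra A I) = carrier (A Quot I)"
      "mult (quotient_algebra A I) = mult (A Quot I)"
      "add (quotient_algebra A I) = add (A Quot I)"
      by (simp_all add: quotient_algebra_def ring.extend_def)
    fix x y assume xy: "x \<in> carrier A" "y \<in> carrier A"
    show "I +> x \<in> carrier (quotient_algebra A I)"
      unfolding Q by (rule ring_hom_closed[OF h xy(1)])
    show "I +> x \<otimes> y = (I +> x) \<otimes>\<^bsub>quotient_algebra A I\<^esub> (I +> y)"
      unfolding Q by (rule ring_hom_mult[OF h xy])
    show "I +> (x \<oplus> y) = (I +> x) \<oplus>\<^bsub>quotient_algebra A I\<^esub> (I +> y)"
      unfolding Q by (rule ring_hom_add[OF h xy])
  qed
qed

lemma calgebra_quotient:
  assumes "ideal I A"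
  shows "calgebra (quotient_algebra A I)"
proof (rule calgebra_hom_surj_imp_calgebra[OF is_calgebra coset_hom[OF assms]])
  interpret I: ideal I A by fact
  show "(\<lambda>x. I +> x) ` carrier A = carrier (quotient_algebra A I)"
    by (auto simp: quotient_algebra_simps A_RCOSETS_def')
  show "I +> \<zero> = \<zero>\<^bsub>quotient_algebra A I\<^esub>"
    using a_coset_join2[OF zero_closed I.a_subgroup I.zero_closed] by (simp add: quotient_algebra_simps)
qed

end

lemma generated_subalgebra_hom_image:
  assumes "calgebra A" "H \<subseteq> carrier A" "f \<in> calgebra_hom A B" "x \<in> generated_subalgebra A H"
  shows "f x \<in> generated_subalgebra B (f ` H)"
proof -
  interpret A: calg A using assms(1) by (rule calg.intro)
  note f = calgebra_homD[OF assms(3)]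
  show ?thesis
    using assms(4)
    by induction (use f A.generated_subalgebra_closed[OF assms(2)] in
      \<open>auto intro: generated_subalgebra.intros\<close>)
qed

section \<open>Generation and universal property of the enveloping algebra\<close>

locale matrix_lie_algebra =
  fixes g :: "complex mat set"
  assumes add_closed: "x \<in> g \<Longrightarrow> y \<in> g \<Longrightarrow> x + y \<in> g"
    and smult_closed: "x \<in> g \<Longrightarrow> c \<cdot>\<^sub>m x \<in> g"
    and bracket_closed: "x \<in> g \<Longrightarrow> y \<in> g \<Longrightarrow> x * y - y * x \<in> g"
begin

abbreviation "U \<equiv> univ_env g"
abbreviation "\<iota> \<equiv> env_of g"

sublocale F: calg "free_algebra g"
  using calgebra_free_algebra by (rule calg.intro)

lemma free_minus: "p \<in> carrier (free_algebra g) \<Longrightarrow> q \<in> carrier (free_algebra g)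
    \<Longrightarrow> p \<ominus>\<^bsub>free_algebra g\<^esub> q = p - q"
  using F.minus_equality[of "- q" q] by (simp add: a_minus_def free_algebra_carrier)

lemma env_relations_closed: "env_relations g \<subseteq> carrier (free_algebra g)"
proof
  fix r assume r: "r \<in> env_relations g"
  note d = F.minus_closed
  note l = letter_closed[of _ g]
  show "r \<in> carrier (free_algebra g)"
    using r unfolding env_relations_def
  proof (elim UnE CollectE exE conjE)
    fix x y assume "r = letter (x + y) - letter x - letter y" "x \<in> g" "y \<in> g"
    then show ?thesis
      using d[OF d[OF l l] l, of "x + y" x y] d[OF l l, of "x + y" x] add_closed
      by (simp add: free_minus l)
  next
    fix c x assume "r = letter (c \<cdot>\<^sub>m x) - Poly_Mapping.single 0 c * letter x" "x \<in> g"
    then show ?thesis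
      using d[OF l F.scale_closed[OF l], of "c \<cdot>\<^sub>m x" x c] smult_closed F.scale_closed[OF l, of x c]
      by (simp add: free_minus l)
  next
    fix x y
    assume "r = letter x * letter y - letter y * letter x - letter (x * y - y * x)" "x \<in> g" "y \<in> g"
    then show ?thesis
      using d[OF d[OF F.m_closed[OF l l] F.m_closed[OF l l]] l, of x y y x "x * y - y * x"]
        d[OF F.m_closed[OF l l] F.m_closed[OF l l], of x y y x] bracket_closed
        F.m_closed[OF l l, of x y] F.m_closed[OF l l, of y x]
      by (simp add: free_minus l)
  qed
qed

lemma ideal_env: "ideal (env_ideal g) (free_algebra g)"
  unfolding env_ideal_def using F.genideal_ideal[OF env_relations_closed] .

lemma env_relations_in_ideal: "r \<in> env_relations g \<Longrightarrow> r \<in> env_ideal g"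
  unfolding env_ideal_def using F.genideal_self[OF env_relations_closed] by auto

sublocale U: calg U
  unfolding univ_env_def using F.calgebra_quotient[OF ideal_env] by (rule calg.intro)

definition proj :: "complex mat ncpoly \<Rightarrow> env" where
  "proj p = env_ideal g +>\<^bsub>free_algebra g\<^esub> p"

lemma proj_hom: "proj \<in> calgebra_hom (free_algebra g) U"
  unfolding univ_env_def proj_def using F.coset_hom[OF ideal_env] .

lemmas proj_simps = calgebra_homD(2-5)[OF proj_hom, symmetric]

lemma proj_surj: "carrier U = proj ` carrier (free_algebra g)"
  by (auto simp: univ_env_def quotient_algebra_simps A_RCOSETS_def' proj_def)

lemma env_of_proj: "\<iota> x = proj (letter x)"
  by (simp add: env_of_def proj_def)

lemma proj_eq_zero: "p \<in> env_ideal g \<Longrightarrow> proj p = \<zero>\<^bsub>U\<^esub>"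
  using F.a_coset_join2[OF ideal.Icarr[OF ideal_env] additive_subgroup.a_subgroup]
    ideal.axioms(1)[OF ideal_env]
  by (simp add: proj_def univ_env_def quotient_algebra_simps)

lemma proj_diff: "p \<in> carrier (free_algebra g) \<Longrightarrow> q \<in> carrier (free_algebra g)
    \<Longrightarrow> proj (p - q) = proj p \<ominus>\<^bsub>U\<^esub> proj q"
  using calgebra_hom_diff[OF F.is_calgebra U.is_calgebra proj_hom] by (simp add: free_minus)

lemma proj_eq:
  assumes "p \<in> carrier (free_algebra g)" "q \<in> carrier (free_algebra g)" "p - q \<in> env_ideal g"
  shows "proj p = proj q"
  using proj_diff[OF assms(1,2)] proj_eq_zero[OF assms(3)]
    U.diff_eq_zero_iff[OF calgebra_homD(1)[OF proj_hom assms(1)] calgebra_homD(1)[OF proj_hom assms(2)]]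
  by simp

lemma env_of_closed [simp, intro]: "x \<in> g \<Longrightarrow> \<iota> x \<in> carrier U"
  using letter_closed[of x g] by (auto simp: env_of_proj proj_surj)

lemma env_of_add: assumes "x \<in> g" "y \<in> g" shows "\<iota> (x + y) = \<iota> x \<oplus>\<^bsub>U\<^esub> \<iota> y"
proof -
  note l = letter_closed[of x g] letter_closed[of y g] letter_closed[of "x + y" g]
  have "letter (x + y) - letter x - letter y \<in> env_ideal g"
    by (rule env_relations_in_ideal) (unfold env_relations_def, use assms in blast)
  then have "letter (x + y) - (letter x + letter y) \<in> env_ideal g"
    by (simp add: diff_diff_eq)
  then have "proj (letter (x + y)) = proj (letter x + letter y)"
    using l assms add_closed free_algebra_add_closed by (intro proj_eq) blast+
  then show ?thesis
    using calgebra_homD(3)[OF proj_hom l(1,2)] assms by (simp add: env_of_proj)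
qed

lemma env_of_smult: assumes "x \<in> g" shows "\<iota> (c \<cdot>\<^sub>m x) = c \<odot>\<^bsub>U\<^esub> \<iota> x"
proof -
  note l = letter_closed[of x g] letter_closed[of "c \<cdot>\<^sub>m x" g]
  have "letter (c \<cdot>\<^sub>m x) - Poly_Mapping.single 0 c * letter x \<in> env_ideal g"
    by (rule env_relations_in_ideal) (unfold env_relations_def, use assms in blast)
  then have "proj (letter (c \<cdot>\<^sub>m x)) = proj (Poly_Mapping.single 0 c * letter x)"
    using l assms smult_closed F.scale_closed[of "letter x" c] by (intro proj_eq) simp_all
  then show ?thesis
    using calgebra_homD(5)[OF proj_hom l(1)] assms by (simp add: env_of_proj)
qed

lemma env_of_bracket:
  assumes "x \<in> g" "y \<in> g"
  shows "\<iota> x \<otimes>\<^bsub>U\<^esub> \<iota> y \<ominus>\<^bsub>U\<^esub> \<iota> y \<otimes>\<^bsub>U\<^esub> \<iota> x = \<iota> (x * y - y * x)"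
proof -
  note l = letter_closed[of x g] letter_closed[of y g] letter_closed[of "x * y - y * x" g]
  have xy: "letter x * letter y \<in> carrier (free_algebra g)" "letter y * letter x \<in> carrier (free_algebra g)"
    using free_algebra_mult_closed l assms by blast+
  have "(letter x * letter y - letter y * letter x) - letter (x * y - y * x) \<in> env_ideal g"
    by (rule env_relations_in_ideal) (unfold env_relations_def, use assms in blast)
  moreover have "letter x * letter y - letter y * letter x \<in> carrier (free_algebra g)"
    using F.minus_closed[OF xy] by (simp only: free_minus[OF xy])
  ultimately have "proj (letter x * letter y - letter y * letter x) = proj (letter (x * y - y * x))"
    using l(3)[OF bracket_closed[OF assms]] by (intro proj_eq)
  then show ?thesis
    using calgebra_homD(2)[OF proj_hom l(1)[OF assms(1)] l(2)[OF assms(2)]]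
      calgebra_homD(2)[OF proj_hom l(2)[OF assms(2)] l(1)[OF assms(1)]]
      proj_diff[OF xy]
    by (simp add: env_of_proj)
qed

text \<open>The letters generate the free algebra and \<open>proj\<close> is onto. Statements about
  all of the enveloping algebra are later proved by induction along this generation.\<close>

lemma env_generated:
  assumes "u \<in> carrier U"
  shows "u \<in> generated_subalgebra U (\<iota> ` g)"
proof -
  obtain p where "p \<in> carrier (free_algebra g)" "u = proj p"
    using assms proj_surj by auto
  then show ?thesis
    using generated_subalgebra_hom_image[OF F.is_calgebra _ proj_hom free_algebra_generated, of p]
      letter_closed[of _ g]
    by (simp add: image_subset_iff image_image env_of_proj)
qed

lemma env_hom_unique:
  assumes "F \<in> calgebra_hom U A" "G \<in> calgebra_hom U A" "\<And>x. x \<in> g \<Longrightarrow> F (\<iota> x) = G (\<iota> x)"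
    and "u \<in> carrier U"
  shows "F u = G u"
  by (rule calgebra_hom_eq_on_generated[OF U.is_calgebra _ assms(1,2) _ env_generated[OF assms(4)]])
    (use assms(3) in auto)

text \<open>Evaluation at \<open>f\<close> kills the three kinds of relations, hence the ideal
  generated by them, and so factors through the cosets.\<close>

lemma env_hom_exists:
  fixes A (structure)
  assumes A: "calgebra A" and f: "\<And>x. x \<in> g \<Longrightarrow> f x \<in> carrier A"
    and add: "\<And>x y. x \<in> g \<Longrightarrow> y \<in> g \<Longrightarrow> f (x + y) = f x \<oplus> f y"
    and smult: "\<And>c x. x \<in> g \<Longrightarrow> f (c \<cdot>\<^sub>m x) = c \<odot> f x"
    and bracket: "\<And>x y. x \<in> g \<Longrightarrow> y \<in> g \<Longrightarrow> f (x * y - y * x) = f x \<otimes> f y \<ominus> f y \<otimes> f x"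
  shows "\<exists>F \<in> calgebra_hom U A. \<forall>x \<in> g. F (\<iota> x) = f x"
proof -
  interpret A: calg A using A by (rule calg.intro)
  \<comment> \<open>The evaluation requires a value in \<open>A\<close> for every matrix, so
    \<open>f\<close> is extended by zero outside \<open>g\<close>.\<close>
  define f' where "f' x = (if x \<in> g then f x else \<zero>)" for x
  have f': "f' x \<in> carrier A" for x
    using f by (simp add: f'_def)
  define e where "e = A.ncpoly_eval f'"
  have e_hom: "e \<in> calgebra_hom (free_algebra g) A"
    unfolding e_def by (rule A.ncpoly_eval_hom[of f', OF f'])
  note e = calgebra_homD[OF e_hom]
  have e_diff: "e (p - q) = e p \<ominus> e q" for p q
  proof -
    have "e (p - q) \<oplus> e q = e p"
      unfolding e_def by (simp flip: A.ncpoly_eval_add[of f', OF f'])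
    moreover have "e p \<in> carrier A" for p
      unfolding e_def by (rule A.ncpoly_eval_closed[of f', OF f'])
    ultimately show ?thesis
      using A.add.inv_solve_right[of "e (p - q)" "e p" "e q"] by (simp add: a_minus_def)
  qed
  have e_mult: "e (p * q) = e p \<otimes> e q" and e_add: "e (p + q) = e p \<oplus> e q" for p q
    unfolding e_def using A.ncpoly_eval_mult[of f', OF f'] A.ncpoly_eval_add[of f', OF f'] by auto
  have e_letter: "e (letter x) = f' x" for x
    unfolding e_def by (rule A.ncpoly_eval_letter[of f', OF f'])
  have e_const: "e (Poly_Mapping.single 0 c * letter x) = c \<odot> f x" if "x \<in> g" for c x
    using e(5)[OF letter_closed[OF that]] e_letter[of x] that by (simp add: f'_def)
  interpret I: ideal "env_ideal g" "free_algebra g"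
    by (rule ideal_env)
  interpret e: ring_hom_ring "free_algebra g" A e
    by (rule ring_hom_ringI2) (use e_hom F.ring_axioms A.ring_axioms in \<open>auto simp: calgebra_hom_def\<close>)
  have "e r = \<zero>" if "r \<in> env_relations g" for r
    using that unfolding env_relations_def
  proof (elim UnE CollectE exE conjE)
    fix x y assume r: "r = letter (x + y) - letter x - letter y" and g: "x \<in> g" "y \<in> g"
    have "e r = e (letter (x + y) - (letter x + letter y))"
      by (simp add: r diff_diff_eq)
    also have "\<dots> = (f x \<oplus> f y) \<ominus> (f x \<oplus> f y)"
      using g by (simp add: e_diff e_add e_letter f'_def add_closed add)
    finally show ?thesis
      using f g by (simp add: A.diff_eq_zero_iff)
  next
    fix c x assume r: "r = letter (c \<cdot>\<^sub>m x) - Poly_Mapping.single 0 c * letter x" and g: "x \<in> g"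
    then have "e r = c \<odot> f x \<ominus> c \<odot> f x"
      by (simp add: e_diff e_const e_letter f'_def smult_closed smult)
    then show ?thesis
      using f g by (simp add: A.diff_eq_zero_iff)
  next
    fix x y assume r: "r = letter x * letter y - letter y * letter x - letter (x * y - y * x)"
      and g: "x \<in> g" "y \<in> g"
    then have "e r = (f x \<otimes> f y \<ominus> f y \<otimes> f x) \<ominus> (f x \<otimes> f y \<ominus> f y \<otimes> f x)"
      by (simp add: e_diff e_mult e_letter f'_def bracket_closed bracket)
    then show ?thesis
      using f g by (simp add: A.diff_eq_zero_iff)
  qed
  then have "env_relations g \<subseteq> a_kernel (free_algebra g) A e"
    unfolding a_kernel_def' using env_relations_closed by blast
  then have ker: "env_ideal g \<subseteq> a_kernel (free_algebra g) A e"
    unfolding env_ideal_def by (rule F.genideal_minimal[OF e.kernel_is_ideal])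
  \<comment> \<open>A coset is evaluated at an arbitrary representative; two representatives differ
    by an element of the kernel of \<open>e\<close>.\<close>
  define F where "F X = e (SOME p. p \<in> X)" for X
  have F: "F (proj p) = e p" if p: "p \<in> carrier (free_algebra g)" for p
  proof -
    have "p \<in> proj p"
      unfolding proj_def by (rule I.a_rcos_self[OF p])
    then have "(SOME q. q \<in> proj p) \<in> proj p"
      by (rule someI)
    then obtain i where i: "i \<in> env_ideal g" "(SOME q. q \<in> proj p) = i + p"
      by (auto simp: proj_def a_r_coset_def')
    moreover have "e i = \<zero>"
      using subsetD[OF ker i(1)] unfolding a_kernel_def' by blast
    ultimately show ?thesis
      unfolding F_def i(2) e_add using A.l_zero[OF e(1)[OF p]] by simp
  qed
  have "F \<in> calgebra_hom U A"
  proof (rule calgebra_homI)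
    show "F \<one>\<^bsub>U\<^esub> = \<one>"
      using F[OF F.one_closed] e(4) calgebra_homD(4)[OF proj_hom] by simp
  qed (use e F F.m_closed F.a_closed F.scale_closed in
      \<open>auto simp: proj_surj proj_simps\<close>)
  moreover have "F (\<iota> x) = f x" if "x \<in> g" for x
    using F[OF letter_closed[OF that]] that by (simp add: env_of_proj e_letter f'_def)
  ultimately show ?thesis by blast
qed

text \<open>Restricting the extension to the carrier makes it unique as a function, so the definite
  description denotes it.\<close>

lemma env_lift:
  fixes A (structure)
  assumes A: "calgebra A" and f: "\<And>x. x \<in> g \<Longrightarrow> f x \<in> carrier A"
    and add: "\<And>x y. x \<in> g \<Longrightarrow> y \<in> g \<Longrightarrow> f (x + y) = f x \<oplus> f y"
    and smult: "\<And>c x. x \<in> g \<Longrightarrow> f (c \<cdot>\<^sub>m x) = c \<odot> f x"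
    and bracket: "\<And>x y. x \<in> g \<Longrightarrow> y \<in> g \<Longrightarrow> f (x * y - y * x) = f x \<otimes> f y \<ominus> f y \<otimes> f x"
  shows "env_lift g A f \<in> calgebra_hom U A" "x \<in> g \<Longrightarrow> env_lift g A f (\<iota> x) = f x"
proof -
  obtain F where F: "F \<in> calgebra_hom U A" "\<forall>x \<in> g. F (\<iota> x) = f x"
    using env_hom_exists[OF assms] by blast
  let ?P = "\<lambda>F. F \<in> calgebra_hom U A \<inter> extensional (carrier U) \<and> (\<forall>x \<in> g. F (\<iota> x) = f x)"
  have "restrict F (carrier U) \<in> calgebra_hom U A"
    by (rule calgebra_homI) (use calgebra_homD[OF F(1)] in auto)
  then have P: "?P (restrict F (carrier U))"
    using F(2) by auto
  have "G = restrict F (carrier U)" if "?P G" for G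
    by (rule extensionalityI[of _ "carrier U"]) (use that F in \<open>auto intro: env_hom_unique\<close>)
  then have "?P (env_lift g A f)"
    unfolding env_lift_def using P by (intro theI[of ?P])
  then show "env_lift g A f \<in> calgebra_hom U A" "x \<in> g \<Longrightarrow> env_lift g A f (\<iota> x) = f x"
    by auto
qed

end

section \<open>Ore localization\<close>

text \<open>The conditions for left fractions: \<open>ore\<close> produces numerators that can be
  moved past a denominator, and \<open>reversible\<close> turns right torsion into left torsion,
  since zero divisors are not excluded.\<close>

locale left_ore = calg +
  fixes S :: "'a set"
  assumes S_subset: "S \<subseteq> carrier A" and one_S [simp, intro]: "\<one> \<in> S"
    and mult_S [simp, intro]: "s \<in> S \<Longrightarrow> t \<in> S \<Longrightarrow> s \<otimes> t \<in> S"
    and ore: "u \<in> carrier A \<Longrightarrow> s \<in> S \<Longrightarrow> \<exists>t \<in> S. \<exists>v \<in> carrier A. t \<otimes> u = v \<otimes> s"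
    and reversible: "u \<in> carrier A \<Longrightarrow> s \<in> S \<Longrightarrow> u \<otimes> s = \<zero> \<Longrightarrow> \<exists>t \<in> S. t \<otimes> u = \<zero>"
begin

abbreviation "L \<equiv> localization A S"

definition frac :: "'a \<Rightarrow> 'a \<Rightarrow> ('a \<times> 'a) set" where
  "frac s u = fraction_rel A S `` {(s, u)}"

lemma S_closed [simp]: "s \<in> S \<Longrightarrow> s \<in> carrier A"
  using S_subset by auto

lemma fraction_rel_iff:
  "((s, u), (t, v)) \<in> fraction_rel A S \<longleftrightarrow> s \<in> S \<and> t \<in> S \<and> u \<in> carrier A \<and> v \<in> carrier A \<and>
    (\<exists>a \<in> carrier A. \<exists>b \<in> carrier A. a \<otimes> s = b \<otimes> t \<and> a \<otimes> s \<in> S \<and> a \<otimes> u = b \<otimes> v)"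
  by (auto simp: fraction_rel_def)

text \<open>Cancelling \<open>s\<close> on the right costs a factor \<open>t\<close> on the left:
  \<open>reversible\<close> is applied to \<open>a \<ominus> b\<close>.\<close>

lemma left_cancel_after:
  assumes "a \<in> carrier A" "b \<in> carrier A" "s \<in> S" "a \<otimes> s = b \<otimes> s"
  shows "\<exists>t \<in> S. t \<otimes> a = t \<otimes> b"
proof -
  have "(a \<ominus> b) \<otimes> s = \<zero>"
    using assms by (simp add: a_minus_def l_distr l_minus r_neg)
  then obtain t where "t \<in> S" "t \<otimes> (a \<ominus> b) = \<zero>"
    using reversible[of "a \<ominus> b" s] assms by auto
  then have "t \<otimes> a \<ominus> t \<otimes> b = \<zero>"
    using assms by (simp add: a_minus_def r_distr r_minus)
  then show ?thesis
    using \<open>t \<in> S\<close> assms diff_eq_zero_iff[of "t \<otimes> a" "t \<otimes> b"] by auto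
qed

text \<open>Here \<open>c\<close> itself is no denominator, only \<open>c \<otimes> t\<close> is.
  The Ore condition is applied to \<open>x \<otimes> t\<close> and \<open>c \<otimes> t\<close>, and
  then \<open>t\<close> is cancelled on the right.\<close>

lemma ore_factor:
  assumes "x \<in> carrier A" "c \<in> carrier A" "t \<in> S" "c \<otimes> t \<in> S"
  shows "\<exists>p \<in> S. \<exists>q \<in> carrier A. p \<otimes> x = q \<otimes> c"
proof -
  obtain p q where pq: "p \<in> S" "q \<in> carrier A" "p \<otimes> (x \<otimes> t) = q \<otimes> (c \<otimes> t)"
    using ore[of "x \<otimes> t" "c \<otimes> t"] assms by auto
  then have "(p \<otimes> x) \<otimes> t = (q \<otimes> c) \<otimes> t"
    using assms by (simp add: m_assoc)
  then obtain r where r: "r \<in> S" "r \<otimes> (p \<otimes> x) = r \<otimes> (q \<otimes> c)"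
    using left_cancel_after[of "p \<otimes> x" "q \<otimes> c" t] assms pq by auto
  show ?thesis
    by (rule bexI[of _ "r \<otimes> p"], rule bexI[of _ "r \<otimes> q"]) (use r pq assms in \<open>auto simp: m_assoc\<close>)
qed

text \<open>Here \<open>x\<close> is a numerator to be moved past the fraction whose two representations have
  denominators \<open>t\<close> and \<open>t'\<close>.\<close>

lemma ore_factor2:
  assumes "x \<in> carrier A" "x' \<in> carrier A" "c \<in> carrier A" "d \<in> carrier A" "t \<in> S" "t' \<in> S"
    and "c \<otimes> t = d \<otimes> t'" "c \<otimes> t \<in> S" "x \<otimes> t = x' \<otimes> t'"
  shows "\<exists>p \<in> S. \<exists>q \<in> carrier A. p \<otimes> x = q \<otimes> c \<and> p \<otimes> x' = q \<otimes> d"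
proof -
  obtain p q where pq: "p \<in> S" "q \<in> carrier A" "p \<otimes> x = q \<otimes> c"
    using ore_factor[of x c t] assms by auto
  have "(p \<otimes> x') \<otimes> t' = p \<otimes> (x \<otimes> t)"
    using assms pq by (simp add: m_assoc)
  also have "\<dots> = q \<otimes> (c \<otimes> t)"
    using assms(1,3,5) pq m_assoc[of p x t] by (simp add: m_assoc)
  also have "\<dots> = (q \<otimes> d) \<otimes> t'"
    using assms pq by (simp add: m_assoc)
  finally obtain r where r: "r \<in> S" "r \<otimes> (p \<otimes> x') = r \<otimes> (q \<otimes> d)"
    using left_cancel_after[of "p \<otimes> x'" "q \<otimes> d" t'] assms pq by auto
  show ?thesis
    by (rule bexI[of _ "r \<otimes> p"], rule bexI[of _ "r \<otimes> q"]) (use r pq assms in \<open>auto simp: m_assoc\<close>)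
qed

lemma equiv_fraction_rel: "equiv (S \<times> carrier A) (fraction_rel A S)"
proof (rule equivI)
  show "fraction_rel A S \<subseteq> (S \<times> carrier A) \<times> (S \<times> carrier A)"
    by (auto simp: fraction_rel_def)
  show "refl_on (S \<times> carrier A) (fraction_rel A S)"
    by (rule refl_onI) (auto simp: fraction_rel_iff intro!: bexI[of _ \<one>])
  show "sym (fraction_rel A S)"
    by (rule symI) (auto simp: fraction_rel_iff; metis)
  \<comment> \<open>The two relations expand the middle denominator \<open>t\<close> to
    \<open>b \<otimes> t\<close> and \<open>c \<otimes> t\<close>; \<open>ore_factor\<close> gives a
    common left multiple of \<open>b\<close> and \<open>c\<close>.\<close>
  show "trans (fraction_rel A S)"
  proof (rule transI; clarsimp simp: fraction_rel_iff)
    fix s u t v r w a b c d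
    assume S: "s \<in> S" "t \<in> S" "r \<in> S" and A: "u \<in> carrier A" "v \<in> carrier A" "w \<in> carrier A"
        "a \<in> carrier A" "b \<in> carrier A" "c \<in> carrier A" "d \<in> carrier A"
      and e: "b \<otimes> t \<in> S" "a \<otimes> s = b \<otimes> t" "a \<otimes> u = b \<otimes> v" "d \<otimes> r \<in> S" "c \<otimes> t = d \<otimes> r" "c \<otimes> v = d \<otimes> w"
    obtain p q where pq: "p \<in> S" "q \<in> carrier A" "p \<otimes> b = q \<otimes> c"
      using ore_factor[of b c t] S A e by auto
    have 1: "(p \<otimes> a) \<otimes> s = p \<otimes> (b \<otimes> t)"
      using e S A pq by (simp add: m_assoc)
    also have "\<dots> = (q \<otimes> c) \<otimes> t"
      using S A pq m_assoc[of p b t] by simp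
    finally have 2: "(p \<otimes> a) \<otimes> s = (q \<otimes> d) \<otimes> r"
      using e S A pq by (simp add: m_assoc)
    have "(p \<otimes> a) \<otimes> u = (p \<otimes> b) \<otimes> v"
      using e S A pq(1,2) by (simp add: m_assoc)
    also have "\<dots> = (q \<otimes> d) \<otimes> w"
      using e S A pq by (simp add: m_assoc)
    finally show "\<exists>a \<in> carrier A. \<exists>b \<in> carrier A. a \<otimes> s = b \<otimes> r \<and> a \<otimes> s \<in> S \<and> a \<otimes> u = b \<otimes> w"
      using 1 2 e S A pq
      by (intro bexI[of _ "p \<otimes> a"] bexI[of _ "q \<otimes> d"]) (auto simp: m_assoc)
  qed
qed

lemma frac_eq_iff:
  assumes "s \<in> S" "t \<in> S" "u \<in> carrier A" "v \<in> carrier A"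
  shows "frac s u = frac t v \<longleftrightarrow>
    (\<exists>a \<in> carrier A. \<exists>b \<in> carrier A. a \<otimes> s = b \<otimes> t \<and> a \<otimes> s \<in> S \<and> a \<otimes> u = b \<otimes> v)"
  unfolding frac_def
  using eq_equiv_class_iff[OF equiv_fraction_rel, of "(s, u)" "(t, v)"] assms
  by (simp add: fraction_rel_iff)

lemma frac_eqI:
  assumes "a \<in> carrier A" "b \<in> carrier A" "a \<otimes> s = b \<otimes> t" "a \<otimes> s \<in> S" "a \<otimes> u = b \<otimes> v"
    and "s \<in> S" "t \<in> S" "u \<in> carrier A" "v \<in> carrier A"
  shows "frac s u = frac t v"
  using assms(1-5) frac_eq_iff[OF assms(6-9)] by blast

lemma frac_eqE:
  assumes "frac s u = frac t v" "s \<in> S" "t \<in> S" "u \<in> carrier A" "v \<in> carrier A"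
  obtains a b where "a \<in> carrier A" "b \<in> carrier A" "a \<otimes> s = b \<otimes> t" "a \<otimes> s \<in> S" "a \<otimes> u = b \<otimes> v"
  using assms(1) frac_eq_iff[OF assms(2-5)] by blast

lemma frac_expand:
  "s \<in> S \<Longrightarrow> a \<in> carrier A \<Longrightarrow> a \<otimes> s \<in> S \<Longrightarrow> u \<in> carrier A \<Longrightarrow> frac (a \<otimes> s) (a \<otimes> u) = frac s u"
  by (rule frac_eqI[of \<one> a]) auto

lemma carrier_L: "carrier L = {frac s u | s u. s \<in> S \<and> u \<in> carrier A}"
  by (auto simp: localization_def quotient_def frac_def)

lemma frac_closed [simp, intro]: "s \<in> S \<Longrightarrow> u \<in> carrier A \<Longrightarrow> frac s u \<in> carrier L"
  by (auto simp: carrier_L)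

lemma in_frac_iff:
  "s \<in> S \<Longrightarrow> u \<in> carrier A \<Longrightarrow> (t, v) \<in> frac s u \<longleftrightarrow> t \<in> S \<and> v \<in> carrier A \<and> frac t v = frac s u"
  unfolding frac_def using equiv_class_eq_iff[OF equiv_fraction_rel, of "(s, u)" "(t, v)"]
  by (auto simp: fraction_rel_iff)

lemma self_in_frac: "s \<in> S \<Longrightarrow> u \<in> carrier A \<Longrightarrow> (s, u) \<in> frac s u"
  by (simp add: in_frac_iff)

text \<open>The operations of the localization are images of whole sets of representatives. When all
  members of such a set lie in one class, any single choice computes the result.\<close>

lemma fraction_rel_Image:
  assumes "(s, u) \<in> X" "\<And>t v. (t, v) \<in> X \<Longrightarrow> frac t v = frac s u"
  shows "fraction_rel A S `` X = frac s u"
proof -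
  have "fraction_rel A S `` X = (\<Union>(t, v) \<in> X. frac t v)"
    by (auto simp: frac_def)
  also have "\<dots> = (\<Union>z \<in> X. frac s u)"
    by (rule SUP_cong[OF refl]) (clarify, rule assms(2))
  also have "\<dots> = frac s u"
    using assms(1) by auto
  finally show ?thesis .
qed

text \<open>Independence of representatives: the two summands may be related to their new
  representatives by different multipliers \<open>a, b\<close> and \<open>c, d\<close>, which
  \<open>ore_factor2\<close> brings into agreement.\<close>

lemma add_frac:
  assumes "s \<in> S" "u \<in> carrier A" "v \<in> carrier A"
  shows "frac s u \<oplus>\<^bsub>L\<^esub> frac s v = frac s (u \<oplus> v)"
proof -
  have *: "frac t (u' \<oplus> v') = frac s (u \<oplus> v)"
    if "(t, u') \<in> frac s u" "(t, v') \<in> frac s v" for t u' v'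
  proof -
    have t: "t \<in> S" "u' \<in> carrier A" "v' \<in> carrier A" "frac t u' = frac s u" "frac t v' = frac s v"
      using that assms by (auto simp: in_frac_iff)
    obtain a b where ab: "a \<in> carrier A" "b \<in> carrier A" "a \<otimes> t = b \<otimes> s" "a \<otimes> t \<in> S" "a \<otimes> u' = b \<otimes> u"
      by (rule frac_eqE[OF t(4,1) assms(1) t(2) assms(2)])
    obtain c d where cd: "c \<in> carrier A" "d \<in> carrier A" "c \<otimes> t = d \<otimes> s" "c \<otimes> t \<in> S" "c \<otimes> v' = d \<otimes> v"
      by (rule frac_eqE[OF t(5,1) assms(1) t(3) assms(3)])
    obtain p q where pq: "p \<in> S" "q \<in> carrier A" "p \<otimes> a = q \<otimes> c" "p \<otimes> b = q \<otimes> d"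
      using ore_factor2[of a b c d t s] ab cd t assms by auto
    have "(p \<otimes> a) \<otimes> u' = (p \<otimes> b) \<otimes> u"
      using ab pq(1) t assms by (simp add: m_assoc)
    moreover have "(p \<otimes> a) \<otimes> v' = (p \<otimes> b) \<otimes> v"
      unfolding pq(3,4) using cd pq(1,2) t assms by (simp add: m_assoc)
    moreover have "(p \<otimes> a) \<otimes> t = (p \<otimes> b) \<otimes> s" "(p \<otimes> a) \<otimes> t \<in> S"
      using ab pq(1) t assms by (simp_all add: m_assoc)
    ultimately show ?thesis
      using ab(1,2) pq(1) t(1-3) assms
      by (intro frac_eqI[of "p \<otimes> a" "p \<otimes> b"]) (simp_all add: r_distr)
  qed
  have "fraction_rel A S `` {(t, u' \<oplus> v') | t u' v'. (t, u') \<in> frac s u \<and> (t, v') \<in> frac s v}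
      = frac s (u \<oplus> v)"
  proof (rule fraction_rel_Image)
    show "(s, u \<oplus> v) \<in> {(t, u' \<oplus> v') | t u' v'. (t, u') \<in> frac s u \<and> (t, v') \<in> frac s v}"
      using self_in_frac assms S_closed m_closed by blast
  qed (clarify, rule *)
  then show ?thesis
    by (simp add: localization_def)
qed

text \<open>The relation \<open>a \<otimes> (u' \<otimes> t') = b \<otimes> (u \<otimes> t)\<close>
  is compared with \<open>c \<otimes> t' = d \<otimes> t\<close> by \<open>ore_factor2\<close>. This
  allows \<open>c \<otimes> v' = d \<otimes> v\<close> to be inserted behind
  \<open>a \<otimes> u'\<close> and \<open>b \<otimes> u\<close>.\<close>

lemma mult_frac:
  assumes "s \<in> S" "t \<in> S" "u \<in> carrier A" "v \<in> carrier A"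
  shows "frac s (u \<otimes> t) \<otimes>\<^bsub>L\<^esub> frac t v = frac s (u \<otimes> v)"
proof -
  have *: "frac s' (u' \<otimes> v') = frac s (u \<otimes> v)"
    if u': "u' \<in> carrier A" and "(s', u' \<otimes> t') \<in> frac s (u \<otimes> t)" "(t', v') \<in> frac t v" for s' u' t' v'
  proof -
    have t: "s' \<in> S" "t' \<in> S" "v' \<in> carrier A" "frac s' (u' \<otimes> t') = frac s (u \<otimes> t)"
        "frac t' v' = frac t v"
      using that assms by (auto simp: in_frac_iff)
    obtain a b where ab: "a \<in> carrier A" "b \<in> carrier A" "a \<otimes> s' = b \<otimes> s" "a \<otimes> s' \<in> S"
        "a \<otimes> (u' \<otimes> t') = b \<otimes> (u \<otimes> t)"
      by (rule frac_eqE[OF t(4,1) assms(1)]) (use t u' assms in auto)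
    obtain c d where cd: "c \<in> carrier A" "d \<in> carrier A" "c \<otimes> t' = d \<otimes> t" "c \<otimes> t' \<in> S" "c \<otimes> v' = d \<otimes> v"
      by (rule frac_eqE[OF t(5,2) assms(2) t(3) assms(4)])
    obtain p q where pq: "p \<in> S" "q \<in> carrier A" "p \<otimes> (a \<otimes> u') = q \<otimes> c" "p \<otimes> (b \<otimes> u) = q \<otimes> d"
      using ore_factor2[of "a \<otimes> u'" "b \<otimes> u" c d t' t] ab cd t assms u'
      by (auto simp: m_assoc)
    have "(p \<otimes> a) \<otimes> (u' \<otimes> v') = (p \<otimes> (a \<otimes> u')) \<otimes> v'"
      using ab pq(1) t assms u' by (simp add: m_assoc)
    also have "\<dots> = (p \<otimes> (b \<otimes> u)) \<otimes> v"
      unfolding pq(3,4) using cd pq(1,2) t assms by (simp add: m_assoc)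
    also have "\<dots> = (p \<otimes> b) \<otimes> (u \<otimes> v)"
      using ab pq(1) t assms by (simp add: m_assoc)
    finally have "(p \<otimes> a) \<otimes> (u' \<otimes> v') = (p \<otimes> b) \<otimes> (u \<otimes> v)" .
    moreover have "(p \<otimes> a) \<otimes> s' = (p \<otimes> b) \<otimes> s" "(p \<otimes> a) \<otimes> s' \<in> S"
      using ab pq(1) t assms by (simp_all add: m_assoc)
    ultimately show ?thesis
      using ab(1,2) pq(1) t(1-3) assms u'
      by (intro frac_eqI[of "p \<otimes> a" "p \<otimes> b"]) simp_all
  qed
  have "fraction_rel A S `` {(s', u' \<otimes> v') | s' u' t' v'. u' \<in> carrier A
        \<and> (s', u' \<otimes> t') \<in> frac s (u \<otimes> t) \<and> (t', v') \<in> frac t v} = frac s (u \<otimes> v)"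
  proof (rule fraction_rel_Image)
    show "(s, u \<otimes> v) \<in> {(s', u' \<otimes> v') | s' u' t' v'. u' \<in> carrier A
        \<and> (s', u' \<otimes> t') \<in> frac s (u \<otimes> t) \<and> (t', v') \<in> frac t v}"
      using self_in_frac assms S_closed m_closed by blast
  qed (clarify, rule *)
  then show ?thesis
    by (simp add: localization_def)
qed

lemma smult_frac:
  assumes "s \<in> S" "u \<in> carrier A"
  shows "c \<odot>\<^bsub>L\<^esub> frac s u = frac s (c \<odot> u)"
proof -
  have *: "frac t (c \<odot> v) = frac s (c \<odot> u)" if "(t, v) \<in> frac s u" for t v
  proof -
    have t: "t \<in> S" "v \<in> carrier A" "frac t v = frac s u"
      using that assms by (auto simp: in_frac_iff)
    obtain a b where "a \<in> carrier A" "b \<in> carrier A" "a \<otimes> t = b \<otimes> s" "a \<otimes> t \<in> S" "a \<otimes> v = b \<otimes> u"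
      by (rule frac_eqE[OF t(3,1) assms(1) t(2) assms(2)])
    then show ?thesis
      using t assms by (intro frac_eqI[of a b]) (auto simp: scale_mult_right)
  qed
  have "fraction_rel A S `` {(t, c \<odot> v) | t v. (t, v) \<in> frac s u} = frac s (c \<odot> u)"
  proof (rule fraction_rel_Image)
    show "(s, c \<odot> u) \<in> {(t, c \<odot> v) | t v. (t, v) \<in> frac s u}"
      using self_in_frac assms S_closed m_closed by blast
  qed (use * in blast)
  then show ?thesis
    by (simp add: localization_def)
qed

lemma one_L: "\<one>\<^bsub>L\<^esub> = frac \<one> \<one>" and zero_L: "\<zero>\<^bsub>L\<^esub> = frac \<one> \<zero>"
  by (simp_all add: localization_def frac_def)

lemma frac_zero: "s \<in> S \<Longrightarrow> frac s \<zero> = \<zero>\<^bsub>L\<^esub>"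
  using frac_expand[of \<one> s \<zero>] by (simp add: zero_L)

lemma frac_self: "s \<in> S \<Longrightarrow> frac s s = \<one>\<^bsub>L\<^esub>"
  using frac_expand[of \<one> s \<one>] by (simp add: one_L)

lemma common_denominator:
  assumes "P \<in> carrier L" "s \<in> S" "u \<in> carrier A"
  obtains a v where "a \<in> carrier A" "a \<otimes> s \<in> S" "v \<in> carrier A" "P = frac (a \<otimes> s) v"
    "frac s u = frac (a \<otimes> s) (a \<otimes> u)"
proof -
  obtain t v where P: "t \<in> S" "v \<in> carrier A" "P = frac t v"
    using assms(1) by (auto simp: carrier_L)
  obtain p q where pq: "p \<in> S" "q \<in> carrier A" "p \<otimes> t = q \<otimes> s"
    using ore[of t s] P assms by auto
  then have qs: "q \<otimes> s \<in> S"
    using P(1) mult_S[of p t] by simp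
  have 1: "P = frac (q \<otimes> s) (p \<otimes> v)"
    using frac_expand[of t p v] P pq qs by simp
  have 2: "frac s u = frac (q \<otimes> s) (q \<otimes> u)"
    using frac_expand[of s q u] assms pq qs by simp
  show ?thesis
    by (rule that[OF pq(2) qs _ 1 2]) (use P pq in simp)
qed

lemma adapted_numerator:
  assumes "P \<in> carrier L" "t \<in> S"
  obtains s u where "s \<in> S" "u \<in> carrier A" "P = frac s (u \<otimes> t)"
proof -
  obtain s x where P: "s \<in> S" "x \<in> carrier A" "P = frac s x"
    using assms(1) by (auto simp: carrier_L)
  obtain p q where pq: "p \<in> S" "q \<in> carrier A" "p \<otimes> x = q \<otimes> t"
    using ore[of x t] P assms by auto
  show ?thesis
    by (rule that[of "p \<otimes> s" q]) (use frac_expand[of s p x] P pq in auto)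
qed

lemma frac_triple:
  assumes "P \<in> carrier L" "Q \<in> carrier L" "R \<in> carrier L"
  obtains s u v w where "s \<in> S" "u \<in> carrier A" "v \<in> carrier A" "w \<in> carrier A"
    "P = frac s u" "Q = frac s v" "R = frac s w"
proof -
  obtain t w where R: "t \<in> S" "w \<in> carrier A" "R = frac t w"
    using assms(3) by (auto simp: carrier_L)
  obtain a v where Q: "a \<in> carrier A" "a \<otimes> t \<in> S" "v \<in> carrier A" "Q = frac (a \<otimes> t) v"
    and R': "frac t w = frac (a \<otimes> t) (a \<otimes> w)"
    by (rule common_denominator[OF assms(2) R(1,2)])
  let ?s = "a \<otimes> t"
  obtain b u where P: "b \<in> carrier A" "b \<otimes> ?s \<in> S" "u \<in> carrier A" "P = frac (b \<otimes> ?s) u"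
    and Q': "frac ?s v = frac (b \<otimes> ?s) (b \<otimes> v)"
    by (rule common_denominator[OF assms(1) Q(2,3)])
  have R'': "R = frac (b \<otimes> ?s) (b \<otimes> (a \<otimes> w))"
    using frac_expand[OF Q(2) P(1,2), of "a \<otimes> w"] Q R R' by simp
  show ?thesis
    by (rule that[OF P(2,3) _ _ P(4) _ R'']) (use P Q R Q' in simp_all)
qed

text \<open>Each axiom is reduced to the same axiom for numerators: sums by a common denominator,
  products by adapting numerators from right to left.\<close>

lemma ring_L: "ring L"
proof (rule ringI)
  show "abelian_group L"
  proof (rule abelian_groupI)
    fix P Q assume PQ: "P \<in> carrier L" "Q \<in> carrier L"
    obtain s u v where "s \<in> S" "u \<in> carrier A" "v \<in> carrier A" "P = frac s u" "Q = frac s v"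
      by (rule frac_triple[OF PQ PQ(1)])
    then show "P \<oplus>\<^bsub>L\<^esub> Q \<in> carrier L" "P \<oplus>\<^bsub>L\<^esub> Q = Q \<oplus>\<^bsub>L\<^esub> P"
      by (simp_all add: add_frac a_comm)
  next
    fix P Q R assume PQR: "P \<in> carrier L" "Q \<in> carrier L" "R \<in> carrier L"
    show "P \<oplus>\<^bsub>L\<^esub> Q \<oplus>\<^bsub>L\<^esub> R = P \<oplus>\<^bsub>L\<^esub> (Q \<oplus>\<^bsub>L\<^esub> R)"
      by (rule frac_triple[OF PQR]) (simp add: add_frac a_assoc)
  next
    show "\<zero>\<^bsub>L\<^esub> \<in> carrier L"
      by (simp add: zero_L)
  next
    fix P assume "P \<in> carrier L"
    then obtain s u where P: "s \<in> S" "u \<in> carrier A" "P = frac s u"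
      by (auto simp: carrier_L)
    then show "\<zero>\<^bsub>L\<^esub> \<oplus>\<^bsub>L\<^esub> P = P"
      using frac_zero[of s] add_frac[of s \<zero> u] by simp
    show "\<exists>Q \<in> carrier L. Q \<oplus>\<^bsub>L\<^esub> P = \<zero>\<^bsub>L\<^esub>"
      using P by (intro bexI[of _ "frac s (\<ominus> u)"]) (simp_all add: add_frac l_neg frac_zero)
  qed
  show "Group.monoid L"
  proof (rule monoidI)
    fix P Q assume PQ: "P \<in> carrier L" "Q \<in> carrier L"
    obtain t v where Q: "t \<in> S" "v \<in> carrier A" "Q = frac t v"
      using PQ by (auto simp: carrier_L)
    obtain s u where "s \<in> S" "u \<in> carrier A" "P = frac s (u \<otimes> t)"
      using adapted_numerator[OF PQ(1) Q(1)] .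
    then show "P \<otimes>\<^bsub>L\<^esub> Q \<in> carrier L"
      using Q by (simp add: mult_frac)
  next
    fix P Q R assume PQR: "P \<in> carrier L" "Q \<in> carrier L" "R \<in> carrier L"
    obtain r w where R: "r \<in> S" "w \<in> carrier A" "R = frac r w"
      using PQR by (auto simp: carrier_L)
    obtain t v where Q: "t \<in> S" "v \<in> carrier A" "Q = frac t (v \<otimes> r)"
      using adapted_numerator[OF PQR(2) R(1)] .
    obtain s u where P: "s \<in> S" "u \<in> carrier A" "P = frac s (u \<otimes> t)"
      using adapted_numerator[OF PQR(1) Q(1)] .
    have "P \<otimes>\<^bsub>L\<^esub> Q \<otimes>\<^bsub>L\<^esub> R = frac s ((u \<otimes> v) \<otimes> r) \<otimes>\<^bsub>L\<^esub> frac r w"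
      using P Q R by (simp add: mult_frac m_assoc)
    also have "\<dots> = frac s (u \<otimes> (v \<otimes> w))"
      using P Q R by (subst mult_frac) (simp_all add: m_assoc)
    also have "\<dots> = P \<otimes>\<^bsub>L\<^esub> (Q \<otimes>\<^bsub>L\<^esub> R)"
      using P Q R by (simp add: mult_frac)
    finally show "P \<otimes>\<^bsub>L\<^esub> Q \<otimes>\<^bsub>L\<^esub> R = P \<otimes>\<^bsub>L\<^esub> (Q \<otimes>\<^bsub>L\<^esub> R)" .
  next
    show "\<one>\<^bsub>L\<^esub> \<in> carrier L"
      by (simp add: one_L)
  next
    fix P assume "P \<in> carrier L"
    then obtain s u where P: "s \<in> S" "u \<in> carrier A" "P = frac s u"
      by (auto simp: carrier_L)
    show "\<one>\<^bsub>L\<^esub> \<otimes>\<^bsub>L\<^esub> P = P"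
      using P mult_frac[of s s \<one> u] by (simp add: frac_self)
    show "P \<otimes>\<^bsub>L\<^esub> \<one>\<^bsub>L\<^esub> = P"
      using P mult_frac[of s \<one> u \<one>] by (simp add: one_L)
  qed
next
  fix P Q R assume PQR: "P \<in> carrier L" "Q \<in> carrier L" "R \<in> carrier L"
  obtain r w where R: "r \<in> S" "w \<in> carrier A" "R = frac r w"
    using PQR by (auto simp: carrier_L)
  \<comment> \<open>This distributive law asks for two things at once: \<open>P\<close> and
    \<open>Q\<close> over one denominator, and both numerators multiples of the denominator
    \<open>r\<close> of \<open>R\<close>.\<close>
  obtain t v where Q: "t \<in> S" "v \<in> carrier A" "Q = frac t (v \<otimes> r)"
    using adapted_numerator[OF PQR(2) R(1)] .
  obtain a x where P: "a \<in> carrier A" "a \<otimes> t \<in> S" "x \<in> carrier A" "P = frac (a \<otimes> t) x"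
    and Q': "frac t (v \<otimes> r) = frac (a \<otimes> t) (a \<otimes> (v \<otimes> r))"
    by (rule common_denominator[OF PQR(1) Q(1), of "v \<otimes> r"]) (use Q R in simp_all)
  obtain p u where pu: "p \<in> S" "u \<in> carrier A" "p \<otimes> x = u \<otimes> r"
    using ore[of x r] P R by auto
  let ?s = "p \<otimes> (a \<otimes> t)" and ?v = "p \<otimes> (a \<otimes> v)"
  have s: "?s \<in> S" "P = frac ?s (u \<otimes> r)" "Q = frac ?s (?v \<otimes> r)" "?v \<in> carrier A"
    using P Q Q' R pu frac_expand[of "a \<otimes> t" p x] frac_expand[of "a \<otimes> t" p "a \<otimes> (v \<otimes> r)"]
    by (auto simp: m_assoc)
  show "(P \<oplus>\<^bsub>L\<^esub> Q) \<otimes>\<^bsub>L\<^esub> R = P \<otimes>\<^bsub>L\<^esub> R \<oplus>\<^bsub>L\<^esub> Q \<otimes>\<^bsub>L\<^esub> R"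
  proof -
    have "P \<oplus>\<^bsub>L\<^esub> Q = frac ?s ((u \<oplus> ?v) \<otimes> r)"
      using s R pu by (simp only: s(2,3)) (subst add_frac, auto simp: l_distr)
    then have "(P \<oplus>\<^bsub>L\<^esub> Q) \<otimes>\<^bsub>L\<^esub> R = frac ?s ((u \<oplus> ?v) \<otimes> w)"
      using mult_frac[of ?s r "u \<oplus> ?v" w] s(1,4) R pu by simp
    also have "\<dots> = frac ?s (u \<otimes> w) \<oplus>\<^bsub>L\<^esub> frac ?s (?v \<otimes> w)"
      using s(1,4) R pu by (subst add_frac) (auto simp: l_distr)
    also have "\<dots> = P \<otimes>\<^bsub>L\<^esub> R \<oplus>\<^bsub>L\<^esub> Q \<otimes>\<^bsub>L\<^esub> R"
      using mult_frac[of ?s r u w] mult_frac[of ?s r ?v w] s R pu by simp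
    finally show ?thesis .
  qed
next
  fix P Q R assume PQR: "P \<in> carrier L" "Q \<in> carrier L" "R \<in> carrier L"
  obtain t v w where PQ: "t \<in> S" "v \<in> carrier A" "w \<in> carrier A" "P = frac t v" "Q = frac t w"
    by (rule frac_triple[OF PQR(1,2,2)])
  obtain s u where R: "s \<in> S" "u \<in> carrier A" "R = frac s (u \<otimes> t)"
    using adapted_numerator[OF PQR(3) PQ(1)] .
  show "R \<otimes>\<^bsub>L\<^esub> (P \<oplus>\<^bsub>L\<^esub> Q) = R \<otimes>\<^bsub>L\<^esub> P \<oplus>\<^bsub>L\<^esub> R \<otimes>\<^bsub>L\<^esub> Q"
    using PQ R by (simp add: add_frac mult_frac r_distr)
qed

lemma calgebra_L: "calgebra L"
proof (rule calgebraI[OF ring_L])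
  fix c P Q assume PQ: "P \<in> carrier L" "Q \<in> carrier L"
  obtain t v where Q: "t \<in> S" "v \<in> carrier A" "Q = frac t v"
    using PQ by (auto simp: carrier_L)
  obtain s u where P: "s \<in> S" "u \<in> carrier A" "P = frac s (u \<otimes> t)"
    using adapted_numerator[OF PQ(1) Q(1)] .
  have "c \<odot>\<^bsub>L\<^esub> P = frac s ((c \<odot> u) \<otimes> t)"
    using P Q by (simp add: smult_frac scale_mult_left)
  then show "c \<odot>\<^bsub>L\<^esub> (P \<otimes>\<^bsub>L\<^esub> Q) = c \<odot>\<^bsub>L\<^esub> P \<otimes>\<^bsub>L\<^esub> Q"
    using P Q mult_frac[of s t "c \<odot> u" v] by (simp add: smult_frac mult_frac scale_mult_left)
  show "c \<odot>\<^bsub>L\<^esub> (P \<otimes>\<^bsub>L\<^esub> Q) = P \<otimes>\<^bsub>L\<^esub> (c \<odot>\<^bsub>L\<^esub> Q)"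
    using P Q by (simp add: smult_frac mult_frac scale_mult_right)
next
  fix c P Q assume PQ: "P \<in> carrier L" "Q \<in> carrier L"
  obtain s u v where "s \<in> S" "u \<in> carrier A" "v \<in> carrier A" "P = frac s u" "Q = frac s v"
    by (rule frac_triple[OF PQ PQ(1)])
  then show "c \<odot>\<^bsub>L\<^esub> (P \<oplus>\<^bsub>L\<^esub> Q) = c \<odot>\<^bsub>L\<^esub> P \<oplus>\<^bsub>L\<^esub> c \<odot>\<^bsub>L\<^esub> Q"
    by (simp add: add_frac smult_frac scale_add_right)
next
  fix c P assume "P \<in> carrier L"
  then obtain s u where P: "s \<in> S" "u \<in> carrier A" "P = frac s u"
    by (auto simp: carrier_L)
  then show "c \<odot>\<^bsub>L\<^esub> P \<in> carrier L" "1 \<odot>\<^bsub>L\<^esub> P = P"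
    by (simp_all add: smult_frac)
  fix d
  show "(c + d) \<odot>\<^bsub>L\<^esub> P = c \<odot>\<^bsub>L\<^esub> P \<oplus>\<^bsub>L\<^esub> d \<odot>\<^bsub>L\<^esub> P"
    "(c * d) \<odot>\<^bsub>L\<^esub> P = c \<odot>\<^bsub>L\<^esub> (d \<odot>\<^bsub>L\<^esub> P)"
    using P by (simp_all add: smult_frac add_frac scale_add_left scale_scale)
qed

sublocale L: calg L
  using calgebra_L by (rule calg.intro)

lemma to_localization_frac: "to_localization A S u = frac \<one> u"
  by (simp add: to_localization_def frac_def)

lemma frac_left_mult: "s \<in> S \<Longrightarrow> u \<in> carrier A \<Longrightarrow> frac \<one> s \<otimes>\<^bsub>L\<^esub> frac s u = frac \<one> u"
  using mult_frac[of \<one> s \<one> u] by simp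

lemma frac_right_mult: "s \<in> S \<Longrightarrow> u \<in> carrier A \<Longrightarrow> v \<in> carrier A
    \<Longrightarrow> frac s u \<otimes>\<^bsub>L\<^esub> frac \<one> v = frac s (u \<otimes> v)"
  using mult_frac[of s \<one> u v] by simp

lemma frac_unit: assumes "s \<in> S" shows "frac \<one> s \<in> Units L" "inv\<^bsub>L\<^esub> (frac \<one> s) = frac s \<one>"
proof -
  have *: "frac \<one> s \<otimes>\<^bsub>L\<^esub> frac s \<one> = \<one>\<^bsub>L\<^esub>" "frac s \<one> \<otimes>\<^bsub>L\<^esub> frac \<one> s = \<one>\<^bsub>L\<^esub>"
    using assms frac_left_mult[of s \<one>] frac_right_mult[of s \<one> s] by (simp_all add: frac_self)
  then show "frac \<one> s \<in> Units L"
    using frac_closed[OF one_S S_closed[OF assms]] frac_closed[OF assms one_closed]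
    unfolding Units_def by blast
  show "inv\<^bsub>L\<^esub> (frac \<one> s) = frac s \<one>"
    by (rule L.inv_char[OF _ _ *]) (use assms in simp_all)
qed

text \<open>With both denominators 1 the multipliers \<open>a\<close> and \<open>b\<close> coincide,
  so the kernel of the map into the localization is the left torsion.\<close>

lemma frac_one_eq_iff:
  assumes "u \<in> carrier A" "v \<in> carrier A"
  shows "frac \<one> u = frac \<one> v \<longleftrightarrow> (\<exists>s \<in> S. s \<otimes> u = s \<otimes> v)"
proof
  assume "frac \<one> u = frac \<one> v"
  then obtain a b where "a \<in> carrier A" "b \<in> carrier A" "a \<otimes> \<one> = b \<otimes> \<one>" "a \<otimes> \<one> \<in> S" "a \<otimes> u = b \<otimes> v"
    by (rule frac_eqE[OF _ one_S one_S assms])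
  then show "\<exists>s \<in> S. s \<otimes> u = s \<otimes> v"
    by auto
next
  assume "\<exists>s \<in> S. s \<otimes> u = s \<otimes> v"
  then show "frac \<one> u = frac \<one> v"
    using frac_eqI[OF _ _ _ _ _ one_S one_S assms] by auto
qed

end

section \<open>Ad-nilpotent elements\<close>

context calg
begin

definition comm :: "'a \<Rightarrow> 'a \<Rightarrow> 'a" where
  "comm x u = x \<otimes> u \<ominus> u \<otimes> x"

lemma comm_closed [simp, intro]: "x \<in> carrier A \<Longrightarrow> u \<in> carrier A \<Longrightarrow> comm x u \<in> carrier A"
  by (simp add: comm_def)

lemma add_diff_swap:
  "a \<in> carrier A \<Longrightarrow> b \<in> carrier A \<Longrightarrow> c \<in> carrier A \<Longrightarrow> d \<in> carrier A
    \<Longrightarrow> (a \<oplus> b) \<ominus> (c \<oplus> d) = (a \<ominus> c) \<oplus> (b \<ominus> d)"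
  by (simp add: a_minus_def minus_add a_ac)

lemma diff_add_cancel [simp]: "a \<in> carrier A \<Longrightarrow> b \<in> carrier A \<Longrightarrow> (a \<ominus> b) \<oplus> b = a"
  by (simp add: a_minus_def a_assoc l_neg)

lemma diff_trans:
  "a \<in> carrier A \<Longrightarrow> b \<in> carrier A \<Longrightarrow> c \<in> carrier A \<Longrightarrow> (a \<ominus> b) \<oplus> (b \<ominus> c) = a \<ominus> c"
  by (simp add: a_minus_def a_assoc r_neg1)

lemma comm_add: "x \<in> carrier A \<Longrightarrow> u \<in> carrier A \<Longrightarrow> v \<in> carrier A
    \<Longrightarrow> comm x (u \<oplus> v) = comm x u \<oplus> comm x v"
  by (simp add: comm_def r_distr l_distr add_diff_swap)

lemma comm_scale: "x \<in> carrier A \<Longrightarrow> u \<in> carrier A \<Longrightarrow> comm x (c \<odot> u) = c \<odot> comm x u"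
  by (simp add: comm_def scale_mult_left scale_mult_right scale_diff)

lemma comm_zero [simp]: "x \<in> carrier A \<Longrightarrow> comm x \<zero> = \<zero>"
  by (simp add: comm_def a_minus_def)

lemma comm_one [simp]: "x \<in> carrier A \<Longrightarrow> comm x \<one> = \<zero>"
  by (simp add: comm_def a_minus_def r_neg)

lemma comm_mult:
  assumes "x \<in> carrier A" "u \<in> carrier A" "v \<in> carrier A"
  shows "comm x (u \<otimes> v) = comm x u \<otimes> v \<oplus> u \<otimes> comm x v"
proof -
  have "comm x u \<otimes> v \<oplus> u \<otimes> comm x v
      = (x \<otimes> u \<otimes> v \<ominus> u \<otimes> x \<otimes> v) \<oplus> (u \<otimes> x \<otimes> v \<ominus> u \<otimes> v \<otimes> x)"
    using assms by (simp add: comm_def a_minus_def l_distr r_distr l_minus r_minus m_assoc)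
  then show ?thesis
    using assms by (simp add: diff_trans comm_def m_assoc)
qed

lemma mult_comm: "x \<in> carrier A \<Longrightarrow> u \<in> carrier A \<Longrightarrow> x \<otimes> u = comm x u \<oplus> u \<otimes> x"
  by (simp add: comm_def)

lemma comm_eq_zero_iff: "x \<in> carrier A \<Longrightarrow> u \<in> carrier A \<Longrightarrow> comm x u = \<zero> \<longleftrightarrow> x \<otimes> u = u \<otimes> x"
  by (simp add: comm_def diff_eq_zero_iff)

text \<open>The elements annihilated by some power of ad \<open>x\<close>. Generating them
  inductively turns induction on the nilpotency degree into rule induction.\<close>

inductive_set adnil :: "'a \<Rightarrow> 'a set" for x where
  zero: "\<zero> \<in> adnil x"
| step: "u \<in> carrier A \<Longrightarrow> comm x u \<in> adnil x \<Longrightarrow> u \<in> adnil x"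

lemma adnil_closed: "u \<in> adnil x \<Longrightarrow> u \<in> carrier A"
  by (erule adnil.cases) auto

lemma adnil_add:
  assumes "x \<in> carrier A" "u \<in> adnil x" "v \<in> adnil x"
  shows "u \<oplus> v \<in> adnil x"
  using assms(2,3)
proof (induction arbitrary: v)
  case (zero v)
  then show ?case by (simp add: adnil_closed)
next
  case u: (step u)
  from u.prems show ?case
  proof cases
    case zero
    then show ?thesis using adnil.step[OF u.hyps] u.hyps(1) by simp
  next
    case step
    have "comm x u \<oplus> comm x v \<in> adnil x"
      by (rule u.IH[OF step(2)])
    with u.hyps(1) step(1) assms(1) show ?thesis
      by - (rule adnil.step, simp_all add: comm_add)
  qed
qed

text \<open>In each summand of the Leibniz rule ad \<open>x\<close> lowers the degree of one factor,
  hence the nested induction.\<close>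

lemma adnil_mult:
  assumes "x \<in> carrier A" "u \<in> adnil x" "v \<in> adnil x"
  shows "u \<otimes> v \<in> adnil x"
  using assms(2,3)
proof (induction arbitrary: v)
  case (zero v)
  then show ?case by (simp add: adnil_closed adnil.zero)
next
  case u: (step u)
  from u.prems show ?case
  proof induction
    case zero
    then show ?case using u.hyps by (simp add: adnil.zero)
  next
    case (step v)
    have "comm x u \<otimes> v \<in> adnil x"
      by (rule u.IH[OF adnil.step[OF step.hyps]])
    then have "comm x u \<otimes> v \<oplus> u \<otimes> comm x v \<in> adnil x"
      by (rule adnil_add[OF assms(1) _ step.IH])
    with u.hyps(1) step.hyps(1) assms(1) show ?case
      by - (rule adnil.step, simp_all add: comm_mult)
  qed
qed

lemma adnil_scale:
  assumes "x \<in> carrier A" "u \<in> adnil x"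
  shows "c \<odot> u \<in> adnil x"
  using assms(2) by induction (use assms(1) in \<open>auto intro: adnil.intros simp: comm_scale\<close>)

lemma adnil_generated:
  assumes "x \<in> carrier A" "H \<subseteq> adnil x" "u \<in> generated_subalgebra A H"
  shows "u \<in> adnil x"
  using assms(3)
proof induction
  case one
  show ?case
    by (rule adnil.step) (simp_all add: assms(1) adnil.zero)
qed (use assms adnil_add adnil_mult adnil_scale in auto)

text \<open>Since \<open>x u = [x, u] + u x\<close>, a solution \<open>t\<close> for
  \<open>[x, u]\<close> gives the solution \<open>t x\<close> for \<open>u\<close>.\<close>

lemma adnil_ore:
  assumes "x \<in> T" "T \<subseteq> carrier A" "\<one> \<in> T" "\<And>s t. s \<in> T \<Longrightarrow> t \<in> T \<Longrightarrow> s \<otimes> t \<in> T" "u \<in> adnil x"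
  shows "\<exists>t \<in> T. \<exists>v \<in> carrier A. t \<otimes> u = v \<otimes> x"
  using assms(5)
proof induction
  case zero
  show ?case
    using assms(1-3) by (intro bexI[of _ \<one>] bexI[of _ \<zero>]) auto
next
  case (step u)
  then obtain t v where t: "t \<in> T" "v \<in> carrier A" "t \<otimes> comm x u = v \<otimes> x"
    by auto
  have c: "x \<in> carrier A" "t \<in> carrier A"
    using assms(1,2) t(1) by auto
  have "(t \<otimes> x) \<otimes> u = t \<otimes> (comm x u \<oplus> u \<otimes> x)"
    using step.hyps(1) c by (simp add: m_assoc mult_comm[of x u])
  also have "\<dots> = (v \<oplus> t \<otimes> u) \<otimes> x"
    using step.hyps(1) c t by (simp add: r_distr l_distr m_assoc)
  finally have "(t \<otimes> x) \<otimes> u = (v \<oplus> t \<otimes> u) \<otimes> x" .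
  moreover have "t \<otimes> x \<in> T" "v \<oplus> t \<otimes> u \<in> carrier A"
    using t c assms(1,4) step.hyps(1) by auto
  ultimately show ?case
    by blast
qed

text \<open>If \<open>u x = 0\<close>, then \<open>[x, u] = x u\<close>, which is again annihilated
  by \<open>x\<close> from the right. If \<open>t\<close> kills \<open>x u\<close> from the left,
  then \<open>t x\<close> kills \<open>u\<close>.\<close>

lemma adnil_reversible:
  assumes "x \<in> T" "T \<subseteq> carrier A" "\<one> \<in> T" "\<And>s t. s \<in> T \<Longrightarrow> t \<in> T \<Longrightarrow> s \<otimes> t \<in> T" "u \<in> adnil x"
    "u \<otimes> x = \<zero>"
  shows "\<exists>t \<in> T. t \<otimes> u = \<zero>"
  using assms(5,6)
proof induction
  case zero
  show ?case
    using assms(3) by (intro bexI[of _ \<one>]) auto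
next
  case (step u)
  have c: "x \<in> carrier A"
    using assms(1,2) by auto
  have xu: "comm x u = x \<otimes> u"
    using step c by (simp add: comm_def a_minus_def)
  then have "comm x u \<otimes> x = \<zero>"
    using step c by (simp add: m_assoc)
  then obtain t where t: "t \<in> T" "t \<otimes> comm x u = \<zero>"
    using step by auto
  then have "(t \<otimes> x) \<otimes> u = \<zero>"
    using xu step c assms(2) by (simp add: m_assoc subset_iff)
  then show ?case
    using t assms(1,4) by blast
qed

section \<open>Left ideals\<close>

text \<open>Finite sums of left multiples of generators, built one summand at a time to provide an
  induction over such sums.\<close>

inductive_set left_ideal :: "'a set \<Rightarrow> 'a set" for G where
  zero: "\<zero> \<in> left_ideal G"
| add: "y \<in> left_ideal G \<Longrightarrow> a \<in> carrier A \<Longrightarrow> g \<in> G \<Longrightarrow> y \<oplus> a \<otimes> g \<in> left_ideal G"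

context
  fixes G assumes G: "G \<subseteq> carrier A"
begin

lemma left_ideal_closed: "y \<in> left_ideal G \<Longrightarrow> y \<in> carrier A"
  by (induction rule: left_ideal.induct) (use G in auto)

lemma left_ideal_gen: "a \<in> carrier A \<Longrightarrow> g \<in> G \<Longrightarrow> a \<otimes> g \<in> left_ideal G"
  using left_ideal.add[OF left_ideal.zero, of a g G] G by auto

lemma left_ideal_add: "z \<in> left_ideal G \<Longrightarrow> y \<in> left_ideal G \<Longrightarrow> y \<oplus> z \<in> left_ideal G"
proof (induction rule: left_ideal.induct)
  case zero
  then show ?case by (simp add: left_ideal_closed)
next
  case (add z a g)
  then have "(y \<oplus> z) \<oplus> a \<otimes> g \<in> left_ideal G"
    by (intro left_ideal.add) auto
  then show ?case
    using add G by (simp add: a_assoc left_ideal_closed subset_iff)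
qed

lemma left_ideal_mult:
  assumes "b \<in> carrier A" shows "y \<in> left_ideal G \<Longrightarrow> b \<otimes> y \<in> left_ideal G"
proof (induction rule: left_ideal.induct)
  case (add y a g)
  then have "b \<otimes> y \<oplus> (b \<otimes> a) \<otimes> g \<in> left_ideal G"
    using assms by (intro left_ideal.add) auto
  then show ?case
    using add assms G by (simp add: r_distr m_assoc left_ideal_closed subset_iff)
qed (use assms in \<open>auto intro: left_ideal.zero\<close>)

lemma left_ideal_scale: "y \<in> left_ideal G \<Longrightarrow> c \<odot> y \<in> left_ideal G"
  using left_ideal_mult[of "c \<odot> \<one>" y] left_ideal_closed[of y] by (simp add: scale_mult_left)

lemma left_ideal_diff: "y \<in> left_ideal G \<Longrightarrow> z \<in> left_ideal G \<Longrightarrow> y \<ominus> z \<in> left_ideal G"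
  using left_ideal_add[OF left_ideal_scale[of z "- 1"], of y] left_ideal_closed[of z] minus_scale[of z 1]
  by (simp add: a_minus_def)

lemma left_ideal_trans:
  assumes "a \<ominus> b \<in> left_ideal G" "b \<ominus> c \<in> left_ideal G" "a \<in> carrier A" "b \<in> carrier A" "c \<in> carrier A"
  shows "a \<ominus> c \<in> left_ideal G"
  using left_ideal_add[OF assms(2,1)] assms(3-5) by (simp add: diff_trans)

lemma left_ideal_sym:
  assumes "a \<ominus> b \<in> left_ideal G" "a \<in> carrier A" "b \<in> carrier A"
  shows "b \<ominus> a \<in> left_ideal G"
  using left_ideal_scale[OF assms(1), of "- 1"] minus_scale[of "a \<ominus> b" 1] assms(2,3)
  by (simp add: a_minus_def minus_add a_comm)

text \<open>By left linearity it suffices to multiply the generators. This applies to the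
  \<open>x j\<close>, which commute with the generators of \<open>I\<close>, and to Whittaker
  vectors, for which it makes right multiplication on the quotient well defined.\<close>

lemma left_ideal_right_mult:
  assumes "b \<in> carrier A" "\<And>g. g \<in> G \<Longrightarrow> g \<otimes> b \<in> left_ideal G" "y \<in> left_ideal G"
  shows "y \<otimes> b \<in> left_ideal G"
  using assms(3)
proof induction
  case (add y a g)
  have "a \<otimes> (g \<otimes> b) \<in> left_ideal G"
    by (rule left_ideal_mult[OF add.hyps(2) assms(2)[OF add.hyps(3)]])
  then have "y \<otimes> b \<oplus> a \<otimes> (g \<otimes> b) \<in> left_ideal G"
    using add.IH by (rule left_ideal_add)
  then show ?case
    using add assms G by (simp add: l_distr m_assoc left_ideal_closed subset_iff)
qed (use assms in \<open>auto intro: left_ideal.zero\<close>)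

end

end

section \<open>Whittaker vectors and weights\<close>

text \<open>The abstract situation: commuting elements \<open>x j\<close>, elements
  \<open>h i\<close> whose adjoint actions define weights, and \<open>wt i k\<close>, the eigenvalue
  of ad \<open>h i\<close> in weight \<open>k\<close>. Weights are given by coordinates in which
  each \<open>x j\<close> has a unit vector as its weight, and \<open>wt_inj\<close> says that the
  \<open>h i\<close> separate weights.\<close>

locale graded_torus = calg +
  fixes js :: "nat list" and x :: "nat \<Rightarrow> 'a" and h :: "nat \<Rightarrow> 'a" and wt :: "nat \<Rightarrow> (nat \<Rightarrow> int) \<Rightarrow> complex"
  assumes distinct_js: "distinct js"
    and x_closed [simp]: "j \<in> set js \<Longrightarrow> x j \<in> carrier A"
    and h_closed [simp]: "i \<in> set js \<Longrightarrow> h i \<in> carrier A"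
    and x_commute: "i \<in> set js \<Longrightarrow> j \<in> set js \<Longrightarrow> x i \<otimes> x j = x j \<otimes> x i"
    and x_adnil: "j \<in> set js \<Longrightarrow> carrier A \<subseteq> adnil (x j)"
    and wt_add: "wt i (\<lambda>j. k j + l j) = wt i k + wt i l"
    and wt_inj: "(\<And>j. j \<notin> set js \<Longrightarrow> k j = 0) \<Longrightarrow> (\<And>j. j \<notin> set js \<Longrightarrow> l j = 0)
      \<Longrightarrow> (\<And>i. i \<in> set js \<Longrightarrow> wt i k = wt i l) \<Longrightarrow> k = l"
    and x_wt: "i \<in> set js \<Longrightarrow> j \<in> set js
      \<Longrightarrow> comm (h i) (x j) = wt i (\<lambda>l. if l = j then 1 else 0) \<odot> x j"
begin

abbreviation "J \<equiv> set js"

text \<open>Coordinates vanish outside \<open>J\<close>, so that equality of functions is equality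
  of weights.\<close>

definition lattice :: "(nat \<Rightarrow> int) set" where
  "lattice = {k. \<forall>j. j \<notin> J \<longrightarrow> k j = 0}"

definition W :: "(nat \<Rightarrow> int) \<Rightarrow> 'a set" where
  "W k = {u \<in> carrier A. \<forall>i \<in> J. comm (h i) u = wt i k \<odot> u}"

abbreviation "mon_list k xs \<equiv> foldr (\<otimes>) (map (\<lambda>j. x j [^] (k j :: nat)) xs) \<one>"

definition mon :: "(nat \<Rightarrow> nat) \<Rightarrow> 'a" where
  "mon k = mon_list k js"

text \<open>The weight of \<open>mon k\<close>. Exponents outside \<open>J\<close> have no influence
  on the monomial and are cut off to stay in \<open>lattice\<close>.\<close>

definition expo :: "(nat \<Rightarrow> nat) \<Rightarrow> nat \<Rightarrow> int" where
  "expo k j = (if j \<in> J then int (k j) else 0)"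

definition S :: "'a set" where
  "S = range mon"

lemma expo_lattice [simp]: "expo k \<in> lattice"
  by (simp add: lattice_def expo_def)

lemma wt_zero [simp]: "wt i (\<lambda>j. 0) = 0"
  using wt_add[of i "\<lambda>j. 0" "\<lambda>j. 0"] by simp

lemma W_closed: "u \<in> W k \<Longrightarrow> u \<in> carrier A"
  by (simp add: W_def)

lemma W_comm: "u \<in> W k \<Longrightarrow> i \<in> J \<Longrightarrow> comm (h i) u = wt i k \<odot> u"
  by (simp add: W_def)

lemma W_zero [simp]: "\<zero> \<in> W k"
  by (simp add: W_def)

lemma W_add: "u \<in> W k \<Longrightarrow> v \<in> W k \<Longrightarrow> u \<oplus> v \<in> W k"
  by (simp add: W_def comm_add scale_add_right)

lemma W_scale: "u \<in> W k \<Longrightarrow> c \<odot> u \<in> W k"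
  by (simp add: W_def comm_scale scale_scale mult.commute)

lemma W_diff: "u \<in> W k \<Longrightarrow> v \<in> W k \<Longrightarrow> u \<ominus> v \<in> W k"
  using W_add[of u k "(- 1) \<odot> v"] W_scale[of v k "- 1"] minus_scale[of v 1] W_closed[of v k]
  by (simp add: a_minus_def)

lemma W_one: "\<one> \<in> W (\<lambda>j. 0)"
  by (simp add: W_def)

lemma W_mult: "u \<in> W k \<Longrightarrow> v \<in> W l \<Longrightarrow> u \<otimes> v \<in> W (\<lambda>j. k j + l j)"
  by (simp add: W_def comm_mult wt_add scale_mult_left scale_mult_right scale_add_left)

lemma x_W: "j \<in> J \<Longrightarrow> x j \<in> W (\<lambda>l. if l = j then 1 else 0)"
  by (simp add: W_def x_wt)

lemma x_pow_W: "j \<in> J \<Longrightarrow> x j [^] (m :: nat) \<in> W (\<lambda>l. if l = j then int m else 0)"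
proof (induction m)
  case (Suc m)
  have "(\<lambda>l. (if l = j then int m else 0) + (if l = j then 1 else 0))
      = (\<lambda>l. if l = j then int (Suc m) else 0)"
    by auto
  then show ?case
    using W_mult[OF Suc.IH[OF Suc.prems] x_W[OF Suc.prems]] by simp
next
  case 0
  have "(\<lambda>l. if l = j then int 0 else 0) = (\<lambda>l. 0)"
    by auto
  then show ?case
    using W_one by simp
qed

lemma mon_list_W:
  assumes "set xs \<subseteq> J" "distinct xs"
  shows "mon_list k xs \<in> W (\<lambda>j. if j \<in> set xs then int (k j) else 0)"
  using assms
proof (induction xs)
  case (Cons a xs)
  have "(\<lambda>l. (if l = a then int (k a) else 0) + (if l \<in> set xs then int (k l) else 0))
      = (\<lambda>l. if l \<in> set (a # xs) then int (k l) else 0)"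
    using Cons.prems by auto
  moreover have "mon_list k xs
      \<in> W (\<lambda>j. if j \<in> set xs then int (k j) else 0)"
    using Cons by simp
  ultimately show ?case
    using W_mult[OF x_pow_W[of a "k a"]] Cons.prems by fastforce
qed (simp add: W_one)

lemma mon_W: "mon k \<in> W (expo k)"
  using mon_list_W[OF subset_refl distinct_js] unfolding mon_def expo_def .

lemma mon_closed [simp]: "mon k \<in> carrier A"
  using mon_W W_closed by blast

lemma commute_mon_list:
  assumes "u \<in> carrier A" "\<And>j. j \<in> J \<Longrightarrow> u \<otimes> x j = x j \<otimes> u" "set xs \<subseteq> J"
  shows "mon_list k xs \<in> carrier A \<and> u \<otimes> mon_list k xs = mon_list k xs \<otimes> u"
  using assms(3)
proof (induction xs)
  case (Cons a xs)
  let ?M = "mon_list k xs"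
  have M: "u \<otimes> ?M = ?M \<otimes> u" "?M \<in> carrier A" and a: "a \<in> J"
    using Cons by auto
  have pow: "x a [^] k a \<otimes> u = u \<otimes> x a [^] k a"
    using group_commutes_pow[of "x a" u "k a"] assms(1,2) a by simp
  have "u \<otimes> (x a [^] k a \<otimes> ?M) = (x a [^] k a \<otimes> u) \<otimes> ?M"
    unfolding pow using a assms(1) M by (simp add: m_assoc)
  also have "\<dots> = (x a [^] k a \<otimes> ?M) \<otimes> u"
    using a assms(1) M by (simp add: m_assoc)
  finally show ?case
    using a M(2) by simp
qed (use assms in simp)

lemma commute_mon:
  assumes "u \<in> carrier A" "\<And>j. j \<in> J \<Longrightarrow> u \<otimes> x j = x j \<otimes> u"
  shows "u \<otimes> mon k = mon k \<otimes> u"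
  using commute_mon_list[OF assms subset_refl] by (simp add: mon_def)

lemma x_commute_mon: "j \<in> J \<Longrightarrow> x j \<otimes> mon k = mon k \<otimes> x j"
  by (rule commute_mon) (auto simp: x_commute)

lemma mon_commute: "mon k \<otimes> mon l = mon l \<otimes> mon k"
  by (rule commute_mon) (auto simp: x_commute_mon)

lemma mon_cong: "(\<And>j. j \<in> J \<Longrightarrow> k j = l j) \<Longrightarrow> mon k = mon l"
  unfolding mon_def by (rule arg_cong[of _ _ "\<lambda>xs. foldr (\<otimes>) xs \<one>"]) auto

lemma mon_zero [simp]: "mon (\<lambda>j. 0) = \<one>"
proof -
  have "foldr (\<otimes>) (map (\<lambda>j. x j [^] (0 :: nat)) xs) \<one> = \<one>" for xs
    by (induction xs) auto
  then show ?thesis by (simp add: mon_def)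
qed

lemma mon_mult: "mon k \<otimes> mon l = mon (\<lambda>j. k j + l j)"
proof -
  have "mon_list k xs \<otimes> mon_list l xs = mon_list (\<lambda>j. k j + l j) xs" if "set xs \<subseteq> J" for xs
    using that
  proof (induction xs)
    case (Cons a xs)
    then have a: "a \<in> J"
      by simp
    have M: "mon_list k xs \<in> carrier A" "mon_list l xs \<in> carrier A"
        "x a \<otimes> mon_list k xs = mon_list k xs \<otimes> x a"
      using commute_mon_list[of "x a" xs k] commute_mon_list[of "x a" xs l] Cons.prems a x_commute by auto
    have pow: "mon_list k xs \<otimes> x a [^] l a = x a [^] l a \<otimes> mon_list k xs"
      using group_commutes_pow[of "x a" "mon_list k xs" "l a"] M(1,3) a by simp
    have "(x a [^] k a \<otimes> mon_list k xs) \<otimes> (x a [^] l a \<otimes> mon_list l xs)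
        = x a [^] k a \<otimes> ((mon_list k xs \<otimes> x a [^] l a) \<otimes> mon_list l xs)"
      using a M(1,2) by (simp add: m_assoc)
    also have "\<dots> = (x a [^] k a \<otimes> x a [^] l a) \<otimes> (mon_list k xs \<otimes> mon_list l xs)"
      unfolding pow using a M(1,2) by (simp add: m_assoc)
    also have "\<dots> = x a [^] (k a + l a) \<otimes> mon_list (\<lambda>j. k j + l j) xs"
      using a Cons by (simp add: nat_pow_mult)
    finally show ?case
      by simp
  qed simp
  then show ?thesis
    by (simp add: mon_def)
qed

lemma mon_single:
  assumes "j \<in> J" shows "mon (\<lambda>i. if i = j then 1 else 0) = x j"
proof -
  have "foldr (\<otimes>) (map (\<lambda>i. x i [^] (if i = j then 1 else 0 :: nat)) xs) \<one>
      = (if j \<in> set xs then x j else \<one>)" if "set xs \<subseteq> J" "distinct xs" for xs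
    using that assms by (induction xs) auto
  from this[OF subset_refl distinct_js] show ?thesis
    unfolding mon_def using assms by simp
qed

lemma x_S [simp]: "j \<in> J \<Longrightarrow> x j \<in> S"
  unfolding S_def using mon_single by (metis rangeI)

lemma S_mult: "s \<in> S \<Longrightarrow> t \<in> S \<Longrightarrow> s \<otimes> t \<in> S"
  by (auto simp: S_def mon_mult)

lemma one_S: "\<one> \<in> S"
  unfolding S_def using mon_zero by (metis rangeI)

text \<open>A monomial is a product of single \<open>x j\<close>, and claims about \<open>S\<close>
  are proved one factor at a time.\<close>

lemma S_induct [consumes 1, case_names one mult]:
  assumes "s \<in> S" "P \<one>" "\<And>j s. j \<in> J \<Longrightarrow> s \<in> carrier A \<Longrightarrow> P s \<Longrightarrow> P (x j \<otimes> s)"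
  shows "P s"
proof -
  have pow: "P (x j [^] m \<otimes> s)" if "j \<in> J" "s \<in> carrier A" "P s" for j s and m :: nat
  proof (induction m)
    case (Suc m)
    then have "P (x j \<otimes> (x j [^] m \<otimes> s))"
      using that assms(3) by simp
    moreover have "x j \<otimes> (x j [^] m \<otimes> s) = x j [^] Suc m \<otimes> s"
      using that nat_pow_Suc2[of "x j" m] by (simp add: m_assoc del: nat_pow_Suc)
    ultimately show ?case by simp
  qed (use that in simp)
  have "P (mon_list k xs) \<and> mon_list k xs \<in> carrier A"
    if "set xs \<subseteq> J" for k :: "nat \<Rightarrow> nat" and xs
    using that
  proof (induction xs)
    case (Cons a xs)
    then show ?case
      using pow[of a "mon_list k xs" "k a"] by simp
  qed (use assms(2) in simp)
  then have "P (mon k)" for k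
    by (simp add: mon_def)
  then show ?thesis
    using assms(1) by (auto simp: S_def)
qed

sublocale left_ore A S
proof
  show sub: "S \<subseteq> carrier A"
    by (auto simp: S_def)
  show "\<one> \<in> S" and "\<And>s t. s \<in> S \<Longrightarrow> t \<in> S \<Longrightarrow> s \<otimes> t \<in> S"
    by (rule one_S) (rule S_mult)
  \<comment> \<open>Induction over the factors of \<open>s\<close>, for all \<open>u\<close>
    together: in the case \<open>x j \<otimes> s\<close> the hypothesis deals with \<open>s\<close>,
    and the ad-nilpotency of the element that remains deals with \<open>x j\<close>.\<close>
  have *: "\<forall>u \<in> carrier A. (\<exists>t \<in> S. \<exists>v \<in> carrier A. t \<otimes> u = v \<otimes> s)
      \<and> (u \<otimes> s = \<zero> \<longrightarrow> (\<exists>t \<in> S. t \<otimes> u = \<zero>))" if "s \<in> S" for s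
    using that
  proof (induction rule: S_induct)
    case one
    show ?case
      using one_S by (auto intro!: bexI[of _ \<one>])
  next
    case (mult j s)
    have xj: "x j \<in> S" "carrier A \<subseteq> adnil (x j)" "x j \<in> carrier A"
      using mult.hyps(1) x_adnil by auto
    show ?case
    proof (intro ballI conjI impI)
      fix u assume u: "u \<in> carrier A"
      obtain t v where t: "t \<in> S" "v \<in> carrier A" "t \<otimes> u = v \<otimes> s"
        using mult.IH u by blast
      obtain t' v' where t': "t' \<in> S" "v' \<in> carrier A" "t' \<otimes> v = v' \<otimes> x j"
        using adnil_ore[OF xj(1) sub one_S S_mult subsetD[OF xj(2) t(2)]] by blast
      have tc: "t \<in> carrier A" "t' \<in> carrier A"
        using t t' sub by auto
      have "(t' \<otimes> t) \<otimes> u = (t' \<otimes> v) \<otimes> s"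
        using u t tc mult.hyps by (simp add: m_assoc)
      also have "\<dots> = v' \<otimes> (x j \<otimes> s)"
        unfolding t'(3) using t'(2) xj(3) mult.hyps by (simp add: m_assoc)
      finally show "\<exists>t \<in> S. \<exists>v \<in> carrier A. t \<otimes> u = v \<otimes> (x j \<otimes> s)"
        using t(1) t'(1,2) S_mult by blast
    next
      fix u assume u: "u \<in> carrier A" "u \<otimes> (x j \<otimes> s) = \<zero>"
      then have "(u \<otimes> x j) \<otimes> s = \<zero>" "u \<otimes> x j \<in> carrier A"
        using xj(3) mult.hyps by (simp_all add: m_assoc)
      then obtain t where t: "t \<in> S" "t \<otimes> (u \<otimes> x j) = \<zero>"
        using mult.IH by blast
      have tc: "t \<in> carrier A"
        using t sub by auto
      have "t \<otimes> u \<in> adnil (x j)" "(t \<otimes> u) \<otimes> x j = \<zero>"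
        using t tc u(1) xj by (auto simp: m_assoc)
      then obtain t' where t': "t' \<in> S" "t' \<otimes> (t \<otimes> u) = \<zero>"
        using adnil_reversible[OF xj(1) sub one_S S_mult] by blast
      then have "(t' \<otimes> t) \<otimes> u = \<zero>"
        using tc u(1) sub by (simp add: m_assoc subset_iff)
      then show "\<exists>t \<in> S. t \<otimes> u = \<zero>"
        using t(1) t'(1) S_mult by blast
    qed
  qed
  show "\<exists>t \<in> S. \<exists>v \<in> carrier A. t \<otimes> u = v \<otimes> s" if "u \<in> carrier A" "s \<in> S" for u s
    using *[OF that(2)] that(1) by blast
  show "\<exists>t \<in> S. t \<otimes> u = \<zero>" if "u \<in> carrier A" "s \<in> S" "u \<otimes> s = \<zero>" for u s
    using *[OF that(2)] that by blast
qed

lemma mon_S [simp]: "mon k \<in> S"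
  by (simp add: S_def)

end

section \<open>Independence of weights\<close>

lemma (in calg) finsum_additive:
  assumes "finite F" "\<And>k. k \<in> F \<Longrightarrow> f k \<in> carrier A" "\<And>u. u \<in> carrier A \<Longrightarrow> T u \<in> carrier A"
    and "T \<zero> = \<zero>" "\<And>u v. u \<in> carrier A \<Longrightarrow> v \<in> carrier A \<Longrightarrow> T (u \<oplus> v) = T u \<oplus> T v"
  shows "T (\<Oplus>k \<in> F. f k) = (\<Oplus>k \<in> F. T (f k))"
  using assms(1,2)
proof (induction F)
  case empty
  then show ?case using assms(4) by simp
next
  case (insert a F)
  have "T (\<Oplus>k \<in> insert a F. f k) = T (f a \<oplus> (\<Oplus>k \<in> F. f k))"
    using insert by (subst finsum_insert) auto
  also have "\<dots> = T (f a) \<oplus> T (\<Oplus>k \<in> F. f k)"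
    using insert assms(5) by (simp add: finsum_closed)
  also have "\<dots> = (\<Oplus>k \<in> insert a F. T (f k))"
    using insert assms(3) by (subst finsum_insert) auto
  finally show ?case .
qed

context graded_torus
begin

text \<open>The operator \<open>ad h\<^sub>i - wt i l\<close> removes the component of weight
  \<open>l\<close> and only rescales the others, so the induction hypothesis applies to what is
  left.\<close>

lemma weights_independent:
  assumes "finite F" "F \<subseteq> lattice" "\<And>k. k \<in> F \<Longrightarrow> f k \<in> W k" "(\<Oplus>k \<in> F. f k) = \<zero>"
  shows "\<forall>k \<in> F. f k = \<zero>"
  using assms
proof (induction F arbitrary: f)
  case (insert l F)
  have c: "\<And>k. k \<in> insert l F \<Longrightarrow> f k \<in> carrier A"
    using insert.prems(2) W_closed by blast
  have F: "f k = \<zero>" if "k \<in> F" for k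
  proof -
    have "k \<noteq> l"
      using that insert.hyps by auto
    moreover have "k \<in> lattice" "l \<in> lattice"
      using insert.prems(1) that by auto
    \<comment> \<open>The choice of \<open>i\<close> depends on the component \<open>k\<close> under
      consideration: a single \<open>h i\<close> may fail to separate all weights in
      question.\<close>
    ultimately obtain i where i: "i \<in> J" "wt i k \<noteq> wt i l"
      using wt_inj[of k l] unfolding lattice_def by blast
    define T where "T u = comm (h i) u \<ominus> wt i l \<odot> u" for u
    have T: "T (\<Oplus>k \<in> insert l F. f k) = (\<Oplus>k \<in> insert l F. T (f k))"
    proof (rule finsum_additive)
      show "T (u \<oplus> v) = T u \<oplus> T v" if "u \<in> carrier A" "v \<in> carrier A" for u v
        unfolding T_def using that i(1) by (simp add: comm_add scale_add_right add_diff_swap)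
    qed (use insert.hyps c i(1) in \<open>auto simp: T_def a_minus_def\<close>)
    have Tf: "T (f k) = (wt i k - wt i l) \<odot> f k" if "k \<in> insert l F" for k
      using W_comm[OF insert.prems(2)[OF that] i(1)] c[OF that] by (simp add: T_def diff_scale)
    have "(\<Oplus>k \<in> insert l F. (wt i k - wt i l) \<odot> f k) = (\<Oplus>k \<in> insert l F. T (f k))"
      by (rule finsum_cong') (use Tf c in auto)
    also have "\<dots> = \<zero>"
      using T insert.prems(3) i(1) by (simp add: T_def a_minus_def)
    finally have "(\<Oplus>k \<in> F. (wt i k - wt i l) \<odot> f k) = \<zero>"
      using insert.hyps c by (subst (asm) finsum_insert) auto
    then have "\<forall>k \<in> F. (wt i k - wt i l) \<odot> f k = \<zero>"
      using insert.prems(1,2) W_scale by (intro insert.IH) auto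
    then show ?thesis
      using that i(2) c scale_eq_zero[of "f k" "wt i k - wt i l"] by auto
  qed
  have "f l \<oplus> (\<Oplus>k \<in> F. f k) = \<zero>"
    using insert.prems(3) insert.hyps c by (subst (asm) finsum_insert) auto
  moreover have "(\<Oplus>k \<in> F. f k) = (\<Oplus>k \<in> F. \<zero>)"
    by (rule finsum_cong') (use F in auto)
  ultimately show ?case
    using F c by (simp add: finsum_zero)
qed simp

section \<open>The left ideal of the \<open>x\<^sub>j - 1\<close> and homogenization\<close>

abbreviation "I \<equiv> left_ideal ((\<lambda>j. x j \<ominus> \<one>) ` J)"

lemma I_gens: "(\<lambda>j. x j \<ominus> \<one>) ` J \<subseteq> carrier A"
  by auto

lemmas I_closed = left_ideal_closed[OF I_gens] and I_add = left_ideal_add[OF I_gens]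
  and I_mult = left_ideal_mult[OF I_gens] and I_diff = left_ideal_diff[OF I_gens]
  and I_trans = left_ideal_trans[OF I_gens] and I_sym = left_ideal_sym[OF I_gens]

lemma I_right_mult_x:
  assumes "j \<in> J" "y \<in> I"
  shows "y \<otimes> x j \<in> I"
proof (rule left_ideal_right_mult[OF I_gens _ _ assms(2)])
  fix g assume "g \<in> (\<lambda>j. x j \<ominus> \<one>) ` J"
  then obtain i where i: "i \<in> J" "g = x i \<ominus> \<one>"
    by auto
  then have "g \<otimes> x j = x j \<otimes> g"
    using assms(1) x_commute by (simp add: a_minus_def l_distr r_distr l_minus r_minus)
  then show "g \<otimes> x j \<in> I"
    using left_ideal_gen[OF I_gens, of "x j" g] assms(1) i by auto
qed (use assms in simp)

text \<open>One factor at a time, because \<open>u x\<^sub>j\<close> and \<open>u\<close> differ by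
  a left multiple of a generator. Right multiplication by monomials thus changes weights but not
  classes.\<close>

lemma S_diff_I:
  assumes "s \<in> S" "u \<in> carrier A"
  shows "u \<otimes> s \<ominus> u \<in> I"
  using assms
proof (induction arbitrary: u rule: S_induct)
  case one
  then show ?case
    by (simp add: a_minus_def r_neg left_ideal.zero)
next
  case (mult j s)
  have "(u \<otimes> x j) \<otimes> s \<ominus> u \<otimes> x j \<in> I"
    using mult by simp
  moreover have "u \<otimes> x j \<ominus> u \<in> I"
    using left_ideal_gen[OF I_gens, of u "x j \<ominus> \<one>"] mult
    by (simp add: a_minus_def r_distr r_minus)
  ultimately show ?case
    using I_trans[of "(u \<otimes> x j) \<otimes> s" "u \<otimes> x j" u] mult by (simp add: m_assoc)
qed

text \<open>The exponent of the monomial that moves weight \<open>k\<close> to weight \<open>m\<close>; it is meaningful only if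
  \<open>k \<le> m\<close>.\<close>

definition gap :: "(nat \<Rightarrow> int) \<Rightarrow> (nat \<Rightarrow> int) \<Rightarrow> nat \<Rightarrow> nat" where
  "gap m k j = nat (m j - k j)"

lemma mon_gap_trans:
  assumes "\<And>j. j \<in> J \<Longrightarrow> k j \<le> l j" "\<And>j. j \<in> J \<Longrightarrow> l j \<le> m j"
  shows "mon (gap l k) \<otimes> mon (gap m l) = mon (gap m k)"
  unfolding mon_mult by (rule mon_cong) (use assms in \<open>force simp: gap_def\<close>)

lemma W_mon_gap:
  assumes "u \<in> W k" "k \<in> lattice" "m \<in> lattice" "\<And>j. j \<in> J \<Longrightarrow> k j \<le> m j"
  shows "u \<otimes> mon (gap m k) \<in> W m"
proof -
  have "(\<lambda>j. k j + expo (gap m k) j) = m"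
    using assms(2-4) by (auto simp: expo_def gap_def lattice_def fun_eq_iff)
  then show ?thesis
    using W_mult[OF assms(1) mon_W] by metis
qed

text \<open>The sum of the absolute values over \<open>F\<close> bounds every weight in
  \<open>F\<close>. A bound with natural coordinates is the weight of a monomial, which can then
  serve as a denominator.\<close>

lemma lattice_bound:
  assumes "finite F"
  shows "\<exists>m :: nat \<Rightarrow> nat. \<forall>k \<in> F. \<forall>j \<in> J. k j \<le> expo m j"
proof -
  have "\<forall>k \<in> F. \<forall>j \<in> J. k j \<le> expo (\<lambda>j. \<Sum>k \<in> F. nat \<bar>k j\<bar>) j"
  proof (intro ballI)
    fix k j assume kj: "k \<in> F" "j \<in> J"
    have "\<bar>k j\<bar> \<le> (\<Sum>k \<in> F. \<bar>k j\<bar>)"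
      by (rule member_le_sum) (use kj assms in auto)
    then show "k j \<le> expo (\<lambda>j. \<Sum>k \<in> F. nat \<bar>k j\<bar>) j"
      using kj by (simp add: expo_def)
  qed
  then show ?thesis by blast
qed

text \<open>\<open>homogenizes_to_zero F f m u\<close>: the weight components of \<open>u\<close>, moved to the common weight \<open>m\<close> by
  monomials, add up to zero.\<close>

definition homogenizes_to_zero ::
    "(nat \<Rightarrow> int) set \<Rightarrow> ((nat \<Rightarrow> int) \<Rightarrow> 'a) \<Rightarrow> (nat \<Rightarrow> int) \<Rightarrow> 'a \<Rightarrow> bool" where
  "homogenizes_to_zero F f m u \<longleftrightarrow> finite F \<and> F \<subseteq> lattice \<and> (\<forall>k. f k \<in> W k) \<and> (\<forall>k. k \<notin> F \<longrightarrow> f k = \<zero>)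
    \<and> (\<forall>k \<in> F. \<forall>j \<in> J. k j \<le> m j) \<and> u = (\<Oplus>k \<in> F. f k) \<and> (\<Oplus>k \<in> F. f k \<otimes> mon (gap m k)) = \<zero>"

text \<open>Raising the target weight from \<open>m\<close> to \<open>m'\<close> multiplies the
  homogenized sum on the right by one monomial, and the added indices carry zero components.\<close>

lemma homogenizes_enlarge:
  assumes H: "homogenizes_to_zero F f m u"
    and G: "F \<subseteq> G" "finite G" "G \<subseteq> lattice" "\<forall>k \<in> G. \<forall>j \<in> J. k j \<le> m' j" "\<forall>j \<in> J. m j \<le> m' j"
  shows "homogenizes_to_zero G f m' u"
proof -
  have f: "\<And>k. f k \<in> carrier A" and f0: "\<And>k. k \<notin> F \<Longrightarrow> f k = \<zero>" and fin: "finite F"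
    and le: "\<And>k j. k \<in> F \<Longrightarrow> j \<in> J \<Longrightarrow> k j \<le> m j" and z: "(\<Oplus>k \<in> F. f k \<otimes> mon (gap m k)) = \<zero>"
    using H W_closed unfolding homogenizes_to_zero_def by blast+
  have "u = (\<Oplus>k \<in> F. f k)"
    using H by (simp add: homogenizes_to_zero_def)
  also have "\<dots> = (\<Oplus>k \<in> G. f k)"
    by (rule add.finprod_mono_neutral_cong_left) (use G f f0 in auto)
  finally have u: "u = (\<Oplus>k \<in> G. f k)" .
  have "(\<Oplus>k \<in> G. f k \<otimes> mon (gap m' k)) = (\<Oplus>k \<in> F. f k \<otimes> mon (gap m' k))"
    by (rule add.finprod_mono_neutral_cong_right) (use G f f0 in auto)
  also have "\<dots> = (\<Oplus>k \<in> F. (f k \<otimes> mon (gap m k)) \<otimes> mon (gap m' m))"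
    by (rule finsum_cong') (use f le G(5) in \<open>auto simp: m_assoc mon_gap_trans\<close>)
  also have "\<dots> = (\<Oplus>k \<in> F. f k \<otimes> mon (gap m k)) \<otimes> mon (gap m' m)"
    using finsum_ldistr[OF fin, of "mon (gap m' m)" "\<lambda>k. f k \<otimes> mon (gap m k)"] f by simp
  finally have "(\<Oplus>k \<in> G. f k \<otimes> mon (gap m' k)) = \<zero>"
    using z by simp
  then show ?thesis
    using H G u unfolding homogenizes_to_zero_def by blast
qed

lemma homogenizes_add:
  assumes "homogenizes_to_zero F f m u" "homogenizes_to_zero F' f' m' u'"
  shows "\<exists>G g p. homogenizes_to_zero G g p (u \<oplus> u')"
proof -
  let ?G = "F \<union> F'"
  have G: "finite ?G" "?G \<subseteq> lattice"
    using assms by (auto simp: homogenizes_to_zero_def)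
  obtain p where p: "\<forall>k \<in> insert m (insert m' ?G). \<forall>j \<in> J. k j \<le> expo p j"
    using lattice_bound[of "insert m (insert m' ?G)"] G(1) by auto
  have H: "homogenizes_to_zero ?G f (expo p) u" "homogenizes_to_zero ?G f' (expo p) u'"
    using assms G p by (auto intro: homogenizes_enlarge)
  have f: "\<And>k. f k \<in> W k" "\<And>k. f' k \<in> W k"
    using assms by (auto simp: homogenizes_to_zero_def)
  note fc = f[THEN W_closed]
  have "u \<oplus> u' = (\<Oplus>k \<in> ?G. f k \<oplus> f' k)"
    using H fc by (simp add: homogenizes_to_zero_def finsum_addf)
  moreover have "(\<Oplus>k \<in> ?G. (f k \<oplus> f' k) \<otimes> mon (gap (expo p) k)) = \<zero>"
  proof -
    have "(\<Oplus>k \<in> ?G. (f k \<oplus> f' k) \<otimes> mon (gap (expo p) k))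
        = (\<Oplus>k \<in> ?G. f k \<otimes> mon (gap (expo p) k) \<oplus> f' k \<otimes> mon (gap (expo p) k))"
      by (rule finsum_cong') (use fc in \<open>auto simp: l_distr\<close>)
    also have "\<dots> = \<zero> \<oplus> \<zero>"
      using H fc by (subst finsum_addf) (auto simp: homogenizes_to_zero_def)
    finally show ?thesis by simp
  qed
  ultimately have "homogenizes_to_zero ?G (\<lambda>k. f k \<oplus> f' k) (expo p) (u \<oplus> u')"
    using H f W_add unfolding homogenizes_to_zero_def by auto
  then show ?thesis by blast
qed

text \<open>The components are \<open>- v\<close> in weight \<open>k\<close> and
  \<open>v x\<^sub>j\<close> in the next weight. Moving the first one up costs exactly the factor
  \<open>x\<^sub>j\<close>, so the two cancel; this is where the form \<open>x\<^sub>j - 1\<close>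
  of the generators enters.\<close>

lemma homogenizes_generator:
  assumes "v \<in> W k" "k \<in> lattice" "j \<in> J"
  shows "\<exists>G g p. homogenizes_to_zero G g p (v \<otimes> (x j \<ominus> \<one>))"
proof -
  let ?l = "\<lambda>i. k i + (if i = j then 1 else 0)"
  define g where "g p = (if p = k then \<ominus> v else if p = ?l then v \<otimes> x j else \<zero>)" for p
  have v: "v \<in> carrier A" "x j \<in> carrier A"
    using assms W_closed by auto
  have kl: "k \<noteq> ?l"
  proof
    assume "k = ?l"
    then have "k j = ?l j" by (rule fun_cong)
    then show False by simp
  qed
  have gk: "g k = \<ominus> v" and gl: "g ?l = v \<otimes> x j"
    using kl by (auto simp: g_def)
  have W: "\<ominus> v \<in> W k" "v \<otimes> x j \<in> W ?l"
    using W_scale[OF assms(1), of "- 1"] minus_scale[OF v(1), of 1] v(1) W_mult[OF assms(1) x_W[OF assms(3)]]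
    by simp_all
  have gc: "g p \<in> W p" for p
    using W by (simp add: g_def)
  have m1: "mon (gap ?l k) = x j"
    unfolding mon_single[OF assms(3), symmetric] by (rule mon_cong) (simp add: gap_def)
  have m2: "mon (gap ?l ?l) = \<one>"
    unfolding mon_zero[symmetric] by (rule mon_cong) (simp add: gap_def)
  have "(\<Oplus>p \<in> {k, ?l}. g p) = \<ominus> v \<oplus> v \<otimes> x j"
    using kl v gk gl by (subst finsum_insert) auto
  then have "v \<otimes> (x j \<ominus> \<one>) = (\<Oplus>p \<in> {k, ?l}. g p)"
    using v by (simp add: a_minus_def r_distr r_minus a_comm)
  moreover have "(\<Oplus>p \<in> {k, ?l}. g p \<otimes> mon (gap ?l p)) = g k \<otimes> mon (gap ?l k) \<oplus> g ?l \<otimes> mon (gap ?l ?l)"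
    using kl v gk gl by (subst finsum_insert) auto
  then have "(\<Oplus>p \<in> {k, ?l}. g p \<otimes> mon (gap ?l p)) = \<zero>"
    unfolding m1 m2 gk gl using v by (simp add: l_minus l_neg)
  moreover have "?l \<in> lattice"
    using assms(2,3) by (auto simp: lattice_def)
  moreover have "\<forall>p. p \<notin> {k, ?l} \<longrightarrow> g p = \<zero>"
    by (simp add: g_def)
  ultimately have "homogenizes_to_zero {k, ?l} g ?l (v \<otimes> (x j \<ominus> \<one>))"
    unfolding homogenizes_to_zero_def using gc assms(2) by auto
  then show ?thesis by blast
qed

text \<open>Weight components are unique, so the only component of \<open>v\<close> is
  \<open>v\<close> itself, and its homogenization is \<open>v\<close> times a monomial.\<close>

lemma homogenizes_weight:
  assumes H: "homogenizes_to_zero F f m v" and v: "v \<in> W k" "k \<in> lattice"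
  shows "\<exists>l. v \<otimes> mon l = \<zero>"
proof -
  obtain p where p: "\<forall>q \<in> insert m (insert k F). \<forall>j \<in> J. q j \<le> expo p j"
    using lattice_bound[of "insert m (insert k F)"] H by (auto simp: homogenizes_to_zero_def)
  have H': "homogenizes_to_zero (insert k F) f (expo p) v"
    by (rule homogenizes_enlarge[OF H]) (use H p v in \<open>auto simp: homogenizes_to_zero_def\<close>)
  let ?G = "insert k F"
  have G: "finite ?G" "?G \<subseteq> lattice" and f: "\<And>q. f q \<in> W q" and sum: "v = (\<Oplus>q \<in> ?G. f q)"
    and z: "(\<Oplus>q \<in> ?G. f q \<otimes> mon (gap (expo p) q)) = \<zero>"
    using H' by (auto simp: homogenizes_to_zero_def)
  note fc = f[THEN W_closed]
  \<comment> \<open>The trivial decomposition of \<open>v\<close>. Independence of weights, applied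
    to the differences \<open>f q \<ominus> d q\<close>, identifies it with the given one.\<close>
  define d where "d q = (if q = k then v else \<zero>)" for q
  have dW: "d q \<in> W q" for q
    using v by (simp add: d_def)
  have single: "(\<Oplus>q \<in> ?G. if q = k then a else \<zero>) = a" if "a \<in> carrier A" for a
  proof -
    have "(\<Oplus>q \<in> ?G. if q = k then a else \<zero>) = (\<Oplus>q \<in> {k}. if q = k then a else \<zero>)"
      by (rule add.finprod_mono_neutral_cong_right) (use G that in auto)
    then show ?thesis using that by simp
  qed
  have "(\<Oplus>q \<in> ?G. f q \<ominus> d q) = \<zero>"
  proof -
    have "(\<Oplus>q \<in> ?G. f q \<ominus> d q) \<oplus> (\<Oplus>q \<in> ?G. d q) = (\<Oplus>q \<in> ?G. (f q \<ominus> d q) \<oplus> d q)"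
      using fc dW[THEN W_closed] by (subst finsum_addf) auto
    also have "\<dots> = (\<Oplus>q \<in> ?G. f q)"
      by (rule finsum_cong') (use fc dW[THEN W_closed] in auto)
    also have "\<dots> = v"
      using sum by simp
    finally have "(\<Oplus>q \<in> ?G. f q \<ominus> d q) \<oplus> v = v"
      using single[OF W_closed[OF v(1)]] by (simp add: d_def)
    moreover have "(\<Oplus>q \<in> ?G. f q \<ominus> d q) \<in> carrier A"
      using fc dW[THEN W_closed] by (intro finsum_closed) auto
    ultimately show ?thesis
      using W_closed[OF v(1)] by simp
  qed
  then have "\<forall>q \<in> ?G. f q \<ominus> d q = \<zero>"
    using G f dW W_diff by (intro weights_independent) auto
  then have fd: "f q = d q" if "q \<in> ?G" for q
    using that fc dW[THEN W_closed] by (metis diff_eq_zero_iff)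
  have "(\<Oplus>q \<in> ?G. f q \<otimes> mon (gap (expo p) q))
      = (\<Oplus>q \<in> ?G. if q = k then v \<otimes> mon (gap (expo p) k) else \<zero>)"
    by (rule finsum_cong') (use fd W_closed[OF v(1)] in \<open>auto simp: d_def\<close>)
  then have "v \<otimes> mon (gap (expo p) k) = \<zero>"
    using z single W_closed[OF v(1)] by simp
  then show ?thesis by blast
qed

inductive_set weight_span :: "'a set" where
  zero: "\<zero> \<in> weight_span"
| add: "u \<in> weight_span \<Longrightarrow> k \<in> lattice \<Longrightarrow> v \<in> W k \<Longrightarrow> u \<oplus> v \<in> weight_span"

lemma weight_span_closed: "u \<in> weight_span \<Longrightarrow> u \<in> carrier A"
  by (induction rule: weight_span.induct) (auto simp: W_closed)

lemma weight_span_W: "k \<in> lattice \<Longrightarrow> v \<in> W k \<Longrightarrow> v \<in> weight_span"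
  using weight_span.add[OF weight_span.zero, of k v] by (simp add: W_closed)

lemma weight_span_add:
  assumes "u \<in> weight_span" shows "v \<in> weight_span \<Longrightarrow> u \<oplus> v \<in> weight_span"
proof (induction rule: weight_span.induct)
  case zero
  then show ?case using assms by (simp add: weight_span_closed)
next
  case (add v k w)
  have "(u \<oplus> v) \<oplus> w \<in> weight_span"
    by (rule weight_span.add[OF add.IH add.hyps(2,3)])
  then show ?case
    using assms add.hyps by (simp add: a_assoc weight_span_closed W_closed)
qed

lemma weight_span_mult:
  assumes "u \<in> weight_span" "v \<in> weight_span"
  shows "u \<otimes> v \<in> weight_span"
proof -
  have *: "u \<otimes> w \<in> weight_span" if w: "w \<in> W l" "l \<in> lattice" for w l
    using assms(1)
  proof induction
    case (add u k v)
    have "v \<otimes> w \<in> weight_span"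
      by (rule weight_span_W[OF _ W_mult[OF add.hyps(3) w(1)]])
        (use add.hyps(2) w(2) in \<open>auto simp: lattice_def\<close>)
    then have "u \<otimes> w \<oplus> v \<otimes> w \<in> weight_span"
      by (rule weight_span_add[OF add.IH])
    then show ?case
      using add.hyps w by (simp add: l_distr weight_span_closed W_closed)
  qed (use w in \<open>simp add: W_closed weight_span.zero\<close>)
  show ?thesis
    using assms(2)
  proof induction
    case (add v k w)
    have "u \<otimes> v \<oplus> u \<otimes> w \<in> weight_span"
      by (rule weight_span_add[OF add.IH *[OF add.hyps(3,2)]])
    then show ?case
      using add.hyps assms(1) by (simp add: r_distr weight_span_closed W_closed)
  qed (use assms in \<open>simp add: weight_span_closed weight_span.zero\<close>)
qed

lemma weight_span_scale: "u \<in> weight_span \<Longrightarrow> c \<odot> u \<in> weight_span"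
proof (induction rule: weight_span.induct)
  case (add u k v)
  have "c \<odot> u \<oplus> c \<odot> v \<in> weight_span"
    by (rule weight_span.add[OF add.IH add.hyps(2) W_scale[OF add.hyps(3)]])
  then show ?case
    using add.hyps by (simp add: scale_add_right weight_span_closed W_closed)
qed (simp add: weight_span.zero)

lemma weight_span_generated:
  assumes "H \<subseteq> weight_span" "u \<in> generated_subalgebra A H"
  shows "u \<in> weight_span"
  using assms(2)
proof induction
  case one
  show ?case
    by (rule weight_span_W[OF _ W_one]) (simp add: lattice_def)
qed (use assms weight_span_add weight_span_mult weight_span_scale in auto)

end

lemma (in monoid) commute_inv:
  assumes "a \<in> carrier G" "y \<in> Units G" "a \<otimes> y = y \<otimes> a"
  shows "a \<otimes> inv y = inv y \<otimes> a"
proof -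
  have y: "y \<in> carrier G" "inv y \<in> carrier G"
    using assms(2) by auto
  have "inv y \<otimes> (a \<otimes> y) \<otimes> inv y = inv y \<otimes> (y \<otimes> a) \<otimes> inv y"
    using assms(3) by simp
  then have "inv y \<otimes> a \<otimes> (y \<otimes> inv y) = (inv y \<otimes> y) \<otimes> a \<otimes> inv y"
    using assms(1) y by (simp add: m_assoc del: Units_l_inv Units_r_inv)
  then show ?thesis
    using assms y by simp
qed

text \<open>The axioms are known on the side of \<open>A\<close> only and are carried to
  \<open>B\<close> by \<open>f\<close>, while the isomorphism asked for is the inverse of
  \<open>f\<close>. In the application \<open>A\<close> is the centralizer.\<close>

lemma calgebra_isomorphicI:
  assumes A: "calgebra A" and f: "f \<in> calgebra_hom A B" and bij: "bij_betw f (carrier A) (carrier B)"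
    and z: "f \<zero>\<^bsub>A\<^esub> = \<zero>\<^bsub>B\<^esub>"
  shows "calgebra_isomorphic B A"
proof -
  interpret A: calg A using A by (rule calg.intro)
  note h = calgebra_homD[OF f]
  have surj: "f ` carrier A = carrier B" and inj: "inj_on f (carrier A)"
    using bij by (auto simp: bij_betw_def)
  let ?g = "inv_into (carrier A) f"
  have g: "?g y \<in> carrier A" "f (?g y) = y" if "y \<in> carrier B" for y
    using that by (auto simp: surj[symmetric] inv_into_into f_inv_into_f)
  have gI: "?g (f a) = a" if "a \<in> carrier A" for a
    using inv_into_f_f[OF inj that] .
  have "?g \<in> calgebra_hom B A"
  proof (rule calgebra_homI)
    show "?g (x \<otimes>\<^bsub>B\<^esub> y) = ?g x \<otimes>\<^bsub>A\<^esub> ?g y" if "x \<in> carrier B" "y \<in> carrier B" for x y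
      using gI[of "?g x \<otimes>\<^bsub>A\<^esub> ?g y"] h(2)[of "?g x" "?g y"] g that by simp
    show "?g (x \<oplus>\<^bsub>B\<^esub> y) = ?g x \<oplus>\<^bsub>A\<^esub> ?g y" if "x \<in> carrier B" "y \<in> carrier B" for x y
      using gI[of "?g x \<oplus>\<^bsub>A\<^esub> ?g y"] h(3)[of "?g x" "?g y"] g that by simp
    show "?g (c \<odot>\<^bsub>B\<^esub> x) = c \<odot>\<^bsub>A\<^esub> ?g x" if "x \<in> carrier B" for c x
      using gI[of "c \<odot>\<^bsub>A\<^esub> ?g x"] h(5)[of "?g x" c] g that by simp
    show "?g \<one>\<^bsub>B\<^esub> = \<one>\<^bsub>A\<^esub>"
      using gI[of "\<one>\<^bsub>A\<^esub>"] h(4) by simp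
  qed (use g in simp)
  moreover have "bij_betw ?g (carrier B) (carrier A)"
    by (rule bij_betw_inv_into[OF bij])
  ultimately show ?thesis
    using calgebra_hom_surj_imp_calgebra[OF A f surj z] A by (auto simp: calgebra_isomorphic_def)
qed

section \<open>Whittaker vectors and fractions of weight 0\<close>

locale weight_algebra = graded_torus +
  assumes spanned: "carrier A \<subseteq> weight_span"
begin

text \<open>The property is additive and weight vectors span, which leaves the products
  \<open>v (x\<^sub>j - 1)\<close> with \<open>v\<close> a weight vector.\<close>

lemma I_homogenizes:
  assumes "y \<in> I"
  shows "\<exists>F f m. homogenizes_to_zero F f m y"
proof -
  have base: "homogenizes_to_zero {} (\<lambda>k. \<zero>) m \<zero>" for m
    by (simp add: homogenizes_to_zero_def)
  have gen: "\<exists>F f m. homogenizes_to_zero F f m (a \<otimes> (x j \<ominus> \<one>))" if a: "a \<in> carrier A" and j: "j \<in> J" for a j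
    using subsetD[OF spanned a]
  proof induction
    case zero
    have "homogenizes_to_zero {} (\<lambda>k. \<zero>) (\<lambda>k. 0) (\<zero> \<otimes> (x j \<ominus> \<one>))"
      using base j by simp
    then show ?case
      by blast
  next
    case (add u k v)
    have "(u \<oplus> v) \<otimes> (x j \<ominus> \<one>) = u \<otimes> (x j \<ominus> \<one>) \<oplus> v \<otimes> (x j \<ominus> \<one>)"
      using add.hyps j by (simp add: l_distr weight_span_closed W_closed)
    moreover obtain F f m where "homogenizes_to_zero F f m (u \<otimes> (x j \<ominus> \<one>))"
      using add.IH by blast
    moreover obtain F' f' m' where "homogenizes_to_zero F' f' m' (v \<otimes> (x j \<ominus> \<one>))"
      using homogenizes_generator[OF add.hyps(3,2) j] by blast
    ultimately show ?case
      using homogenizes_add by metis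
  qed
  show ?thesis
    using assms
  proof induction
    case zero
    then show ?case using base by blast
  next
    case (add y a g)
    then obtain j where j: "j \<in> J" "g = x j \<ominus> \<one>"
      by auto
    obtain F f m where "homogenizes_to_zero F f m y"
      using add.IH by blast
    moreover obtain F' f' m' where "homogenizes_to_zero F' f' m' (a \<otimes> g)"
      using gen[OF add.hyps(2) j(1)] j(2) by blast
    ultimately show ?case
      by (rule homogenizes_add)
  qed
qed

lemma weight_I_torsion:
  assumes "v \<in> W k" "k \<in> lattice" "v \<in> I"
  shows "\<exists>l. v \<otimes> mon l = \<zero>"
  using I_homogenizes[OF assms(3)] homogenizes_weight assms(1,2) by blast

lemma homogeneous_representative:
  assumes "u \<in> carrier A"
  shows "\<exists>k v. v \<in> W (expo k) \<and> v \<ominus> u \<in> I"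
  using subsetD[OF spanned assms]
proof induction
  case zero
  then show ?case
    by (intro exI[of _ "\<lambda>_. 0"] exI[of _ \<zero>]) (simp add: a_minus_def left_ideal.zero)
next
  case (add u q w)
  then obtain k v where v: "v \<in> W (expo k)" "v \<ominus> u \<in> I"
    by auto
  obtain m where m: "\<forall>p \<in> {expo k, q}. \<forall>j \<in> J. p j \<le> expo m j"
    using lattice_bound[of "{expo k, q}"] by auto
  have c: "u \<in> carrier A" "v \<in> carrier A" "w \<in> carrier A"
    using add.hyps v W_closed weight_span_closed by auto
  let ?v = "v \<otimes> mon (gap (expo m) (expo k))" and ?w = "w \<otimes> mon (gap (expo m) q)"
  have "?v \<ominus> u \<in> I" "?w \<ominus> w \<in> I"
    using I_trans[OF S_diff_I v(2)] S_diff_I c by auto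
  then have "(?v \<ominus> u) \<oplus> (?w \<ominus> w) \<in> I"
    using I_add by simp
  then have "(?v \<oplus> ?w) \<ominus> (u \<oplus> w) \<in> I"
    using c by (simp add: add_diff_swap)
  moreover have "?v \<oplus> ?w \<in> W (expo m)"
    using m v add.hyps by (intro W_add W_mon_gap) auto
  ultimately show ?case by blast
qed

text \<open>The numerators that give, over \<open>mon k\<close>, fractions of weight 0 commuting
  with the \<open>x j\<close>. The exponent is a parameter because it also fixes the
  denominator.\<close>

definition hom_cent :: "(nat \<Rightarrow> nat) \<Rightarrow> 'a set" where
  "hom_cent k = {u \<in> W (expo k). \<forall>j \<in> J. x j \<otimes> u = u \<otimes> x j}"

lemma mon_hom_cent [simp]: "mon k \<in> hom_cent k"
  by (simp add: hom_cent_def mon_W x_commute_mon)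

lemma hom_cent_closed: "u \<in> hom_cent k \<Longrightarrow> u \<in> carrier A"
  using W_closed by (auto simp: hom_cent_def)

lemma expo_add: "(\<lambda>j. expo k j + expo l j) = expo (\<lambda>j. k j + l j)"
  by (auto simp: expo_def)

lemma hom_cent_mult:
  assumes "u \<in> hom_cent k" "v \<in> hom_cent l"
  shows "u \<otimes> v \<in> hom_cent (\<lambda>j. k j + l j)"
proof -
  note c = assms[THEN hom_cent_closed]
  have "x j \<otimes> (u \<otimes> v) = (u \<otimes> v) \<otimes> x j" if "j \<in> J" for j
  proof -
    have "x j \<otimes> (u \<otimes> v) = (x j \<otimes> u) \<otimes> v"
      using c that by (simp add: m_assoc)
    also have "\<dots> = u \<otimes> (x j \<otimes> v)"
      using c that assms(1) by (simp add: hom_cent_def m_assoc)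
    also have "\<dots> = (u \<otimes> v) \<otimes> x j"
      using c that assms(2) by (simp add: hom_cent_def m_assoc)
    finally show ?thesis .
  qed
  then show ?thesis
    using W_mult[of u "expo k" v "expo l"] assms by (simp add: hom_cent_def expo_add)
qed

lemma hom_cent_add:
  "u \<in> hom_cent k \<Longrightarrow> v \<in> hom_cent k \<Longrightarrow> u \<oplus> v \<in> hom_cent k"
  using W_closed[of u "expo k"] W_closed[of v "expo k"]
  by (simp add: hom_cent_def W_add l_distr r_distr)

lemma hom_cent_scale:
  "u \<in> hom_cent k \<Longrightarrow> c \<odot> u \<in> hom_cent k"
  using W_closed[of u "expo k"]
  by (simp add: hom_cent_def W_scale scale_mult_left scale_mult_right)

lemma hom_cent_commute_mon:
  "u \<in> hom_cent k \<Longrightarrow> u \<otimes> mon l = mon l \<otimes> u"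
  by (rule commute_mon) (auto simp: hom_cent_def W_closed)

text \<open>The representatives of Whittaker vectors in the module \<open>A / I\<close>: since
  \<open>u (x\<^sub>j - 1)\<close> lies in \<open>I\<close>, the condition says that
  \<open>x\<^sub>j - 1\<close> annihilates the class of \<open>u\<close> from the left.\<close>

definition whittaker :: "'a set" where
  "whittaker = {u \<in> carrier A. \<forall>j \<in> J. comm (x j) u \<in> I}"

lemma hom_cent_whittaker: "u \<in> hom_cent k \<Longrightarrow> u \<in> whittaker"
  using hom_cent_closed[of u k]
  by (auto simp: hom_cent_def whittaker_def comm_eq_zero_iff[THEN iffD2] left_ideal.zero)

text \<open>If \<open>v\<close> is a weight vector congruent to \<open>u\<close>, then
  \<open>[x\<^sub>j, v]\<close> is a weight vector in \<open>I\<close> and hence is killed by a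
  monomial. Monomials commute with the \<open>x\<^sub>j\<close>, so multiplying \<open>v\<close> by
  a suitable one turns commutation modulo \<open>I\<close> into commutation.\<close>

lemma whittaker_representative:
  assumes "u \<in> whittaker"
  shows "\<exists>k. \<exists>v \<in> hom_cent k. v \<ominus> u \<in> I"
proof -
  have u: "u \<in> carrier A" "\<And>j. j \<in> J \<Longrightarrow> comm (x j) u \<in> I"
    using assms by (auto simp: whittaker_def)
  obtain k v where v: "v \<in> W (expo k)" "v \<ominus> u \<in> I"
    using homogeneous_representative[OF u(1)] by blast
  note vc = W_closed[OF v(1)]
  have "\<exists>l. comm (x j) v \<otimes> mon l = \<zero>" if j: "j \<in> J" for j
  proof (rule weight_I_torsion)
    let ?l = "\<lambda>i. (if i = j then 1 else 0) + expo k i"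
    have "x j \<otimes> v \<in> W ?l"
      by (rule W_mult[OF x_W[OF j] v(1)])
    moreover have "v \<otimes> x j \<in> W ?l"
      using W_mult[OF v(1) x_W[OF j]] by (simp add: add.commute)
    ultimately show "comm (x j) v \<in> W ?l"
      unfolding comm_def by (rule W_diff)
    show "?l \<in> lattice"
      using j by (auto simp: lattice_def expo_def)
    have "x j \<otimes> (v \<ominus> u) \<ominus> (v \<ominus> u) \<otimes> x j \<in> I"
      using I_mult[of "x j" "v \<ominus> u"] I_right_mult_x[OF j v(2)] v(2) j by (intro I_diff) auto
    then have "comm (x j) u \<oplus> comm (x j) (v \<ominus> u) \<in> I"
      using I_add u(2)[OF j] by (simp add: comm_def)
    then show "comm (x j) v \<in> I"
      using comm_add[of "x j" u "v \<ominus> u"] diff_add_cancel[of v u] a_comm[of u "v \<ominus> u"] j u(1) vc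
      by simp
  qed
  then obtain l where l: "comm (x j) v \<otimes> mon (l j) = \<zero>" if "j \<in> J" for j
    by metis
  \<comment> \<open>Adding all the exponents makes \<open>mon m\<close> a multiple of each
    \<open>mon (l j)\<close>.\<close>
  define m where "m i = (\<Sum>j \<in> J. l j i)" for i
  have m: "comm (x j) v \<otimes> mon m = \<zero>" if j: "j \<in> J" for j
  proof -
    have "m i = l j i + (m i - l j i)" for i
      using member_le_sum[of j J "\<lambda>j. l j i"] j by (simp add: m_def)
    then have "mon m = mon (l j) \<otimes> mon (\<lambda>i. m i - l j i)"
      unfolding mon_mult by (intro mon_cong) simp
    then show ?thesis
      using l[OF j] j vc by (simp flip: m_assoc)
  qed
  have "v \<otimes> mon m \<in> hom_cent (\<lambda>j. k j + m j)"
  proof -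
    have "x j \<otimes> (v \<otimes> mon m) = (v \<otimes> mon m) \<otimes> x j" if j: "j \<in> J" for j
    proof -
      have "comm (x j) (v \<otimes> mon m) = comm (x j) v \<otimes> mon m \<oplus> v \<otimes> comm (x j) (mon m)"
        using j vc by (simp add: comm_mult)
      also have "comm (x j) (mon m) = \<zero>"
        using j by (simp add: comm_eq_zero_iff x_commute_mon)
      finally show ?thesis
        using m[OF j] j vc by (simp add: comm_eq_zero_iff)
    qed
    then show ?thesis
      using W_mult[OF v(1) mon_W[of m]] by (simp add: hom_cent_def expo_add)
  qed
  moreover have "v \<otimes> mon m \<ominus> u \<in> I"
    using I_trans[OF S_diff_I v(2)] vc u(1) by simp
  ultimately show ?thesis by blast
qed

text \<open>Over the common denominator \<open>?s\<close>, equal fractions have numerators that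
  agree after multiplication by a monomial, which acts as 1 modulo \<open>I\<close>. Conversely
  \<open>?u\<close> and \<open>?v\<close> have the same weight, so their difference is a weight
  vector in \<open>I\<close>, hence torsion, and the localization does not see it.\<close>

lemma frac_homogeneous_eq_iff:
  assumes u: "u \<in> hom_cent k" and v: "v \<in> hom_cent l"
  shows "frac (mon k) u = frac (mon l) v \<longleftrightarrow> u \<ominus> v \<in> I"
proof -
  note c = u[THEN hom_cent_closed] v[THEN hom_cent_closed]
  let ?u = "u \<otimes> mon l" and ?v = "v \<otimes> mon k"
  have uv: "?u \<in> hom_cent (\<lambda>j. k j + l j)" "?v \<in> hom_cent (\<lambda>j. k j + l j)"
    using hom_cent_mult[OF u mon_hom_cent[of l]]
      hom_cent_mult[OF v mon_hom_cent[of k]]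
    by (simp_all only: add.commute)
  let ?s = "mon (\<lambda>j. k j + l j)"
  have s: "?s = mon l \<otimes> mon k" "?s = mon k \<otimes> mon l"
    by (simp_all add: mon_mult add.commute)
  have fu: "frac (mon k) u = frac ?s ?u"
    using frac_expand[of "mon k" "mon l" u] c(1) hom_cent_commute_mon[OF u]
    by (simp add: s(1))
  have fv: "frac (mon l) v = frac ?s ?v"
    using frac_expand[of "mon l" "mon k" v] c(2) hom_cent_commute_mon[OF v]
    by (simp add: s(2))
  have I_uv: "?u \<ominus> u \<in> I" "?v \<ominus> v \<in> I"
    using S_diff_I c by auto
  show ?thesis
  proof
    assume "frac (mon k) u = frac (mon l) v"
    then have "frac \<one> ?s \<otimes>\<^bsub>L\<^esub> frac ?s ?u = frac \<one> ?s \<otimes>\<^bsub>L\<^esub> frac ?s ?v"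
      by (simp add: fu fv)
    then have "frac \<one> ?u = frac \<one> ?v"
      using c by (simp add: frac_left_mult)
    then obtain t where t: "t \<in> S" "t \<otimes> ?u = t \<otimes> ?v"
      using c frac_one_eq_iff[of ?u ?v] by auto
    then obtain p where p: "t = mon p"
      unfolding S_def by blast
    have e: "?u \<otimes> mon p = ?v \<otimes> mon p"
      using t p hom_cent_commute_mon[OF uv(1)] hom_cent_commute_mon[OF uv(2)]
      by simp
    have "?u \<otimes> mon p \<ominus> ?u \<in> I" "?v \<otimes> mon p \<ominus> ?v \<in> I"
      using S_diff_I c by auto
    then have "?u \<otimes> mon p \<ominus> u \<in> I" "?v \<otimes> mon p \<ominus> v \<in> I"
      using I_trans[OF _ I_uv(1), of "?u \<otimes> mon p"] I_trans[OF _ I_uv(2), of "?v \<otimes> mon p"] c by auto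
    then have "u \<ominus> ?u \<otimes> mon p \<in> I" "?u \<otimes> mon p \<ominus> v \<in> I"
      using I_sym[of "?u \<otimes> mon p" u] c by (simp_all add: e)
    then show "u \<ominus> v \<in> I"
      using I_trans[of u "?u \<otimes> mon p" v] c by simp
  next
    assume "u \<ominus> v \<in> I"
    then have "?u \<ominus> v \<in> I"
      using I_trans[OF I_uv(1)] c by simp
    then have "?u \<ominus> ?v \<in> I"
      using I_trans[OF _ I_sym[OF I_uv(2)]] c by simp
    moreover have "?u \<ominus> ?v \<in> W (expo (\<lambda>j. k j + l j))"
      using uv by (intro W_diff) (auto simp: hom_cent_def)
    ultimately obtain p where "(?u \<ominus> ?v) \<otimes> mon p = \<zero>"
      using weight_I_torsion expo_lattice by blast
    then have "?u \<otimes> mon p \<ominus> ?v \<otimes> mon p = \<zero>"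
      using c by (simp add: a_minus_def l_distr l_minus)
    then have "mon p \<otimes> ?u = mon p \<otimes> ?v"
      using c hom_cent_commute_mon[OF uv(1)] hom_cent_commute_mon[OF uv(2)]
      by (simp add: diff_eq_zero_iff)
    moreover have "frac (mon p \<otimes> ?s) (mon p \<otimes> ?u) = frac ?s ?u" "frac (mon p \<otimes> ?s) (mon p \<otimes> ?v) = frac ?s ?v"
      using c by (simp_all add: frac_expand)
    ultimately show "frac (mon k) u = frac (mon l) v"
      by (simp add: fu fv)
  qed
qed

lemma x_frac:
  assumes "j \<in> J" "u \<in> carrier A"
  shows "frac \<one> (x j) \<otimes>\<^bsub>L\<^esub> frac (mon k) u = frac (mon k) (x j \<otimes> u)"
proof -
  have "frac \<one> (x j) = frac (mon k) (x j \<otimes> mon k)"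
    using frac_expand[of \<one> "mon k" "x j"] assms x_commute_mon by simp
  then show ?thesis
    using mult_frac[of "mon k" "mon k" "x j" u] assms by simp
qed

text \<open>Moving \<open>h i\<close> past the denominator shifts it by the weight of the monomial:
  \<open>h\<^sub>i s\<^sup>-\<^sup>1 = s\<^sup>-\<^sup>1 (h\<^sub>i - wt)\<close>.\<close>

lemma h_frac:
  assumes "i \<in> J" "u \<in> carrier A"
  shows "frac \<one> (h i) \<otimes>\<^bsub>L\<^esub> frac (mon k) u = frac (mon k) (h i \<otimes> u \<ominus> wt i (expo k) \<odot> u)"
proof -
  let ?h = "h i \<ominus> wt i (expo k) \<odot> \<one>"
  have "h i \<otimes> mon k \<ominus> mon k \<otimes> h i = wt i (expo k) \<odot> mon k"
    using W_comm[OF mon_W assms(1)] by (simp add: comm_def)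
  then have "h i \<otimes> mon k = wt i (expo k) \<odot> mon k \<oplus> mon k \<otimes> h i"
    using assms(1) diff_add_cancel[of "h i \<otimes> mon k" "mon k \<otimes> h i"] by simp
  then have "?h \<otimes> mon k = mon k \<otimes> h i"
    using assms(1) by (simp add: a_minus_def l_distr l_minus scale_mult_left a_ac r_neg r_neg1 r_neg2)
  then have "frac \<one> (h i) = frac (mon k) (?h \<otimes> mon k)"
    using frac_expand[of \<one> "mon k" "h i"] assms by simp
  then have "frac \<one> (h i) \<otimes>\<^bsub>L\<^esub> frac (mon k) u = frac (mon k) (?h \<otimes> u)"
    using mult_frac[of "mon k" "mon k" ?h u] assms by simp
  also have "?h \<otimes> u = h i \<otimes> u \<ominus> wt i (expo k) \<odot> u"
    using assms by (simp add: a_minus_def l_distr l_minus scale_mult_left)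
  finally show ?thesis .
qed

text \<open>Elements of \<open>S\<close> commute, so the product of the finitely many factors serves
  for all the equations at once.\<close>

lemma common_left_factor:
  assumes "finite K" "\<And>k. k \<in> K \<Longrightarrow> a k \<in> carrier A" "\<And>k. k \<in> K \<Longrightarrow> b k \<in> carrier A"
    and "\<And>k. k \<in> K \<Longrightarrow> \<exists>t \<in> S. t \<otimes> a k = t \<otimes> b k"
  shows "\<exists>t \<in> S. \<forall>k \<in> K. t \<otimes> a k = t \<otimes> b k"
  using assms
proof (induction K)
  case (insert c K)
  obtain t where t: "t \<in> S" "\<And>k. k \<in> K \<Longrightarrow> t \<otimes> a k = t \<otimes> b k"
    using insert by auto
  obtain r where r: "r \<in> S" "r \<otimes> a c = r \<otimes> b c"
    using insert.prems(3)[of c] by auto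
  have rt: "r \<otimes> t = t \<otimes> r"
    using t(1) r(1) mon_commute by (auto simp: S_def)
  have "(r \<otimes> t) \<otimes> a k = (r \<otimes> t) \<otimes> b k" if k: "k \<in> insert c K" for k
  proof (cases "k = c")
    case True
    have "(t \<otimes> r) \<otimes> a c = (t \<otimes> r) \<otimes> b c"
      using r t(1) insert.prems(1,2)[of c] by (simp add: m_assoc)
    then show ?thesis using rt True by simp
  next
    case False
    then show ?thesis
      using k t r(1) insert.prems(1,2)[of k] by (simp add: m_assoc)
  qed
  then show ?case
    using r(1) t(1) by blast
qed (use one_S in blast)

definition torus_generators :: "('a \<times> 'a) set set" where
  "torus_generators = (\<lambda>i. frac \<one> (h i)) ` J \<union> (\<lambda>j. frac \<one> (x j)) ` J \<union> (\<lambda>j. inv\<^bsub>L\<^esub> (frac \<one> (x j))) ` J"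

lemma torus_generators_closed: "torus_generators \<subseteq> carrier L"
  unfolding torus_generators_def using frac_unit[OF x_S] by auto

definition C :: "('a \<times> 'a) set set" where
  "C = {frac (mon k) u | k u. u \<in> hom_cent k}"

text \<open>Commuting with the \<open>h i\<close> means that numerator and denominator have the same
  weight, commuting with the \<open>x j\<close> that the numerator does. For an arbitrary fraction
  both hold only up to left torsion, and expanding it by a single monomial \<open>mon l\<close>
  makes them exact.\<close>

lemma carrier_centralizer_torus:
  "carrier (centralizer L (generated_subalgebra L torus_generators)) = C"
proof -
  have "P \<in> C \<longleftrightarrow> P \<in> carrier L \<and> (\<forall>b \<in> torus_generators. P \<otimes>\<^bsub>L\<^esub> b = b \<otimes>\<^bsub>L\<^esub> P)" for P
  proof
    assume "P \<in> C"
    then obtain k u where P: "P = frac (mon k) u" and u: "u \<in> hom_cent k"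
      by (auto simp: C_def)
    note uc = hom_cent_closed[OF u]
    have Pc: "P \<in> carrier L"
      using P uc by simp
    have x: "P \<otimes>\<^bsub>L\<^esub> frac \<one> (x j) = frac \<one> (x j) \<otimes>\<^bsub>L\<^esub> P" if "j \<in> J" for j
      unfolding P using that u uc
      by (simp add: x_frac frac_right_mult hom_cent_def)
    have "P \<otimes>\<^bsub>L\<^esub> frac \<one> (h i) = frac \<one> (h i) \<otimes>\<^bsub>L\<^esub> P" if i: "i \<in> J" for i
    proof -
      have "h i \<otimes> u \<ominus> wt i (expo k) \<odot> u = u \<otimes> h i"
        using W_comm[of u "expo k" i] u i uc mult_comm[of "h i" u]
        by (simp add: hom_cent_def a_minus_def a_ac r_neg r_neg1 r_neg2)
      then show ?thesis
        unfolding P using i uc by (simp add: h_frac frac_right_mult)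
    qed
    moreover have "P \<otimes>\<^bsub>L\<^esub> inv\<^bsub>L\<^esub> (frac \<one> (x j)) = inv\<^bsub>L\<^esub> (frac \<one> (x j)) \<otimes>\<^bsub>L\<^esub> P" if "j \<in> J" for j
      using L.commute_inv[OF Pc frac_unit(1)[OF x_S[OF that]] x[OF that]] .
    ultimately show "P \<in> carrier L \<and> (\<forall>b \<in> torus_generators. P \<otimes>\<^bsub>L\<^esub> b = b \<otimes>\<^bsub>L\<^esub> P)"
      using Pc x by (auto simp: torus_generators_def)
  next
    assume P: "P \<in> carrier L \<and> (\<forall>b \<in> torus_generators. P \<otimes>\<^bsub>L\<^esub> b = b \<otimes>\<^bsub>L\<^esub> P)"
    then obtain s u where s: "s \<in> S" and u: "P = frac s u" "u \<in> carrier A"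
      by (auto simp: carrier_L)
    from s obtain k where "s = mon k"
      by (auto simp: S_def)
    with u have u: "P = frac (mon k) u" "u \<in> carrier A"
      by simp_all
    have numerators: "\<exists>t \<in> S. t \<otimes> a = t \<otimes> b"
      if "a \<in> carrier A" "b \<in> carrier A" "frac (mon k) a = frac (mon k) b" for a b
    proof -
      have "frac \<one> (mon k) \<otimes>\<^bsub>L\<^esub> frac (mon k) a = frac \<one> (mon k) \<otimes>\<^bsub>L\<^esub> frac (mon k) b"
        using that(3) by simp
      then show ?thesis
        using that(1,2) by (simp add: frac_left_mult frac_one_eq_iff)
    qed
    have "\<exists>t \<in> S. \<forall>j \<in> J. t \<otimes> (x j \<otimes> u) = t \<otimes> (u \<otimes> x j)"
    proof (rule common_left_factor)
      fix j assume j: "j \<in> J"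
      have "P \<otimes>\<^bsub>L\<^esub> frac \<one> (x j) = frac \<one> (x j) \<otimes>\<^bsub>L\<^esub> P"
        using P j by (auto simp: torus_generators_def)
      then show "\<exists>t \<in> S. t \<otimes> (x j \<otimes> u) = t \<otimes> (u \<otimes> x j)"
        using j u by (intro numerators) (simp_all add: x_frac frac_right_mult)
    qed (use u in auto)
    then obtain t1 where t1: "t1 \<in> S" "\<And>j. j \<in> J \<Longrightarrow> t1 \<otimes> (x j \<otimes> u) = t1 \<otimes> (u \<otimes> x j)"
      by blast
    have "\<exists>t \<in> S. \<forall>i \<in> J. t \<otimes> (h i \<otimes> u \<ominus> wt i (expo k) \<odot> u) = t \<otimes> (u \<otimes> h i)"
    proof (rule common_left_factor)
      fix i assume i: "i \<in> J"
      have "P \<otimes>\<^bsub>L\<^esub> frac \<one> (h i) = frac \<one> (h i) \<otimes>\<^bsub>L\<^esub> P"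
        using P i by (auto simp: torus_generators_def)
      then show "\<exists>t \<in> S. t \<otimes> (h i \<otimes> u \<ominus> wt i (expo k) \<odot> u) = t \<otimes> (u \<otimes> h i)"
        using i u by (intro numerators) (simp_all add: h_frac frac_right_mult)
    qed (use u in auto)
    then obtain t2 where t2: "t2 \<in> S"
        "\<And>i. i \<in> J \<Longrightarrow> t2 \<otimes> (h i \<otimes> u \<ominus> wt i (expo k) \<odot> u) = t2 \<otimes> (u \<otimes> h i)"
      by blast
    obtain l1 l2 where l: "t1 = mon l1" "t2 = mon l2"
      using t1(1) t2(1) by (auto simp: S_def)
    define l where "l = (\<lambda>j. l1 j + l2 j)"
    have m: "mon l = mon l1 \<otimes> mon l2" "mon l = mon l2 \<otimes> mon l1"
      by (simp_all add: mon_mult l_def add.commute)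
    let ?v = "mon l \<otimes> u"
    have "x j \<otimes> ?v = ?v \<otimes> x j" if j: "j \<in> J" for j
    proof -
      have "x j \<otimes> ?v = (x j \<otimes> mon l) \<otimes> u"
        using j u by (simp add: m_assoc)
      also have "\<dots> = mon l2 \<otimes> (mon l1 \<otimes> (x j \<otimes> u))"
        using j u x_commute_mon[OF j, of l] by (simp add: m(2) m_assoc)
      also have "\<dots> = ?v \<otimes> x j"
        using j u t1(2)[OF j] by (simp add: m(2) m_assoc l)
      finally show ?thesis .
    qed
    moreover have "?v \<in> W (expo (\<lambda>j. l j + k j))"
    proof -
      have "comm (h i) ?v = wt i (expo (\<lambda>j. l j + k j)) \<odot> ?v" if i: "i \<in> J" for i
      proof -
        have "mon l \<otimes> (h i \<otimes> u \<ominus> wt i (expo k) \<odot> u) = mon l \<otimes> (u \<otimes> h i)"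
          using i u t2(2)[OF i] by (simp add: m(1) m_assoc l)
        then have "mon l \<otimes> (h i \<otimes> u) \<ominus> wt i (expo k) \<odot> ?v = mon l \<otimes> (u \<otimes> h i)"
          using i u by (simp add: a_minus_def r_distr r_minus scale_mult_right)
        then have "mon l \<otimes> (h i \<otimes> u) = mon l \<otimes> (u \<otimes> h i) \<oplus> wt i (expo k) \<odot> ?v"
          using i u diff_add_cancel[of "mon l \<otimes> (h i \<otimes> u)" "wt i (expo k) \<odot> ?v"] by simp
        then have "mon l \<otimes> comm (h i) u = wt i (expo k) \<odot> ?v"
          using i u by (simp add: comm_def a_minus_def r_distr r_minus a_ac r_neg r_neg1 r_neg2)
        moreover have "comm (h i) (mon l) = wt i (expo l) \<odot> mon l"
          by (rule W_comm[OF mon_W i])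
        ultimately show ?thesis
          using i u by (simp add: comm_mult scale_mult_left scale_add_left wt_add flip: expo_add)
      qed
      then show ?thesis
        using u by (simp add: W_def)
    qed
    ultimately have "?v \<in> hom_cent (\<lambda>j. l j + k j)"
      by (simp add: hom_cent_def)
    moreover have "P = frac (mon (\<lambda>j. l j + k j)) ?v"
      using frac_expand[of "mon k" "mon l" u] u by (simp add: mon_mult)
    ultimately show "P \<in> C"
      by (auto simp: C_def)
  qed
  then show ?thesis
    unfolding L.centralizer_carrier[OF torus_generators_closed] by blast
qed

text \<open>Stated for any \<open>V\<close> presented through \<open>\<Phi>\<close> as the Whittaker
  vectors modulo \<open>I\<close>, which separates the localization from the study of module
  endomorphisms. The map is built out of the centralizer, the side already known to be an
  algebra.\<close>

theorem whittaker_isomorphic_centralizer: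
  fixes V (structure)
  assumes closed: "\<And>u. u \<in> whittaker \<Longrightarrow> \<Phi> u \<in> carrier V"
    and surj: "\<And>f. f \<in> carrier V \<Longrightarrow> \<exists>u \<in> whittaker. f = \<Phi> u"
    and ker: "\<And>u v. u \<in> whittaker \<Longrightarrow> v \<in> whittaker \<Longrightarrow> \<Phi> u = \<Phi> v \<longleftrightarrow> u \<ominus>\<^bsub>A\<^esub> v \<in> I"
    and add: "\<And>u v. u \<in> whittaker \<Longrightarrow> v \<in> whittaker \<Longrightarrow> \<Phi> (u \<oplus>\<^bsub>A\<^esub> v) = \<Phi> u \<oplus>\<^bsub>V\<^esub> \<Phi> v"
    and mult: "\<And>u v. u \<in> whittaker \<Longrightarrow> v \<in> whittaker \<Longrightarrow> \<Phi> (u \<otimes>\<^bsub>A\<^esub> v) = \<Phi> u \<otimes>\<^bsub>V\<^esub> \<Phi> v"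
    and smult: "\<And>c u. u \<in> whittaker \<Longrightarrow> \<Phi> (c \<odot>\<^bsub>A\<^esub> u) = c \<odot>\<^bsub>V\<^esub> \<Phi> u"
    and one: "\<Phi> \<one>\<^bsub>A\<^esub> = \<one>\<^bsub>V\<^esub>" and zero: "\<Phi> \<zero>\<^bsub>A\<^esub> = \<zero>\<^bsub>V\<^esub>"
  shows "calgebra_isomorphic V (centralizer L (generated_subalgebra L torus_generators))"
    (is "calgebra_isomorphic V ?C")
proof -
  note car = carrier_centralizer_torus
  \<comment> \<open>A fraction may be written with many denominators. The possible numerators are
    congruent modulo \<open>I\<close>, so \<open>\<Phi>\<close> takes the same value on
    them.\<close>
  define \<Psi> where "\<Psi> P = \<Phi> (SOME u. \<exists>k. u \<in> hom_cent k \<and> P = frac (mon k) u)" for P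
  have \<Psi>: "\<Psi> (frac (mon k) u) = \<Phi> u" if u: "u \<in> hom_cent k" for k u
  proof -
    let ?u = "SOME v. \<exists>l. v \<in> hom_cent l \<and> frac (mon k) u = frac (mon l) v"
    have "\<exists>l. ?u \<in> hom_cent l \<and> frac (mon k) u = frac (mon l) ?u"
      by (rule someI[of _ u]) (use u in blast)
    then obtain l where l: "?u \<in> hom_cent l" "frac (mon k) u = frac (mon l) ?u"
      by blast
    then have "u \<ominus>\<^bsub>A\<^esub> ?u \<in> I"
      using frac_homogeneous_eq_iff[OF u l(1)] by blast
    then have "\<Phi> u = \<Phi> ?u"
      using ker[OF u[THEN hom_cent_whittaker] l(1)[THEN hom_cent_whittaker]]
      by blast
    then show ?thesis
      by (simp only: \<Psi>_def)
  qed
  have C_cases: "\<exists>k u. u \<in> hom_cent k \<and> P = frac (mon k) u" if "P \<in> carrier ?C" for P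
    using that by (auto simp: car C_def)
  have ops: "mult ?C = mult L" "add ?C = add L" "smult ?C = smult L" "\<one>\<^bsub>?C\<^esub> = \<one>\<^bsub>L\<^esub>" "\<zero>\<^bsub>?C\<^esub> = \<zero>\<^bsub>L\<^esub>"
    by (simp_all add: centralizer_def)
  have one_hc: "\<one>\<^bsub>A\<^esub> \<in> hom_cent (\<lambda>_. 0)" "\<zero>\<^bsub>A\<^esub> \<in> hom_cent (\<lambda>_. 0)"
    using mon_hom_cent[of "\<lambda>_. 0"] hom_cent_scale[of "\<one>\<^bsub>A\<^esub>" "\<lambda>_. 0" 0]
    by simp_all
  have "\<Psi> \<in> calgebra_hom ?C V"
  proof (rule calgebra_homI)
    fix P assume "P \<in> carrier ?C"
    then obtain k u where u: "u \<in> hom_cent k" "P = frac (mon k) u"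
      using C_cases by blast
    note uc = hom_cent_closed[OF u(1)] and uw = hom_cent_whittaker[OF u(1)]
    show "\<Psi> P \<in> carrier V"
      using u uw closed \<Psi> by simp
    show "\<Psi> (c \<odot>\<^bsub>?C\<^esub> P) = c \<odot>\<^bsub>V\<^esub> \<Psi> P" for c
      using u uc uw hom_cent_scale[OF u(1)] by (simp add: ops smult_frac \<Psi> smult)
    fix Q assume "Q \<in> carrier ?C"
    then obtain l v where v: "v \<in> hom_cent l" "Q = frac (mon l) v"
      using C_cases by blast
    note vc = hom_cent_closed[OF v(1)] and vw = hom_cent_whittaker[OF v(1)]
    let ?m = "\<lambda>j. k j + l j"
    let ?s = "mon ?m" and ?u = "u \<otimes>\<^bsub>A\<^esub> mon l" and ?v = "v \<otimes>\<^bsub>A\<^esub> mon k"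
    have s: "?s = mon l \<otimes>\<^bsub>A\<^esub> mon k" "?s = mon k \<otimes>\<^bsub>A\<^esub> mon l"
      by (simp_all add: mon_mult add.commute)
    have P: "P = frac ?s ?u"
      using frac_expand[of "mon k" "mon l" u] u uc hom_cent_commute_mon[OF u(1)]
      by (simp add: s(1))
    have Q: "Q = frac ?s ?v"
      using frac_expand[of "mon l" "mon k" v] v vc hom_cent_commute_mon[OF v(1)]
      by (simp add: s(2))
    have hc: "?u \<in> hom_cent ?m" "?v \<in> hom_cent ?m"
      using hom_cent_mult[OF u(1) mon_hom_cent[of l]]
        hom_cent_mult[OF v(1) mon_hom_cent[of k]]
      by (simp_all only: add.commute)
    have "\<Psi> (P \<oplus>\<^bsub>?C\<^esub> Q) = \<Phi> (?u \<oplus>\<^bsub>A\<^esub> ?v)"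
      using hc uc vc hom_cent_add[OF hc] by (simp add: ops P Q add_frac \<Psi>)
    then show "\<Psi> (P \<oplus>\<^bsub>?C\<^esub> Q) = \<Psi> P \<oplus>\<^bsub>V\<^esub> \<Psi> Q"
      using hc add hom_cent_whittaker by (simp add: P Q \<Psi>)
    \<comment> \<open>In this expansion of \<open>P\<close> the numerator ends in
      \<open>mon l\<close>, the denominator of \<open>Q\<close>, so the product formula applies as
      it stands.\<close>
    have "P \<otimes>\<^bsub>L\<^esub> Q = frac ?s (u \<otimes>\<^bsub>A\<^esub> v)"
      using mult_frac[of ?s "mon l" u v] uc vc v(2) by (simp add: P)
    then show "\<Psi> (P \<otimes>\<^bsub>?C\<^esub> Q) = \<Psi> P \<otimes>\<^bsub>V\<^esub> \<Psi> Q"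
      using \<Psi>[OF hom_cent_mult[OF u(1) v(1)]] mult[OF uw vw] \<Psi>[OF u(1)] \<Psi>[OF v(1)]
      by (simp add: ops u(2) v(2))
  next
    show "\<Psi> \<one>\<^bsub>?C\<^esub> = \<one>\<^bsub>V\<^esub>"
      using \<Psi>[OF one_hc(1)] one by (simp add: ops one_L)
  qed
  moreover have "bij_betw \<Psi> (carrier ?C) (carrier V)"
  proof (rule bij_betw_imageI)
    show "inj_on \<Psi> (carrier ?C)"
    proof (rule inj_onI)
      fix P Q assume PQ: "P \<in> carrier ?C" "Q \<in> carrier ?C" "\<Psi> P = \<Psi> Q"
      obtain k u where u: "u \<in> hom_cent k" "P = frac (mon k) u"
        using C_cases PQ(1) by blast
      obtain l v where v: "v \<in> hom_cent l" "Q = frac (mon l) v"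
        using C_cases PQ(2) by blast
      show "P = Q"
        using PQ(3) \<Psi>[OF u(1)] \<Psi>[OF v(1)] ker hom_cent_whittaker u v
          frac_homogeneous_eq_iff[OF u(1) v(1)] by simp
    qed
    show "\<Psi> ` carrier ?C = carrier V"
    proof
      show "\<Psi> ` carrier ?C \<subseteq> carrier V"
        using C_cases \<Psi> closed hom_cent_whittaker by fastforce
      show "carrier V \<subseteq> \<Psi> ` carrier ?C"
      proof
        fix f assume "f \<in> carrier V"
        then obtain u where u: "u \<in> whittaker" "f = \<Phi> u"
          using surj by blast
        obtain k v where v: "v \<in> hom_cent k" "v \<ominus>\<^bsub>A\<^esub> u \<in> I"
          using whittaker_representative[OF u(1)] by blast
        have "f = \<Psi> (frac (mon k) v)"
          using ker[OF hom_cent_whittaker[OF v(1)] u(1)] v(2) u(2) \<Psi>[OF v(1)] by simp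
        then show "f \<in> \<Psi> ` carrier ?C"
          using v(1) by (auto simp: car C_def)
      qed
    qed
  qed
  moreover have "\<Psi> \<zero>\<^bsub>?C\<^esub> = \<zero>\<^bsub>V\<^esub>"
    using \<Psi>[OF one_hc(2)] zero by (simp add: ops zero_L)
  ultimately show ?thesis
    using calgebra_isomorphicI[OF L.calgebra_centralizer[OF torus_generators_closed]] by blast
qed

end

section \<open>The symplectic Lie algebra\<close>

text \<open>Instances of library facts without free dimensions in their premises, so that the simplifier
  can discharge them.\<close>

context
  fixes N :: nat
begin

abbreviation "sq \<equiv> carrier_mat N N :: complex mat set"

lemma sq_minus_closed: "A \<in> sq \<Longrightarrow> B \<in> sq \<Longrightarrow> A - B \<in> sq"
  by auto

lemma sq_transpose_closed: "A \<in> sq \<Longrightarrow> A\<^sup>T \<in> sq"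
  by auto

lemmas sq_simps = assoc_mult_mat[of _ N N _ N _ N] mult_minus_distrib_mat[of _ N N _ N]
  minus_mult_distrib_mat[of _ N N _ _ N] mult_add_distrib_mat[of _ N N _ N]
  add_mult_distrib_mat[of _ N N _ _ N] left_mult_zero_mat[of _ N N N] right_mult_zero_mat[of _ N N N]
  left_mult_one_mat[of _ N N] right_mult_one_mat[of _ N N]
  mult_carrier_mat[of _ N N _ N] add_carrier_mat[of _ N N]
  sq_minus_closed smult_carrier_mat[of _ N N] zero_carrier_mat[of N N] one_carrier_mat[of N]
  sq_transpose_closed

text \<open>If \<open>X\<close> squares to zero, the square of ad \<open>X\<close> sends
  \<open>Y\<close> to \<open>-2 X Y X\<close>, which \<open>X\<close> annihilates on both
  sides.\<close>

lemma nilpotent_ad_cube: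
  assumes A: "X \<in> sq" "Y \<in> sq" and X: "X * X = 0\<^sub>m N N"
  defines "D \<equiv> \<lambda>Y. X * Y - Y * X"
  shows "D (D (D Y)) = 0\<^sub>m N N"
proof -
  let ?Z = "X * (Y * X)"
  have z: "?Z \<in> sq" "X * ?Z = 0\<^sub>m N N" "?Z * X = 0\<^sub>m N N"
  proof -
    show "?Z \<in> sq" using A by (simp add: sq_simps)
    have "X * ?Z = (X * X) * (Y * X)" using A by (simp add: sq_simps)
    then show "X * ?Z = 0\<^sub>m N N" using A X by (simp add: sq_simps)
    have "?Z * X = (X * Y) * (X * X)" using A by (simp add: sq_simps)
    then show "?Z * X = 0\<^sub>m N N" using A X by (simp add: sq_simps)
  qed
  have "X * (X * Y) = (X * X) * Y" "Y * (X * X) = Y * X * X"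
    using A by (simp_all add: sq_simps)
  then have 1: "X * (X * Y) = 0\<^sub>m N N" "Y * (X * X) = 0\<^sub>m N N"
    using A X by (simp_all add: sq_simps)
  have D2: "D (D Y) = (0\<^sub>m N N - ?Z) - (?Z - 0\<^sub>m N N)"
    unfolding D_def using A 1 by (simp add: sq_simps)
  have "X * D (D Y) = 0\<^sub>m N N" "D (D Y) * X = 0\<^sub>m N N"
    unfolding D2 using A(1) z
    by (simp_all add: mult_minus_distrib_mat[of X N N _ N] minus_mult_distrib_mat[of _ N N _ X N]
      sq_minus_closed right_mult_zero_mat[of X N N N] left_mult_zero_mat[of X N N N])
  moreover have "D (D (D Y)) = X * D (D Y) - D (D Y) * X"
    by (simp add: D_def)
  ultimately show ?thesis
    by simp
qed

end

locale symplectic =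
  fixes n :: nat
  assumes n_ge_2: "n \<ge> 2"
begin

abbreviation "N \<equiv> 2 * n"
abbreviation "sqm \<equiv> carrier_mat N N :: complex mat set"

section \<open>Entrywise description of sp and closure under brackets\<close>

lemma symplectic_form_closed: "symplectic_form n \<in> sqm"
proof -
  have "symplectic_form n \<in> carrier_mat (n + n) (n + n)"
    unfolding symplectic_form_def by (rule four_block_carrier_mat) auto
  then show ?thesis by (simp add: mult_2)
qed

lemma symplectic_form_index:
  "r < N \<Longrightarrow> c < N \<Longrightarrow> symplectic_form n $$ (r, c)
    = (if r < n then if c = r + n then 1 else 0 else if c + n = r then - 1 else 0)"
  by (auto simp: symplectic_form_def index_mat_four_block one_mat_def)

lemma symplectic_form_mult_left:
  assumes "A \<in> sqm" "r < N" "c < N"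
  shows "(symplectic_form n * A) $$ (r, c) = (if r < n then A $$ (r + n, c) else - A $$ (r - n, c))"
proof -
  let ?p = "if r < n then r + n else r - n"
  have p: "?p < N" using assms(2) by auto
  have "(symplectic_form n * A) $$ (r, c) = (\<Sum>k<N. symplectic_form n $$ (r, k) * A $$ (k, c))"
    using assms symplectic_form_closed by (auto simp: scalar_prod_def atLeast0LessThan)
  also have "\<dots> = (\<Sum>k<N. if k = ?p then (if r < n then 1 else - 1) * A $$ (?p, c) else 0)"
    by (rule sum.cong[OF refl]) (use assms in \<open>auto simp: symplectic_form_index\<close>)
  finally show ?thesis
    using p by simp
qed

lemma symplectic_form_mult_right:
  assumes "A \<in> sqm" "r < N" "c < N"
  shows "(transpose_mat A * symplectic_form n) $$ (r, c)
    = (if c < n then - A $$ (c + n, r) else A $$ (c - n, r))"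
proof -
  let ?p = "if c < n then c + n else c - n"
  have p: "?p < N" using assms(3) by auto
  have "(transpose_mat A * symplectic_form n) $$ (r, c) = (\<Sum>k<N. A $$ (k, r) * symplectic_form n $$ (k, c))"
    using assms symplectic_form_closed by (auto simp: scalar_prod_def atLeast0LessThan)
  also have "\<dots> = (\<Sum>k<N. if k = ?p then (if c < n then - 1 else 1) * A $$ (?p, r) else 0)"
    by (rule sum.cong[OF refl]) (use assms in \<open>auto simp: symplectic_form_index\<close>)
  finally show ?thesis
    using p by simp
qed

text \<open>An entry of \<open>A\<^sup>T J + J A\<close>; multiplication by \<open>J\<close>
  exchanges the two halves of the indices up to sign.\<close>

definition sp_entry :: "complex mat \<Rightarrow> nat \<Rightarrow> nat \<Rightarrow> complex" where
  "sp_entry A r c = (if c < n then - A $$ (c + n, r) else A $$ (c - n, r))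
    + (if r < n then A $$ (r + n, c) else - A $$ (r - n, c))"

lemma sp_iff: "A \<in> sp n \<longleftrightarrow> A \<in> sqm \<and> (\<forall>r < N. \<forall>c < N. sp_entry A r c = 0)"
proof -
  have "transpose_mat A * symplectic_form n + symplectic_form n * A = 0\<^sub>m N N \<longleftrightarrow>
    (\<forall>r < N. \<forall>c < N. sp_entry A r c = 0)" if A: "A \<in> sqm"
  proof -
    let ?M = "transpose_mat A * symplectic_form n + symplectic_form n * A"
    have M: "?M \<in> sqm"
      using A symplectic_form_closed by (simp add: sq_simps)
    have "?M $$ (r, c) = sp_entry A r c" if "r < N" "c < N" for r c
    proof -
      have "?M $$ (r, c) = (transpose_mat A * symplectic_form n) $$ (r, c)
          + (symplectic_form n * A) $$ (r, c)"
        using that carrier_matD[OF A] carrier_matD[OF symplectic_form_closed] by simp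
      then show ?thesis
        using symplectic_form_mult_left[OF A that] symplectic_form_mult_right[OF A that]
        by (simp add: sp_entry_def)
    qed
    moreover have "?M = 0\<^sub>m N N \<longleftrightarrow> (\<forall>r < N. \<forall>c < N. ?M $$ (r, c) = 0)"
    proof
      assume *: "\<forall>r < N. \<forall>c < N. ?M $$ (r, c) = 0"
      show "?M = 0\<^sub>m N N"
        by (rule eq_matI) (use * M in auto)
    qed simp
    ultimately show ?thesis by simp
  qed
  then show ?thesis
    by (auto simp: sp_def)
qed

lemma sp_closed: "A \<in> sp n \<Longrightarrow> A \<in> sqm"
  by (simp add: sp_iff)

lemma sp_transpose_mult:
  assumes "A \<in> sp n" shows "transpose_mat A * symplectic_form n = - (symplectic_form n * A)"
proof -
  have "transpose_mat A * symplectic_form n + symplectic_form n * A = 0\<^sub>m N N" "A \<in> sqm"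
    using assms by (auto simp: sp_def)
  moreover have "transpose_mat A * symplectic_form n \<in> sqm" "symplectic_form n * A \<in> sqm"
    using \<open>A \<in> sqm\<close> symplectic_form_closed by (simp_all add: sq_simps)
  ultimately show ?thesis
    by (intro eq_matI) (auto simp: mat_eq_iff eq_neg_iff_add_eq_0)
qed

lemma sp_I:
  assumes "A \<in> sqm" "transpose_mat A * symplectic_form n = - (symplectic_form n * A)"
  shows "A \<in> sp n"
  using assms symplectic_form_closed mult_carrier_mat[OF symplectic_form_closed assms(1)]
  by (auto simp: sp_def)

text \<open>Carrying \<open>J\<close> past a transposed product reverses the factors and introduces
  two signs, which cancel. The reversal turns the commutator into its negative.\<close>

lemma sp_bracket:
  assumes "A \<in> sp n" "B \<in> sp n"
  shows "A * B - B * A \<in> sp n"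
proof (rule sp_I)
  let ?J = "symplectic_form n"
  note c = sp_closed[OF assms(1)] sp_closed[OF assms(2)] symplectic_form_closed
  show "A * B - B * A \<in> sqm"
    using c by (simp add: sq_simps)
  have *: "transpose_mat (A * B) * ?J = ?J * (B * A)" if "A \<in> sp n" "B \<in> sp n" for A B
  proof -
    note c = sp_closed[OF that(1)] sp_closed[OF that(2)] symplectic_form_closed
    have "transpose_mat (A * B) * ?J = transpose_mat B * (transpose_mat A * ?J)"
      using c by (simp add: transpose_mult[of _ N N _ N] sq_simps)
    also have "\<dots> = transpose_mat B * - (?J * A)"
      using sp_transpose_mult[OF that(1)] by simp
    also have "\<dots> = - (transpose_mat B * ?J * A)"
      using c by (subst uminus_mult_right_mat) (auto simp: sq_simps)
    also have "\<dots> = - (- (?J * B) * A)"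
      using sp_transpose_mult[OF that(2)] by simp
    also have "\<dots> = ?J * B * A"
      using c by (subst uminus_mult_left_mat) (auto simp: sq_simps)
    finally show ?thesis
      using c by (simp add: sq_simps)
  qed
  have "transpose_mat (A * B - B * A) * ?J = ?J * (B * A) - ?J * (A * B)"
    using c *[OF assms] *[OF assms(2,1)]
    by (simp add: transpose_minus[of _ N N] minus_mult_distrib_mat[of _ N N _ _ N] sq_simps)
  also have "\<dots> = - (?J * (A * B) - ?J * (B * A))"
    using c by (intro eq_matI) (auto simp: sq_simps)
  also have "\<dots> = - (?J * (A * B - B * A))"
    using c by (simp add: sq_simps)
  finally show "transpose_mat (A * B - B * A) * ?J = - (?J * (A * B - B * A))" .
qed

sublocale g: matrix_lie_algebra "sp n"
proof
  show "x + y \<in> sp n" if "x \<in> sp n" "y \<in> sp n" for x y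
  proof -
    have "sp_entry (x + y) r c = sp_entry x r c + sp_entry y r c" if "r < N" "c < N" for r c
      using that sp_closed[OF \<open>x \<in> sp n\<close>] sp_closed[OF \<open>y \<in> sp n\<close>]
      by (auto simp: sp_entry_def)
    then show ?thesis
      using that by (simp add: sp_iff)
  qed
  show "c \<cdot>\<^sub>m x \<in> sp n" if "x \<in> sp n" for c x
  proof -
    have "sp_entry (c \<cdot>\<^sub>m x) r s = c * sp_entry x r s" if "r < N" "s < N" for r s
      using that sp_closed[OF \<open>x \<in> sp n\<close>] by (auto simp: sp_entry_def algebra_simps)
    then show ?thesis
      using that by (simp add: sp_iff)
  qed
qed (rule sp_bracket)


section \<open>The diagonal elements and the vectors \<open>x\<^sub>j\<close>\<close>

definition h_entry :: "nat \<Rightarrow> nat \<Rightarrow> int" where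
  "h_entry i r = (if Suc r = i then 1 else if Suc r = n + i then - 1 else 0)"

lemma h_mat_closed: "h_mat n i \<in> sqm"
  by (rule carrier_matI) (simp_all add: h_mat_def mat_unit_def)

lemma h_mat_index:
  assumes "i \<in> {1..n}" "r < N" "c < N"
  shows "h_mat n i $$ (r, c) = (if r = c then of_int (h_entry i r) else 0)"
  using assms by (auto simp: h_mat_def mat_unit_def h_entry_def)

lemma h_entry_shift:
  "i \<in> {1..n} \<Longrightarrow> r < n \<Longrightarrow> h_entry i (r + n) = - h_entry i r"
  by (auto simp: h_entry_def)

lemma h_mat_sp: "i \<in> {1..n} \<Longrightarrow> h_mat n i \<in> sp n"
  unfolding sp_iff
proof (intro conjI allI impI)
  fix r c assume i: "i \<in> {1..n}" and rc: "r < N" "c < N"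
  show "sp_entry (h_mat n i) r c = 0"
    using i rc h_entry_shift[OF i, of "r - n"] h_entry_shift[OF i, of r]
    by (auto simp: sp_entry_def h_mat_index)
qed (rule h_mat_closed)

lemma h_mat_bracket_index:
  assumes i: "i \<in> {1..n}" and M: "M \<in> sqm" and rc: "r < N" "c < N"
  shows "(h_mat n i * M - M * h_mat n i) $$ (r, c) = of_int (h_entry i r - h_entry i c) * M $$ (r, c)"
proof -
  have "(h_mat n i * M) $$ (r, c) = (\<Sum>k<N. h_mat n i $$ (r, k) * M $$ (k, c))"
    using M rc h_mat_closed[of i] by (auto simp: scalar_prod_def atLeast0LessThan)
  also have "\<dots> = (\<Sum>k<N. if k = r then of_int (h_entry i r) * M $$ (r, c) else 0)"
    by (rule sum.cong[OF refl]) (use rc i in \<open>auto simp: h_mat_index\<close>)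
  finally have 1: "(h_mat n i * M) $$ (r, c) = of_int (h_entry i r) * M $$ (r, c)"
    using rc by simp
  have "(M * h_mat n i) $$ (r, c) = (\<Sum>k<N. M $$ (r, k) * h_mat n i $$ (k, c))"
    using M rc h_mat_closed[of i] by (auto simp: scalar_prod_def atLeast0LessThan)
  also have "\<dots> = (\<Sum>k<N. if k = c then of_int (h_entry i c) * M $$ (r, c) else 0)"
    by (rule sum.cong[OF refl]) (use rc i in \<open>auto simp: h_mat_index\<close>)
  finally have 2: "(M * h_mat n i) $$ (r, c) = of_int (h_entry i c) * M $$ (r, c)"
    using rc by simp
  have "(h_mat n i * M - M * h_mat n i) $$ (r, c) = (h_mat n i * M) $$ (r, c) - (M * h_mat n i) $$ (r, c)"
    using rc carrier_matD[OF M] carrier_matD[OF h_mat_closed[of i]] by simp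
  then show ?thesis
    by (simp add: 1 2 algebra_simps)
qed

definition xm :: "nat \<Rightarrow> complex mat" where
  "xm j = (if j = 1 then X_sum n 1 1 else X_diff n 1 j)"

lemma xm_closed: "xm j \<in> sqm"
  by (rule carrier_matI) (simp_all add: xm_def X_sum_def X_diff_def mat_unit_def)

lemma xm_one_index: "r < N \<Longrightarrow> c < N \<Longrightarrow> xm 1 $$ (r, c) = (if r = 0 \<and> c = n then 2 else 0)"
  by (auto simp: xm_def X_sum_def mat_unit_def)

lemma xm_index:
  assumes "j \<in> {2..n}" "r < N" "c < N"
  shows "xm j $$ (r, c)
    = (if r = 0 \<and> Suc c = j then 1 else if Suc r = n + j \<and> c = n then - 1 else 0)"
  using assms by (auto simp: xm_def X_diff_def mat_unit_def)

lemma xm_sp: assumes j: "j \<in> {1..n}" shows "xm j \<in> sp n"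
  unfolding sp_iff
proof (intro conjI allI impI)
  fix r c assume rc: "r < N" "c < N"
  show "sp_entry (xm j) r c = 0"
  proof (cases "j = 1")
    case True
    then show ?thesis
      using rc n_ge_2 by (auto simp: sp_entry_def xm_one_index[unfolded One_nat_def])
  next
    case False
    then have "j \<in> {2..n}" using j by auto
    then show ?thesis
      using rc n_ge_2 by (auto simp: sp_entry_def xm_index)
  qed
qed (rule xm_closed)

text \<open>Counting from 0, nonzero entries occur only in columns 1 to n and only in rows that are
  0 or larger than n. Columns of one matrix thus never meet rows of another, and all products of the
  \<open>xm j\<close> vanish.\<close>

lemma xm_support:
  assumes "j \<in> {1..n}" "r < N" "c < N" "xm j $$ (r, c) \<noteq> 0"
  shows "(r = 0 \<or> Suc r = n + j) \<and> 0 < c \<and> c \<le> n \<and> (r \<noteq> 0 \<longrightarrow> n < r \<and> c = n)"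
proof (cases "j = 1")
  case True
  then show ?thesis
    using assms n_ge_2 by (auto simp: xm_one_index[unfolded One_nat_def] split: if_splits)
next
  case False
  then have "j \<in> {2..n}" using assms(1) by auto
  then show ?thesis
    using assms n_ge_2 by (auto simp: xm_index split: if_splits)
qed

lemma mat_mult_eq_zero:
  assumes "P \<in> sqm" "Q \<in> sqm" "\<And>r k c. r < N \<Longrightarrow> k < N \<Longrightarrow> c < N \<Longrightarrow> P $$ (r, k) = 0 \<or> Q $$ (k, c) = 0"
  shows "P * Q = 0\<^sub>m N N"
proof (rule eq_matI)
  fix r c assume "r < dim_row (0\<^sub>m N N)" "c < dim_col (0\<^sub>m N N)"
  then have rc: "r < N" "c < N" by auto
  have "(P * Q) $$ (r, c) = (\<Sum>k<N. P $$ (r, k) * Q $$ (k, c))"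
    using assms(1,2) rc by (auto simp: scalar_prod_def atLeast0LessThan)
  also have "\<dots> = 0"
    by (rule sum.neutral) (use assms(3) rc in auto)
  finally show "(P * Q) $$ (r, c) = 0\<^sub>m N N $$ (r, c)"
    using rc by simp
qed (use assms in auto)

lemma xm_mult: assumes "i \<in> {1..n}" "j \<in> {1..n}" shows "xm i * xm j = 0\<^sub>m N N"
proof (rule mat_mult_eq_zero[OF xm_closed xm_closed])
  fix r k c assume "r < N" "k < N" "c < N"
  then show "xm i $$ (r, k) = 0 \<or> xm j $$ (k, c) = 0"
    using xm_support[OF assms(1), of r k] xm_support[OF assms(2), of k c] by force
qed

text \<open>The weight of the matrix position (r, c) in the basis
  \<open>2\<epsilon>\<^sub>1, \<epsilon>\<^sub>1 - \<epsilon>\<^sub>j\<close>. If it is the sum of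
  the \<open>a\<^sub>i \<epsilon>\<^sub>i\<close>, its coordinates are \<open>- a\<^sub>j\<close>
  for j \<ge> 2 and half the sum of all \<open>a\<^sub>i\<close> for j = 1. The half-sum is a
  difference of truth values because each standard basis vector has weight
  \<open>\<epsilon>\<^sub>i\<close> or \<open>- \<epsilon>\<^sub>i\<close>.\<close>

definition root :: "nat \<Rightarrow> nat \<Rightarrow> nat \<Rightarrow> int" where
  "root r c j = (if j = 1 then of_bool (r < n) - of_bool (c < n)
    else if j \<in> {2..n} then h_entry j c - h_entry j r else 0)"

text \<open>The weights in the basis of the roots \<open>2\<epsilon>\<^sub>1, \<epsilon>\<^sub>1 - \<epsilon>\<^sub>2, \<dots>, \<epsilon>\<^sub>1 - \<epsilon>\<^sub>n\<close> of the root lattice.\<close>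

definition sp_wt :: "nat \<Rightarrow> (nat \<Rightarrow> int) \<Rightarrow> complex" where
  "sp_wt i k = of_int (if i = 1 then 2 * k 1 + (\<Sum>j\<in>{2..n}. k j) else - k i)"

lemma sum_h_entry:
  assumes "r < N" shows "(\<Sum>j\<in>{1..n}. h_entry j r) = 2 * of_bool (r < n) - 1"
proof -
  have "(\<Sum>j\<in>{1..n}. h_entry j r)
      = (\<Sum>j\<in>{1..n}. if j = (if r < n then Suc r else Suc r - n) then (if r < n then 1 else - 1) else 0)"
    by (rule sum.cong[OF refl]) (use assms in \<open>auto simp: h_entry_def\<close>)
  then show ?thesis
    using assms by (auto simp: sum.delta')
qed

lemma sp_wt_root:
  assumes "i \<in> {1..n}" "r < N" "c < N"
  shows "sp_wt i (root r c) = of_int (h_entry i r - h_entry i c)"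
proof (cases "i = 1")
  case True
  have split: "(\<Sum>j\<in>{1..n}. f j) = f 1 + (\<Sum>j\<in>{2..n}. f j)" for f :: "nat \<Rightarrow> int"
    using n_ge_2 by (simp add: sum.atLeast_Suc_atMost numeral_2_eq_2)
  have "(\<Sum>j\<in>{2..n}. root r c j) = (\<Sum>j\<in>{2..n}. h_entry j c - h_entry j r)"
    by (rule sum.cong) (auto simp: root_def)
  also have "\<dots> = (2 * of_bool (c < n) - 1 - h_entry 1 c) - (2 * of_bool (r < n) - 1 - h_entry 1 r)"
    using sum_h_entry[OF assms(2)] sum_h_entry[OF assms(3)] split[of "\<lambda>j. h_entry j r"]
      split[of "\<lambda>j. h_entry j c"] by (simp add: sum_subtractf)
  finally show ?thesis
    using True by (simp add: sp_wt_def root_def)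
next
  case False
  then show ?thesis
    using assms by (auto simp: sp_wt_def root_def)
qed

text \<open>The symplectic condition couples an entry with the one at the transposed position with
  halves exchanged. Both positions have the same root, so cutting out the entries with given roots
  stays inside sp.\<close>

lemma root_symmetric:
  assumes "r < N" "c < N"
  shows "root (if c < n then c + n else c - n) r = root (if r < n then r + n else r - n) c"
proof
  fix j
  have h: "h_entry j (if r < n then r + n else r - n) = - h_entry j r"
    if "j \<in> {1..n}" "r < N" for r
    using that h_entry_shift[of j r] h_entry_shift[of j "r - n"] by auto
  show "root (if c < n then c + n else c - n) r j = root (if r < n then r + n else r - n) c j"
  proof (cases "j \<in> {2..n}")
    case True
    then have "j \<in> {1..n}" by auto
    then show ?thesis
      using True h[of r] h[of c] assms by (simp add: root_def)
  next
    case False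
    then show ?thesis
      using assms by (auto simp: root_def)
  qed
qed

text \<open>The sum of the root components of \<open>M\<close> with roots in \<open>F\<close>. It
  takes the place of an expansion in a basis of root vectors.\<close>

definition part :: "(nat \<Rightarrow> int) set \<Rightarrow> complex mat \<Rightarrow> complex mat" where
  "part F M = mat N N (\<lambda>(r, c). if root r c \<in> F then M $$ (r, c) else 0)"

lemma part_closed: "part F M \<in> sqm"
  by (simp add: part_def)

lemma part_index:
  "r < N \<Longrightarrow> c < N \<Longrightarrow> part F M $$ (r, c) = (if root r c \<in> F then M $$ (r, c) else 0)"
  by (simp add: part_def)

lemma part_sp:
  assumes "M \<in> sp n" shows "part F M \<in> sp n"
  unfolding sp_iff
proof (intro conjI allI impI)
  fix r c assume rc: "r < N" "c < N"
  have "sp_entry M r c = 0"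
    using assms rc by (simp add: sp_iff)
  then show "sp_entry (part F M) r c = 0"
    using rc root_symmetric[OF rc] by (auto simp: sp_entry_def part_def split: if_splits)
qed (rule part_closed)

lemma part_bracket:
  assumes "i \<in> {1..n}" "M \<in> sp n"
  shows "h_mat n i * part {k} M - part {k} M * h_mat n i = sp_wt i k \<cdot>\<^sub>m part {k} M"
proof (rule eq_matI)
  fix r c assume "r < dim_row (sp_wt i k \<cdot>\<^sub>m part {k} M)" "c < dim_col (sp_wt i k \<cdot>\<^sub>m part {k} M)"
  then have rc: "r < N" "c < N"
    using part_closed[of "{k}" M] by auto
  show "(h_mat n i * part {k} M - part {k} M * h_mat n i) $$ (r, c) = (sp_wt i k \<cdot>\<^sub>m part {k} M) $$ (r, c)"
    using h_mat_bracket_index[OF assms(1) part_closed rc] sp_wt_root[OF assms(1) rc] rc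
      carrier_matD[OF part_closed[of "{k}" M]]
    by (auto simp: part_index)
qed (use part_closed[of "{k}" M] h_mat_closed[of i] in auto)

lemma part_insert: "k \<notin> F \<Longrightarrow> part (insert k F) M = part F M + part {k} M"
  by (rule eq_matI) (auto simp: part_def)

lemma part_empty: "part {} M = 0\<^sub>m N N"
  by (rule eq_matI) (auto simp: part_def)

lemma part_all:
  "M \<in> sqm \<Longrightarrow> part ((\<lambda>(r, c). root r c) ` ({..<N} \<times> {..<N})) M = M"
  by (rule eq_matI) (auto simp: part_def image_iff)

lemma xm_bracket:
  assumes i: "i \<in> {1..n}" and j: "j \<in> {1..n}"
  shows "h_mat n i * xm j - xm j * h_mat n i = sp_wt i (\<lambda>l. if l = j then 1 else 0) \<cdot>\<^sub>m xm j"
proof (rule eq_matI)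
  fix r c assume "r < dim_row (sp_wt i (\<lambda>l. if l = j then 1 else 0) \<cdot>\<^sub>m xm j)"
    "c < dim_col (sp_wt i (\<lambda>l. if l = j then 1 else 0) \<cdot>\<^sub>m xm j)"
  then have rc: "r < N" "c < N"
    using xm_closed[of j] by auto
  have wt: "sp_wt i (\<lambda>l. if l = j then 1 else 0) = of_int (h_entry i r - h_entry i c)"
    if "xm j $$ (r, c) \<noteq> 0"
  proof (cases "j = 1")
    case True
    then show ?thesis
      using that rc i n_ge_2
      by (auto simp: xm_one_index[unfolded One_nat_def] sp_wt_def h_entry_def split: if_splits)
  next
    case False
    then have j2: "j \<in> {2..n}" using j by auto
    then show ?thesis
      using that rc i n_ge_2 False
      by (auto simp: xm_index sp_wt_def h_entry_def split: if_splits)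
  qed
  have "(sp_wt i (\<lambda>l. if l = j then 1 else 0) \<cdot>\<^sub>m xm j) $$ (r, c)
      = sp_wt i (\<lambda>l. if l = j then 1 else 0) * xm j $$ (r, c)"
    using rc xm_closed[of j] by auto
  then show "(h_mat n i * xm j - xm j * h_mat n i) $$ (r, c)
      = (sp_wt i (\<lambda>l. if l = j then 1 else 0) \<cdot>\<^sub>m xm j) $$ (r, c)"
    using h_mat_bracket_index[OF i xm_closed rc] wt by (cases "xm j $$ (r, c) = 0") auto
qed (use xm_closed[of j] h_mat_closed[of i] in auto)

section \<open>Weights and ad-nilpotency in the enveloping algebra of sp\<close>

abbreviation "U \<equiv> univ_env (sp n)"
abbreviation "\<iota> \<equiv> env_of (sp n)"

lemma env_of_zero: "\<iota> (0\<^sub>m N N) = \<zero>\<^bsub>U\<^esub>"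
proof -
  have "0\<^sub>m N N = 0 \<cdot>\<^sub>m xm 1"
    by (rule eq_matI) (use xm_closed[of 1] in auto)
  then show ?thesis
    using g.env_of_smult[OF xm_sp[of 1], of 0] xm_sp[of 1] n_ge_2 by simp
qed

lemma comm_env_of: "X \<in> sp n \<Longrightarrow> Y \<in> sp n \<Longrightarrow> g.U.comm (\<iota> X) (\<iota> Y) = \<iota> (X * Y - Y * X)"
  unfolding g.U.comm_def by (rule g.env_of_bracket)

text \<open>On the generators coming from sp the third power of ad vanishes, and the ad-nilpotent
  elements form a subalgebra.\<close>

lemma xm_adnil:
  assumes j: "j \<in> {1..n}" shows "carrier U \<subseteq> g.U.adnil (\<iota> (xm j))"
proof
  let ?D = "\<lambda>Y. xm j * Y - Y * xm j"
  fix u assume u: "u \<in> carrier U"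
  have "\<iota> Y \<in> g.U.adnil (\<iota> (xm j))" if Y: "Y \<in> sp n" for Y
  proof -
    have D: "?D Z \<in> sp n" if "Z \<in> sp n" for Z
      using sp_bracket[OF xm_sp[OF j] that] .
    have step: "\<iota> Z \<in> g.U.adnil (\<iota> (xm j))" if "Z \<in> sp n" "\<iota> (?D Z) \<in> g.U.adnil (\<iota> (xm j))" for Z
      by (rule g.U.adnil.step) (use that comm_env_of[OF xm_sp[OF j] that(1)] in auto)
    have "?D (?D (?D Y)) = 0\<^sub>m N N"
      by (rule nilpotent_ad_cube[OF xm_closed sp_closed[OF Y] xm_mult[OF j j]])
    then have "\<iota> (?D (?D (?D Y))) \<in> g.U.adnil (\<iota> (xm j))"
      using env_of_zero g.U.adnil.zero by simp
    then show ?thesis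
      using step D Y by blast
  qed
  then show "u \<in> g.U.adnil (\<iota> (xm j))"
    by (intro g.U.adnil_generated[OF _ _ g.env_generated[OF u]]) (use xm_sp[OF j] in auto)
qed

definition indices :: "nat list" where
  "indices = [1..<Suc n]"

lemma set_indices: "set indices = {1..n}" and distinct_indices: "distinct indices"
  by (auto simp: indices_def)

sublocale T: graded_torus U "indices" "\<lambda>j. \<iota> (xm j)" "\<lambda>i. \<iota> (h_mat n i)" sp_wt
proof
  note set = set_indices
  show "distinct indices" by (rule distinct_indices)
  show "\<iota> (xm j) \<in> carrier U" if "j \<in> set indices" for j
    using that xm_sp unfolding set by blast
  show "\<iota> (h_mat n i) \<in> carrier U" if "i \<in> set indices" for i
    using that h_mat_sp unfolding set by blast
  show "\<iota> (xm i) \<otimes>\<^bsub>U\<^esub> \<iota> (xm j) = \<iota> (xm j) \<otimes>\<^bsub>U\<^esub> \<iota> (xm i)"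
    if "i \<in> set indices" "j \<in> set indices" for i j
  proof -
    have ij: "i \<in> {1..n}" "j \<in> {1..n}" using that set by auto
    have "0\<^sub>m N N - 0\<^sub>m N N = (0\<^sub>m N N :: complex mat)" by auto
    then have "g.U.comm (\<iota> (xm i)) (\<iota> (xm j)) = \<zero>\<^bsub>U\<^esub>"
      unfolding comm_env_of[OF xm_sp[OF ij(1)] xm_sp[OF ij(2)]] xm_mult[OF ij] xm_mult[OF ij(2,1)]
      by (simp only: env_of_zero)
    then show ?thesis
      using g.U.comm_eq_zero_iff xm_sp ij by blast
  qed
  show "carrier U \<subseteq> g.U.adnil (\<iota> (xm j))" if "j \<in> set indices" for j
    using that xm_adnil unfolding set by blast
  show "sp_wt i (\<lambda>j. k j + l j) = sp_wt i k + sp_wt i l" for i k l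
    by (simp add: sp_wt_def sum.distrib)
  show "k = l" if "\<And>j. j \<notin> set indices \<Longrightarrow> k j = 0" "\<And>j. j \<notin> set indices \<Longrightarrow> l j = 0"
    "\<And>i. i \<in> set indices \<Longrightarrow> sp_wt i k = sp_wt i l" for k l
  proof
    fix j
    \<comment> \<open>For j \<ge> 2 the eigenvalue is minus the coordinate. Once these coordinates
      agree, the eigenvalue of \<open>h\<^sub>1\<close> determines twice the first one.\<close>
    have 2: "k j = l j" if "j \<in> {2..n}" for j
      using \<open>\<And>i. i \<in> set indices \<Longrightarrow> sp_wt i k = sp_wt i l\<close>[of j] that set by (simp add: sp_wt_def)
    then have "(\<Sum>j\<in>{2..n}. k j) = (\<Sum>j\<in>{2..n}. l j)"
      by (intro sum.cong) auto
    moreover have "sp_wt 1 k = sp_wt 1 l"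
      using n_ge_2 by (intro \<open>\<And>i. i \<in> set indices \<Longrightarrow> sp_wt i k = sp_wt i l\<close>) (simp add: set)
    ultimately have 1: "k 1 = l 1"
      by (simp add: sp_wt_def del: of_int_add of_int_mult of_int_sum)
    have "j \<in> {2..n} \<or> j = 1 \<or> j \<notin> {1..n}"
      by auto
    then show "k j = l j"
      using 1 2 \<open>\<And>j. j \<notin> set indices \<Longrightarrow> k j = 0\<close>[of j] \<open>\<And>j. j \<notin> set indices \<Longrightarrow> l j = 0\<close>[of j]
      unfolding set by auto
  qed
  show "g.U.comm (\<iota> (h_mat n i)) (\<iota> (xm j)) = sp_wt i (\<lambda>l. if l = j then 1 else 0) \<odot>\<^bsub>U\<^esub> \<iota> (xm j)"
    if "i \<in> set indices" "j \<in> set indices" for i j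
    using that comm_env_of[OF h_mat_sp xm_sp] xm_bracket g.env_of_smult[OF xm_sp] unfolding set by metis
qed

text \<open>A matrix in sp is the finite sum of its root components, and products of weight vectors
  are weight vectors.\<close>

lemma env_weight_span: "carrier U \<subseteq> T.weight_span"
proof
  fix u assume u: "u \<in> carrier U"
  note set = set_indices
  have "\<iota> M \<in> T.weight_span" if M: "M \<in> sp n" for M
  proof -
    let ?R = "(\<lambda>(r, c). root r c) ` ({..<N} \<times> {..<N})"
    have lat: "?R \<subseteq> T.lattice"
      unfolding T.lattice_def set using n_ge_2 by (auto simp: root_def)
    have "\<iota> (part F M) \<in> T.weight_span" if "finite F" "F \<subseteq> T.lattice" for F
      using that
    proof (induction F)
      case empty
      show ?case
        by (simp add: part_empty env_of_zero T.weight_span.zero)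
    next
      case (insert k F)
      have "\<iota> (part {k} M) \<in> T.W k"
        unfolding T.W_def set
        using comm_env_of[OF h_mat_sp part_sp[OF M]] part_bracket[OF _ M]
          g.env_of_smult[OF part_sp[OF M]] part_sp[OF M] by auto
      then have "\<iota> (part F M) \<oplus>\<^bsub>U\<^esub> \<iota> (part {k} M) \<in> T.weight_span"
        using insert by (intro T.weight_span.add) auto
      then show ?case
        by (simp only: part_insert[OF insert.hyps(2)] g.env_of_add[OF part_sp[OF M] part_sp[OF M]])
    qed
    from this[of ?R] show ?thesis
      using lat part_all[OF sp_closed[OF M]] by simp
  qed
  then show "u \<in> T.weight_span"
    by (intro T.weight_span_generated[OF _ g.env_generated[OF u]]) auto
qed

sublocale T: weight_algebra U "indices" "\<lambda>j. \<iota> (xm j)" "\<lambda>i. \<iota> (h_mat n i)" sp_wt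
  by unfold_locales (rule env_weight_span)

end

context symplectic
begin

lemmas sqm_simps = sq_simps[where N = N]

lemma one_smult_mat: "(1 :: complex) \<cdot>\<^sub>m M = M"
  by (intro eq_matI) auto

section \<open>An automorphism moving the character\<close>

text \<open>The exponential of \<open>- \<Sum>\<^sub>j X\<^bsub>\<epsilon>\<^sub>1 + \<epsilon>\<^sub>j\<^esub>\<close> conjugates \<open>X\<^bsub>\<epsilon>\<^sub>1 - \<epsilon>\<^sub>j\<^esub>\<close> to \<open>X\<^bsub>\<epsilon>\<^sub>1 - \<epsilon>\<^sub>j\<^esub> + X\<^bsub>2\<epsilon>\<^sub>1\<^esub>\<close>,
  on which the character takes the value 1.\<close>

definition nil_mat :: "complex mat" where
  "nil_mat = mat N N (\<lambda>(r, c). if r = 0 \<and> n < c \<or> c = n \<and> 0 < r \<and> r < n then - 1 else 0)"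

lemma nil_mat_closed: "nil_mat \<in> sqm"
  by (simp add: nil_mat_def)

lemma nil_mat_sp: "nil_mat \<in> sp n"
  unfolding sp_iff
proof (intro conjI allI impI)
  fix r c assume "r < N" "c < N"
  then show "sp_entry nil_mat r c = 0"
    using n_ge_2 by (auto simp: sp_entry_def nil_mat_def)
qed (rule nil_mat_closed)

lemma nil_mat_square: "nil_mat * nil_mat = 0\<^sub>m N N"
  by (rule mat_mult_eq_zero[OF nil_mat_closed nil_mat_closed]) (auto simp: nil_mat_def)

text \<open>The exponential of \<open>s \<cdot>\<^sub>m nil_mat\<close>, which stops after the
  linear term because \<open>nil_mat\<close> squares to zero.\<close>

definition shear :: "complex \<Rightarrow> complex mat" where
  "shear s = 1\<^sub>m N + s \<cdot>\<^sub>m nil_mat"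

lemma shear_closed: "shear s \<in> sqm"
  using nil_mat_closed by (simp add: shear_def)

lemma shear_inverse: "shear s * shear (- s) = 1\<^sub>m N"
proof -
  let ?T = "s \<cdot>\<^sub>m nil_mat" and ?T' = "(- s) \<cdot>\<^sub>m nil_mat"
  have c: "?T \<in> sqm" "?T' \<in> sqm"
    using nil_mat_closed by auto
  have "?T * ?T' = (- s) \<cdot>\<^sub>m (s \<cdot>\<^sub>m (nil_mat * nil_mat))"
    using nil_mat_closed by (simp add: mult_smult_assoc_mat[of _ N N _ N] mult_smult_distrib[of _ N N _ N])
  then have TT: "?T * ?T' = 0\<^sub>m N N"
    by (simp add: nil_mat_square)
  have "shear s * shear (- s) = (1\<^sub>m N + ?T) + (?T' + ?T * ?T')"
    unfolding shear_def using c by (simp add: sqm_simps)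
  also have "\<dots> = 1\<^sub>m N"
    unfolding TT using nil_mat_closed by (intro eq_matI) auto
  finally show ?thesis .
qed

text \<open>The linear term lies in sp, which accounts for the change of sign. Together with
  \<open>shear_inverse\<close> this says that \<open>shear s\<close> is symplectic.\<close>

lemma shear_transpose:
  "transpose_mat (shear s) * symplectic_form n = symplectic_form n * shear (- s)"
proof -
  let ?J = "symplectic_form n"
  note c = nil_mat_closed symplectic_form_closed
  have t: "transpose_mat (s \<cdot>\<^sub>m nil_mat) = s \<cdot>\<^sub>m transpose_mat nil_mat"
    using c by (intro eq_matI) auto
  have "transpose_mat (shear s) * ?J = ?J + s \<cdot>\<^sub>m (transpose_mat nil_mat * ?J)"
    unfolding shear_def using c
    by (simp add: transpose_add[of _ N N] t add_mult_distrib_mat[of _ N N _ _ N]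
      mult_smult_assoc_mat[of _ N N _ N])
  also have "\<dots> = ?J + s \<cdot>\<^sub>m - (?J * nil_mat)"
    by (simp add: sp_transpose_mult[OF nil_mat_sp])
  also have "\<dots> = ?J + (- s) \<cdot>\<^sub>m (?J * nil_mat)"
    using c by (intro eq_matI) auto
  also have "\<dots> = ?J * shear (- s)"
    unfolding shear_def using c by (simp add: mult_add_distrib_mat[of _ N N _ N] mult_smult_distrib[of _ N N _ N])
  finally show ?thesis .
qed

definition adj :: "complex \<Rightarrow> complex mat \<Rightarrow> complex mat" where
  "adj s X = shear s * (X * shear (- s))"

lemma adj_closed: "X \<in> sqm \<Longrightarrow> adj s X \<in> sqm"
  using shear_closed by (simp add: adj_def sqm_simps)

lemma adj_inverse: assumes "X \<in> sqm" shows "adj s (adj (- s) X) = X"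
proof -
  note c = assms shear_closed[of s] shear_closed[of "- s"]
  have "adj s (adj (- s) X) = (shear s * shear (- s)) * X * (shear s * shear (- s))"
    unfolding adj_def using c by (simp add: sqm_simps)
  then show ?thesis
    using c by (simp add: shear_inverse sqm_simps)
qed

lemma adj_mult:
  assumes "X \<in> sqm" "Y \<in> sqm"
  shows "adj s X * adj s Y = adj s (X * Y)"
proof -
  note c = assms shear_closed[of s] shear_closed[of "- s"]
  have "adj s X * adj s Y = shear s * (X * ((shear (- s) * shear s) * (Y * shear (- s))))"
    unfolding adj_def using c by (simp add: sqm_simps)
  also have "shear (- s) * shear s = 1\<^sub>m N"
    using shear_inverse[of "- s"] by simp
  finally show ?thesis
    unfolding adj_def using c by (simp add: sqm_simps)
qed

lemma adj_add: "X \<in> sqm \<Longrightarrow> Y \<in> sqm \<Longrightarrow> adj s (X + Y) = adj s X + adj s Y"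
  and adj_diff: "X \<in> sqm \<Longrightarrow> Y \<in> sqm \<Longrightarrow> adj s (X - Y) = adj s X - adj s Y"
  and adj_smult: "X \<in> sqm \<Longrightarrow> adj s (c \<cdot>\<^sub>m X) = c \<cdot>\<^sub>m adj s X"
  using shear_closed[of s] shear_closed[of "- s"]
  by (simp_all add: adj_def sqm_simps mult_smult_assoc_mat[of _ N N _ N] mult_smult_distrib[of _ N N _ N])

lemma adj_sp: assumes "X \<in> sp n" shows "adj s X \<in> sp n"
proof (rule sp_I)
  let ?J = "symplectic_form n" and ?g = "shear s" and ?h = "shear (- s)"
  note c = sp_closed[OF assms] shear_closed[of s] shear_closed[of "- s"] symplectic_form_closed
  show "adj s X \<in> sqm"
    using adj_closed c by simp
  have "transpose_mat (adj s X) = transpose_mat ?h * (transpose_mat X * transpose_mat ?g)"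
    unfolding adj_def using c by (simp add: transpose_mult[of _ N N _ N] sqm_simps)
  then have "transpose_mat (adj s X) * ?J = transpose_mat ?h * (transpose_mat X * (transpose_mat ?g * ?J))"
    using c by (simp add: sqm_simps)
  also have "\<dots> = transpose_mat ?h * (transpose_mat X * ?J * ?h)"
    unfolding shear_transpose using c by (simp add: sqm_simps)
  also have "\<dots> = transpose_mat ?h * - (?J * (X * ?h))"
    unfolding sp_transpose_mult[OF assms] using c
    by (subst uminus_mult_left_mat) (auto simp: sqm_simps)
  also have "\<dots> = - (transpose_mat ?h * (?J * (X * ?h)))"
    using c by (subst uminus_mult_right_mat) auto
  also have "transpose_mat ?h * (?J * (X * ?h)) = (transpose_mat ?h * ?J) * (X * ?h)"
    using c by (simp add: sqm_simps)
  also have "transpose_mat ?h * ?J = ?J * ?g"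
    using shear_transpose[of "- s"] by simp
  finally show "transpose_mat (adj s X) * ?J = - (?J * adj s X)"
    unfolding adj_def using c by (simp add: sqm_simps)
qed

text \<open>The bracket of \<open>nil_mat\<close> with \<open>xm j\<close> is \<open>xm 1\<close>.
  At (0, n), the only position where any of the three terms is nonzero, the equation reads 1 = 2 +
  (-1); the entries -1 of \<open>nil_mat\<close> are chosen for this sign.\<close>

lemma nil_mat_xm:
  assumes "j \<in> {2..n}"
  shows "nil_mat * xm j = xm 1 + xm j * nil_mat"
proof (rule eq_matI)
  fix r c assume "r < dim_row (xm 1 + xm j * nil_mat)" "c < dim_col (xm 1 + xm j * nil_mat)"
  then have rc: "r < N" "c < N"
    using xm_closed[of j] nil_mat_closed by auto
  have "(nil_mat * xm j) $$ (r, c) = (\<Sum>k<N. nil_mat $$ (r, k) * xm j $$ (k, c))"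
    using rc xm_closed[of j] nil_mat_closed by (auto simp: scalar_prod_def atLeast0LessThan)
  also have "\<dots> = (\<Sum>k<N. if k = n + j - 1 then (if r = 0 \<and> c = n then 1 else 0) else 0)"
    by (rule sum.cong[OF refl]) (use rc assms in \<open>auto simp: xm_index nil_mat_def\<close>)
  finally have 1: "(nil_mat * xm j) $$ (r, c) = (if r = 0 \<and> c = n then 1 else 0)"
    using assms by auto
  have "(xm j * nil_mat) $$ (r, c) = (\<Sum>k<N. xm j $$ (r, k) * nil_mat $$ (k, c))"
    using rc xm_closed[of j] nil_mat_closed by (auto simp: scalar_prod_def atLeast0LessThan)
  also have "\<dots> = (\<Sum>k<N. if k = j - 1 then (if r = 0 \<and> c = n then - 1 else 0) else 0)"
    by (rule sum.cong[OF refl]) (use rc assms in \<open>auto simp: xm_index nil_mat_def\<close>)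
  finally have 2: "(xm j * nil_mat) $$ (r, c) = (if r = 0 \<and> c = n then - 1 else 0)"
    using assms by auto
  have "(xm 1 + xm j * nil_mat) $$ (r, c) = xm 1 $$ (r, c) + (xm j * nil_mat) $$ (r, c)"
    using rc carrier_matD[OF xm_closed[of j]] carrier_matD[OF nil_mat_closed] by simp
  then show "(nil_mat * xm j) $$ (r, c) = (xm 1 + xm j * nil_mat) $$ (r, c)"
    using 1 2 xm_one_index[OF rc] by auto
qed (use carrier_matD[OF xm_closed[of j]] carrier_matD[OF nil_mat_closed] in auto)

lemma nil_mat_xm_one: "nil_mat * xm 1 = 0\<^sub>m N N" "xm 1 * nil_mat = 0\<^sub>m N N"
  by (rule mat_mult_eq_zero, use xm_closed nil_mat_closed n_ge_2 in
      \<open>auto simp: xm_one_index[unfolded One_nat_def] nil_mat_def\<close>)+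

text \<open>Clearing the inverse leaves an equation that is linear in \<open>shear s\<close>, so
  that only products with \<open>nil_mat\<close> have to be computed.\<close>

lemma adj_eqI:
  assumes "X \<in> sqm" "Y \<in> sqm" "shear s * X = Y * shear s"
  shows "adj s X = Y"
proof -
  note c = assms(1,2) shear_closed[of s] shear_closed[of "- s"]
  have "adj s X = (shear s * X) * shear (- s)"
    unfolding adj_def using c by (simp add: sqm_simps)
  also have "\<dots> = Y * (shear s * shear (- s))"
    unfolding assms(3) using c by (simp add: sqm_simps)
  finally show ?thesis
    using c by (simp add: shear_inverse)
qed

lemma adj_xm_one: "adj 1 (xm 1) = xm 1"
  by (rule adj_eqI) (use xm_closed[of 1] nil_mat_closed nil_mat_xm_one in
    \<open>simp_all add: shear_def one_smult_mat sqm_simps mult_smult_assoc_mat[of _ N N _ N] mult_smult_distrib[of _ N N _ N]\<close>)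

lemma adj_xm: assumes "j \<in> {2..n}" shows "adj 1 (xm j) = xm j + xm 1"
proof (rule adj_eqI)
  note c = xm_closed[of j] xm_closed[of 1] nil_mat_closed
  have "shear 1 * xm j = xm j + nil_mat * xm j"
    unfolding shear_def using c
    by (simp add: add_mult_distrib_mat[of _ N N _ _ N] one_smult_mat)
  also have "\<dots> = (xm j + xm 1) + (xm j * nil_mat + xm 1 * nil_mat)"
    unfolding nil_mat_xm[OF assms] nil_mat_xm_one(2) using c by (simp add: sqm_simps)
  also have "\<dots> = (xm j + xm 1) * shear 1"
    unfolding shear_def using c
    by (simp add: add_mult_distrib_mat[of _ N N _ _ N] mult_add_distrib_mat[of _ N N _ N]
      one_smult_mat add_carrier_mat[of _ N N] mult_carrier_mat[of _ N N _ N])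
  finally show "shear 1 * xm j = (xm j + xm 1) * shear 1" .
qed (use xm_closed in auto)

definition ym :: "nat \<Rightarrow> complex mat" where
  "ym j = adj 1 (xm j)"

lemma ym_sp: "j \<in> {1..n} \<Longrightarrow> ym j \<in> sp n"
  unfolding ym_def by (intro adj_sp xm_sp)

text \<open>The automorphism of the enveloping algebra induced by conjugation with
  \<open>shear s\<close>; the parameter covers the inverse as well, which belongs to
  \<open>- s\<close>.\<close>

definition tau :: "complex \<Rightarrow> env \<Rightarrow> env" where
  "tau s = (SOME F. F \<in> calgebra_hom U U \<and> (\<forall>X \<in> sp n. F (\<iota> X) = \<iota> (adj s X)))"

lemma tau: "tau s \<in> calgebra_hom U U" "X \<in> sp n \<Longrightarrow> tau s (\<iota> X) = \<iota> (adj s X)"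
proof -
  have "\<exists>F \<in> calgebra_hom U U. \<forall>X \<in> sp n. F (\<iota> X) = \<iota> (adj s X)"
  proof (rule g.env_hom_exists[OF g.U.is_calgebra])
    fix X Y assume XY: "X \<in> sp n" "Y \<in> sp n"
    note c = sp_closed[OF XY(1)] sp_closed[OF XY(2)]
    show "\<iota> (adj s (X + Y)) = \<iota> (adj s X) \<oplus>\<^bsub>U\<^esub> \<iota> (adj s Y)"
      using adj_add[OF c] g.env_of_add adj_sp XY by simp
    have "adj s (X * Y - Y * X) = adj s X * adj s Y - adj s Y * adj s X"
      using c by (simp add: adj_mult adj_diff sqm_simps)
    then show "\<iota> (adj s (X * Y - Y * X))
        = \<iota> (adj s X) \<otimes>\<^bsub>U\<^esub> \<iota> (adj s Y) \<ominus>\<^bsub>U\<^esub> \<iota> (adj s Y) \<otimes>\<^bsub>U\<^esub> \<iota> (adj s X)"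
      using g.env_of_bracket adj_sp XY by simp
  next
    fix c X assume X: "X \<in> sp n"
    then show "\<iota> (adj s X) \<in> carrier U" "\<iota> (adj s (c \<cdot>\<^sub>m X)) = c \<odot>\<^bsub>U\<^esub> \<iota> (adj s X)"
      using adj_sp adj_smult[OF sp_closed[OF X]] g.env_of_smult by auto
  qed
  then have "tau s \<in> calgebra_hom U U \<and> (\<forall>X \<in> sp n. tau s (\<iota> X) = \<iota> (adj s X))"
    unfolding tau_def by (intro someI_ex[of "\<lambda>F. F \<in> calgebra_hom U U \<and> (\<forall>X \<in> sp n. F (\<iota> X) = \<iota> (adj s X))"]) blast
  then show "tau s \<in> calgebra_hom U U" "X \<in> sp n \<Longrightarrow> tau s (\<iota> X) = \<iota> (adj s X)"
    by auto
qed

lemmas tau_hom = calgebra_homD[OF tau(1)]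

lemma tau_inverse: assumes "u \<in> carrier U" shows "tau s (tau (- s) u) = u"
proof (rule g.env_hom_unique[OF calgebra_hom_compose[OF tau(1) tau(1)], of "\<lambda>u. u"])
  show "(\<lambda>u. u) \<in> calgebra_hom U U"
    by (rule calgebra_homI) auto
qed (use assms tau(2) adj_sp adj_inverse sp_closed in auto)

lemma tau_diff: "u \<in> carrier U \<Longrightarrow> v \<in> carrier U \<Longrightarrow> tau s (u \<ominus>\<^bsub>U\<^esub> v) = tau s u \<ominus>\<^bsub>U\<^esub> tau s v"
  by (rule calgebra_hom_diff[OF g.U.is_calgebra g.U.is_calgebra tau(1)])

lemma tau_zero: "tau s \<zero>\<^bsub>U\<^esub> = \<zero>\<^bsub>U\<^esub>"
  by (rule calgebra_hom_zero[OF g.U.is_calgebra g.U.is_calgebra tau(1)])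

text \<open>Two left ideals interchanged by \<open>tau 1\<close> and \<open>tau (- 1)\<close>:
  \<open>I\<^sub>y\<close> belongs to \<theta>, which is 1 on each \<open>ym j\<close>, and
  \<open>I\<^sub>x\<close> is the one adapted to the weights.\<close>

abbreviation "I\<^sub>x \<equiv> g.U.left_ideal ((\<lambda>j. \<iota> (xm j) \<ominus>\<^bsub>U\<^esub> \<one>\<^bsub>U\<^esub>) ` {1..n})"
abbreviation "I\<^sub>y \<equiv> g.U.left_ideal ((\<lambda>j. \<iota> (ym j) \<ominus>\<^bsub>U\<^esub> \<one>\<^bsub>U\<^esub>) ` {1..n})"

lemma gens_closed: "(\<lambda>j. \<iota> (xm j) \<ominus>\<^bsub>U\<^esub> \<one>\<^bsub>U\<^esub>) ` {1..n} \<subseteq> carrier U"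
    "(\<lambda>j. \<iota> (ym j) \<ominus>\<^bsub>U\<^esub> \<one>\<^bsub>U\<^esub>) ` {1..n} \<subseteq> carrier U"
  using xm_sp ym_sp by (auto intro!: g.U.minus_closed)

lemma tau_left_ideal:
  assumes "y \<in> g.U.left_ideal G" "G \<subseteq> carrier U" "G' \<subseteq> carrier U" "tau s ` G \<subseteq> G'"
  shows "tau s y \<in> g.U.left_ideal G'"
  using assms(1)
proof induction
  case zero
  then show ?case by (simp add: tau_zero g.U.left_ideal.zero)
next
  case (add y a g)
  have "tau s (y \<oplus>\<^bsub>U\<^esub> a \<otimes>\<^bsub>U\<^esub> g) = tau s y \<oplus>\<^bsub>U\<^esub> tau s a \<otimes>\<^bsub>U\<^esub> tau s g"
    using add.hyps assms(2) g.U.left_ideal_closed[OF assms(2)] tau_hom(2,3)[where s = s] by auto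
  moreover have "tau s g \<in> G'" "tau s a \<in> carrier U"
    using add.hyps assms(4) tau_hom(1)[where s = s] by auto
  ultimately show ?case
    using add.IH g.U.left_ideal.add by simp
qed

lemma tau_xm: "j \<in> {1..n} \<Longrightarrow> tau 1 (\<iota> (xm j)) = \<iota> (ym j)"
  by (simp add: tau xm_sp ym_def)

lemma tau_ym: "j \<in> {1..n} \<Longrightarrow> tau (- 1) (\<iota> (ym j)) = \<iota> (xm j)"
  using tau_inverse[of "\<iota> (xm j)" "- 1"] tau_xm[of j] xm_sp[of j] by simp

lemma tau_I: "y \<in> I\<^sub>x \<Longrightarrow> tau 1 y \<in> I\<^sub>y"
  by (rule tau_left_ideal[OF _ gens_closed])
    (use xm_sp tau_xm tau_hom(4) in \<open>auto simp: tau_diff image_iff\<close>)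

lemma tau_I': "y \<in> I\<^sub>y \<Longrightarrow> tau (- 1) y \<in> I\<^sub>x"
  by (rule tau_left_ideal[OF _ gens_closed(2,1)])
    (use ym_sp tau_ym tau_hom(4) in \<open>auto simp: tau_diff image_iff\<close>)


section \<open>The subalgebra \<open>m\<close> and its character\<close>

interpretation M: abelian_group "module_mat TYPE(complex) N N"
  by (rule abelian_group_mat)

abbreviation "msum F a \<equiv> \<Oplus>\<^bsub>module_mat TYPE(complex) N N\<^esub>j \<in> F. a j \<cdot>\<^sub>m xm j"

lemma m_alg_iff: "X \<in> m_alg n \<longleftrightarrow> (\<exists>a. X =
    msum {2..n} a + a 1 \<cdot>\<^sub>m xm 1)"
proof -
  have "msum {2..n} a
      = (\<Oplus>\<^bsub>module_mat TYPE(complex) N N\<^esub>j \<in> {2..n}. a j \<cdot>\<^sub>m X_diff n 1 j)" for a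
  proof (rule M.finsum_cong')
    show "(\<lambda>j. a j \<cdot>\<^sub>m X_diff n 1 j) \<in> {2..n} \<rightarrow> carrier (module_mat TYPE(complex) N N)"
      by (auto simp: module_mat_simps X_diff_def mat_unit_def intro!: carrier_matI)
  qed (auto simp: xm_def)
  moreover have "xm 1 = X_sum n 1 1"
    by (simp add: xm_def)
  ultimately show ?thesis
    by (simp add: m_alg_def)
qed

text \<open>Linear statements about the subalgebra can be proved by adding multiples of generators,
  with the finite sums in the matrix module kept out of sight.\<close>

lemma m_alg_induct [consumes 1, case_names zero add]:
  assumes "X \<in> m_alg n" "P (0\<^sub>m N N)"
    and "\<And>X c j. X \<in> sqm \<Longrightarrow> P X \<Longrightarrow> j \<in> {1..n} \<Longrightarrow> P (X + c \<cdot>\<^sub>m xm j)"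
  shows "P X"
proof -
  obtain a where X: "X = msum {2..n} a + a 1 \<cdot>\<^sub>m xm 1"
    using assms(1) m_alg_iff by blast
  have "P (msum F a)
      \<and> msum F a \<in> sqm"
    if "finite F" "F \<subseteq> {2..n}" for F
    using that
  proof (induction F)
    case empty
    show ?case using assms(2) by (simp add: module_mat_simps)
  next
    case (insert i F)
    let ?S = "msum F a"
    have S: "P ?S" "?S \<in> sqm"
      using insert by auto
    have "msum (insert i F) a = a i \<cdot>\<^sub>m xm i + ?S"
      using insert.hyps xm_closed by (subst M.finsum_insert) (auto simp: module_mat_simps)
    also have "\<dots> = ?S + a i \<cdot>\<^sub>m xm i"
      by (rule comm_add_mat[OF smult_carrier_mat[OF xm_closed] S(2)])
    finally show ?case
      using assms(3)[OF S(2,1), of i "a i"] insert.prems S(2) xm_closed[of i] by auto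
  qed
  from this[of "{2..n}"] show ?thesis
    unfolding X using assms(3)[of _ 1 "a 1"] n_ge_2 by auto
qed

lemma m_alg_add: assumes "X \<in> m_alg n" "Y \<in> m_alg n" shows "X + Y \<in> m_alg n"
proof -
  obtain a where X: "X = msum {2..n} a + a 1 \<cdot>\<^sub>m xm 1" (is "X = ?S + _")
    using assms(1) m_alg_iff by blast
  obtain b where Y: "Y = msum {2..n} b + b 1 \<cdot>\<^sub>m xm 1" (is "Y = ?R + _")
    using assms(2) m_alg_iff by blast
  have c: "(\<lambda>j. a j \<cdot>\<^sub>m xm j) \<in> {2..n} \<rightarrow> carrier (module_mat TYPE(complex) N N)" for a
    using xm_closed by (auto simp: module_mat_simps)
  have S: "?S \<in> sqm" "?R \<in> sqm"
    using M.finsum_closed[OF c] by (simp_all add: module_mat_simps)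
  have ab: "(a j + b j) \<cdot>\<^sub>m xm j = a j \<cdot>\<^sub>m xm j + b j \<cdot>\<^sub>m xm j" for j
    using xm_closed[of j] by (intro eq_matI) (auto simp: algebra_simps)
  have "msum {2..n} (\<lambda>j. a j + b j) = ?S + ?R"
    using M.finsum_addf[OF c c, of a b] by (simp add: module_mat_simps ab)
  then have "X + Y = msum {2..n} (\<lambda>j. a j + b j)
      + (a 1 + b 1) \<cdot>\<^sub>m xm 1"
    unfolding X Y using S xm_closed[of 1] by (intro eq_matI) (auto simp: algebra_simps)
  then show ?thesis
    unfolding m_alg_iff by (intro exI[of _ "\<lambda>j. a j + b j"])
qed

lemma m_alg_smult: assumes "X \<in> m_alg n" shows "c \<cdot>\<^sub>m X \<in> m_alg n"
proof -
  obtain a where X: "X = msum {2..n} a + a 1 \<cdot>\<^sub>m xm 1" (is "X = ?S + _")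
    using assms(1) m_alg_iff by blast
  have cl: "(\<lambda>j. a j \<cdot>\<^sub>m xm j) \<in> F \<rightarrow> carrier (module_mat TYPE(complex) N N)" for a F
    using xm_closed by (auto simp: module_mat_simps)
  have S: "msum F a \<in> sqm" for a F
    using M.finsum_closed[OF cl] by (simp add: module_mat_simps)
  have "msum F (\<lambda>j. c * a j)
      = c \<cdot>\<^sub>m msum F a" if "finite F" for F
    using that
  proof (induction F)
    case empty
    show ?case by (simp add: module_mat_simps)
  next
    case (insert i F)
    have ins: "msum (insert i F) a
        = a i \<cdot>\<^sub>m xm i + msum F a" for a
      using M.finsum_insert[OF insert.hyps cl] xm_closed[of i] by (simp add: module_mat_simps)
    show ?case
      unfolding ins insert.IH using S[of a F] xm_closed[of i]
      by (intro eq_matI) (auto simp: algebra_simps)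
  qed
  then have cS: "msum {2..n} (\<lambda>j. c * a j) = c \<cdot>\<^sub>m ?S"
    by simp
  have "c \<cdot>\<^sub>m X = msum {2..n} (\<lambda>j. c * a j) + (c * a 1) \<cdot>\<^sub>m xm 1"
    unfolding X cS using S[of a "{2..n}"] xm_closed[of 1] by (intro eq_matI) (auto simp: algebra_simps)
  then show ?thesis
    unfolding m_alg_iff by (intro exI[of _ "\<lambda>j. c * a j"])
qed

lemma xm_m_alg: assumes "i \<in> {1..n}" shows "xm i \<in> m_alg n"
proof -
  define a where "a j = (if j = i then 1 else 0 :: complex)" for j
  have z: "0 \<cdot>\<^sub>m xm j = 0\<^sub>m N N" for j
    using xm_closed[of j] by (intro eq_matI) auto
  have cl: "(\<lambda>j. a j \<cdot>\<^sub>m xm j) \<in> F \<rightarrow> carrier (module_mat TYPE(complex) N N)" for F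
    using xm_closed by (auto simp: module_mat_simps)
  have sum: "msum {2..n} a
      = msum ({2..n} \<inter> {i}) a"
    by (rule M.add.finprod_mono_neutral_cong_right) (use cl[unfolded Pi_iff] in \<open>auto simp: a_def z module_mat_simps\<close>)
  have "msum {2..n} a + a 1 \<cdot>\<^sub>m xm 1 = xm i"
  proof (cases "i = 1")
    case True
    then show ?thesis
      unfolding sum using xm_closed[of 1] by (simp add: a_def one_smult_mat module_mat_simps)
  next
    case False
    then have i: "{2..n} \<inter> {i} = {i}" using assms by auto
    have "msum ({2..n} \<inter> {i}) a = xm i"
      unfolding i using M.finsum_insert[of "{}" i "\<lambda>j. a j \<cdot>\<^sub>m xm j"] xm_closed[of i]
      by (simp add: module_mat_simps a_def one_smult_mat)
    then show ?thesis
      unfolding sum using False xm_closed[of i] z[of 1] by (simp add: a_def)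
  qed
  then show ?thesis
    unfolding m_alg_iff by (intro exI[of _ a]) simp
qed

lemma m_alg_sp: "X \<in> m_alg n \<Longrightarrow> X \<in> sp n"
proof (induction rule: m_alg_induct)
  case zero
  have "0\<^sub>m N N = 0 \<cdot>\<^sub>m xm 1"
    using xm_closed[of 1] by (intro eq_matI) auto
  then show ?case
    using g.smult_closed[OF xm_sp[of 1], of 0] n_ge_2 by simp
next
  case (add X c j)
  then show ?case
    by (intro g.add_closed g.smult_closed xm_sp)
qed

text \<open>Products of generators vanish and the product is bilinear. Hence the bracket is zero,
  and every linear form is a character.\<close>

lemma m_alg_mult:
  assumes "X \<in> m_alg n" "Y \<in> m_alg n" shows "X * Y = 0\<^sub>m N N"
proof -
  have xY: "xm i * Y = 0\<^sub>m N N" if i: "i \<in> {1..n}" for i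
    using assms(2)
  proof (induction rule: m_alg_induct)
    case (add Y c j)
    then show ?case
      using xm_closed[of i] xm_closed[of j] xm_mult[OF i add(2)]
      by (simp add: mult_add_distrib_mat[of _ N N _ N] mult_smult_distrib[of _ N N _ N])
  qed (use xm_closed[of i] in auto)
  show ?thesis
    using assms(1)
  proof (induction rule: m_alg_induct)
    case (add X c j)
    then show ?case
      using xm_closed[of j] xY[OF add(2)] sp_closed[OF m_alg_sp[OF assms(2)]]
      by (simp add: add_mult_distrib_mat[of _ N N _ _ N] mult_smult_assoc_mat[of _ N N _ N])
  qed (use sp_closed[OF m_alg_sp[OF assms(2)]] in auto)
qed

lemma zero_m_alg: "0\<^sub>m N N \<in> m_alg n"
proof -
  have "0\<^sub>m N N = 0 \<cdot>\<^sub>m xm 1"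
    using xm_closed[of 1] by (intro eq_matI) auto
  then show ?thesis
    using m_alg_smult[OF xm_m_alg[of 1], of 0] n_ge_2 by simp
qed

lemma m_alg_bracket: "X \<in> m_alg n \<Longrightarrow> Y \<in> m_alg n \<Longrightarrow> X * Y - Y * X = 0\<^sub>m N N"
  by (simp only: m_alg_mult) auto

sublocale m: matrix_lie_algebra "m_alg n"
  by unfold_locales (auto simp: m_alg_add m_alg_smult m_alg_bracket zero_m_alg)

text \<open>Counting from 0, the single entry of \<open>min_nilpotent n\<close> stands at (n, 0), so
  the trace picks out the entry (0, n) of \<open>X\<close>.\<close>

lemma theta_eq: assumes X: "X \<in> sqm" shows "theta n X = X $$ (0, n) / 2"
proof -
  have e: "min_nilpotent n \<in> sqm"
    by (simp add: min_nilpotent_def mat_unit_def)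
  have "(X * min_nilpotent n) $$ (i, i) = (if i = 0 then X $$ (0, n) else 0)" if "i < N" for i
  proof -
    have "(X * min_nilpotent n) $$ (i, i) = (\<Sum>k<N. X $$ (i, k) * min_nilpotent n $$ (k, i))"
      using that X e by (auto simp: scalar_prod_def atLeast0LessThan)
    also have "\<dots> = (\<Sum>k<N. if k = n then (if i = 0 then X $$ (0, n) else 0) else 0)"
      by (rule sum.cong[OF refl]) (use that in \<open>auto simp: min_nilpotent_def mat_unit_def\<close>)
    finally show ?thesis using n_ge_2 by simp
  qed
  then have "(\<Sum>i<N. (X * min_nilpotent n) $$ (i, i)) = (\<Sum>i<N. if i = 0 then X $$ (0, n) else 0)"
    by (intro sum.cong) auto
  moreover have "dim_row (X * min_nilpotent n) = N"
    using X by simp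
  ultimately show ?thesis
    using n_ge_2 by (simp add: theta_def mat_trace_def)
qed

lemma theta_add: "X \<in> sqm \<Longrightarrow> Y \<in> sqm \<Longrightarrow> theta n (X + Y) = theta n X + theta n Y"
  using n_ge_2 by (simp add: theta_eq add_divide_distrib)

lemma theta_smult: "X \<in> sqm \<Longrightarrow> theta n (c \<cdot>\<^sub>m X) = c * theta n X"
  using n_ge_2 by (simp add: theta_eq)

lemma theta_zero: "theta n (0\<^sub>m N N) = 0"
  using n_ge_2 by (simp add: theta_eq)

lemma theta_xm: "j \<in> {1..n} \<Longrightarrow> theta n (xm j) = (if j = 1 then 1 else 0)"
  using n_ge_2 xm_one_index[of 0 n] xm_index[of j 0 n] xm_closed by (auto simp: theta_eq)

lemma ym_one: "ym 1 = xm 1" and ym: "j \<in> {2..n} \<Longrightarrow> ym j = xm j + xm 1"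
  using adj_xm_one adj_xm by (simp_all add: ym_def)

lemma ym_m_alg: "j \<in> {1..n} \<Longrightarrow> ym j \<in> m_alg n"
  using xm_m_alg[of 1] xm_m_alg[of j] ym_one ym[of j] m_alg_add n_ge_2 by (cases "j = 1") auto

lemma theta_ym: assumes j: "j \<in> {1..n}" shows "theta n (ym j) = 1"
proof (cases "j = 1")
  case True
  then show ?thesis using ym_one theta_xm[of 1] n_ge_2 by simp
next
  case False
  then have "j \<in> {2..n}" using j by auto
  then show ?thesis
    using ym theta_add[OF xm_closed xm_closed, of j 1] theta_xm[OF j] theta_xm[of 1] False n_ge_2 by simp
qed

abbreviation "\<nu> \<equiv> env_lift (m_alg n) U \<iota>"
abbreviation "\<chi> \<equiv> env_lift (m_alg n) complex_algebra (theta n)"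

lemma nu: "\<nu> \<in> calgebra_hom m.U U" "X \<in> m_alg n \<Longrightarrow> \<nu> (m.\<iota> X) = \<iota> X"
proof -
  have "\<iota> X \<otimes>\<^bsub>U\<^esub> \<iota> Y \<ominus>\<^bsub>U\<^esub> \<iota> Y \<otimes>\<^bsub>U\<^esub> \<iota> X = \<iota> (X * Y - Y * X)" if "X \<in> m_alg n" "Y \<in> m_alg n" for X Y
    using g.env_of_bracket m_alg_sp that by blast
  note * = g.U.is_calgebra g.env_of_closed[OF m_alg_sp] g.env_of_add[OF m_alg_sp m_alg_sp]
    g.env_of_smult[OF m_alg_sp] this[symmetric]
  show "\<nu> \<in> calgebra_hom m.U U" "X \<in> m_alg n \<Longrightarrow> \<nu> (m.\<iota> X) = \<iota> X"
    by (rule m.env_lift[OF *]; assumption)+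
qed

lemma chi: "\<chi> \<in> calgebra_hom m.U complex_algebra" "X \<in> m_alg n \<Longrightarrow> \<chi> (m.\<iota> X) = theta n X"
proof -
  interpret CC: calg complex_algebra
    using calgebra_complex_algebra by (rule calg.intro)
  have b: "theta n (X * Y - Y * X)
      = theta n X \<otimes>\<^bsub>complex_algebra\<^esub> theta n Y \<ominus>\<^bsub>complex_algebra\<^esub> theta n Y \<otimes>\<^bsub>complex_algebra\<^esub> theta n X"
    if "X \<in> m_alg n" "Y \<in> m_alg n" for X Y
  proof -
    have "theta n X * theta n Y \<ominus>\<^bsub>complex_algebra\<^esub> theta n Y * theta n X = \<zero>\<^bsub>complex_algebra\<^esub>"
      by (rule CC.diff_eq_zero_iff[THEN iffD2]) (simp_all add: mult.commute)
    then show ?thesis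
      by (simp add: m_alg_bracket[OF that] theta_zero)
  qed
  have *: "theta n X \<in> carrier complex_algebra"
    "X \<in> m_alg n \<Longrightarrow> Y \<in> m_alg n \<Longrightarrow> theta n (X + Y) = theta n X \<oplus>\<^bsub>complex_algebra\<^esub> theta n Y"
    "X \<in> m_alg n \<Longrightarrow> theta n (c \<cdot>\<^sub>m X) = c \<odot>\<^bsub>complex_algebra\<^esub> theta n X" for X Y c
    using theta_add theta_smult sp_closed[OF m_alg_sp] by auto
  show "\<chi> \<in> calgebra_hom m.U complex_algebra" "X \<in> m_alg n \<Longrightarrow> \<chi> (m.\<iota> X) = theta n X"
    using m.env_lift[OF calgebra_complex_algebra *(1,2,3) b] by blast+
qed

text \<open>Linearity in \<open>X\<close> leaves the generators. Modulo \<open>I\<^sub>y\<close> the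
  element of \<open>xm 1 = ym 1\<close> is 1, and that of \<open>xm j = ym j - ym 1\<close> is 0 for
  j \<ge> 2; these are the values of \<theta>.\<close>

lemma m_alg_character:
  assumes "X \<in> m_alg n"
  shows "\<iota> X \<ominus>\<^bsub>U\<^esub> theta n X \<odot>\<^bsub>U\<^esub> \<one>\<^bsub>U\<^esub> \<in> I\<^sub>y"
proof -
  let ?d = "\<lambda>X. \<iota> X \<ominus>\<^bsub>U\<^esub> theta n X \<odot>\<^bsub>U\<^esub> \<one>\<^bsub>U\<^esub>"
  note lid = g.U.left_ideal_add[OF gens_closed(2)] g.U.left_ideal_diff[OF gens_closed(2)]
    g.U.left_ideal_scale[OF gens_closed(2)]
  have y: "\<iota> (ym j) \<ominus>\<^bsub>U\<^esub> \<one>\<^bsub>U\<^esub> \<in> I\<^sub>y" if "j \<in> {1..n}" for j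
    using g.U.left_ideal_gen[OF gens_closed(2) g.U.one_closed, of "\<iota> (ym j) \<ominus>\<^bsub>U\<^esub> \<one>\<^bsub>U\<^esub>"] that ym_sp[OF that]
    by auto
  have x: "?d (xm j) \<in> I\<^sub>y" if j: "j \<in> {1..n}" for j
  proof (cases "j = 1")
    case True
    then show ?thesis
      using y[of 1] ym_one theta_xm[OF j] j by simp
  next
    case False
    then have j2: "j \<in> {2..n}" and 1: "1 \<in> {1..n}"
      using j by auto
    have "\<iota> (ym j) = \<iota> (xm j) \<oplus>\<^bsub>U\<^esub> \<iota> (ym 1)"
      using ym[OF j2] ym_one g.env_of_add[OF xm_sp[OF j] xm_sp[OF 1]] by simp
    moreover have c: "\<iota> (xm j) \<in> carrier U" "\<iota> (ym 1) \<in> carrier U"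
      using xm_sp[OF j] ym_sp[OF 1] by auto
    ultimately have "(\<iota> (ym j) \<ominus>\<^bsub>U\<^esub> \<one>\<^bsub>U\<^esub>) \<ominus>\<^bsub>U\<^esub> (\<iota> (ym 1) \<ominus>\<^bsub>U\<^esub> \<one>\<^bsub>U\<^esub>)
        = (\<iota> (xm j) \<oplus>\<^bsub>U\<^esub> (\<iota> (ym 1) \<ominus>\<^bsub>U\<^esub> \<one>\<^bsub>U\<^esub>)) \<ominus>\<^bsub>U\<^esub> (\<iota> (ym 1) \<ominus>\<^bsub>U\<^esub> \<one>\<^bsub>U\<^esub>)"
      by (simp add: a_minus_def g.U.a_assoc)
    also have "\<dots> = \<iota> (xm j)"
      using c by (simp add: a_minus_def[of U "\<iota> (xm j) \<oplus>\<^bsub>U\<^esub> _"] g.U.a_assoc g.U.r_neg)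
    finally show ?thesis
      using lid(2)[OF y[OF j] y[OF 1]] theta_xm[OF j] False c by (simp add: a_minus_def)
  qed
  have "X \<in> sp n \<and> ?d X \<in> I\<^sub>y"
    using assms
  proof (induction rule: m_alg_induct)
    case zero
    then show ?case
      using m_alg_sp[OF zero_m_alg] by (simp add: env_of_zero theta_zero a_minus_def g.U.left_ideal.zero)
  next
    case (add X c j)
    have X: "X \<in> sp n" "?d X \<in> I\<^sub>y" and j: "j \<in> {1..n}" "xm j \<in> sp n"
      using add xm_sp by auto
    have c: "\<iota> X \<in> carrier U" "\<iota> (xm j) \<in> carrier U"
      using X j by auto
    have e: "\<iota> (X + c \<cdot>\<^sub>m xm j) = \<iota> X \<oplus>\<^bsub>U\<^esub> c \<odot>\<^bsub>U\<^esub> \<iota> (xm j)"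
      using g.env_of_add[OF X(1) g.smult_closed[OF j(2)]] g.env_of_smult[OF j(2)] by simp
    have t: "theta n (X + c \<cdot>\<^sub>m xm j) = theta n X + c * theta n (xm j)"
      using theta_add[OF sp_closed[OF X(1)] smult_carrier_mat[OF xm_closed]] theta_smult[OF xm_closed] by simp
    have "?d X \<oplus>\<^bsub>U\<^esub> c \<odot>\<^bsub>U\<^esub> ?d (xm j) \<in> I\<^sub>y"
      using lid(1)[OF lid(3)[OF x[OF j(1)]] X(2)] .
    also have "?d X \<oplus>\<^bsub>U\<^esub> c \<odot>\<^bsub>U\<^esub> ?d (xm j) = ?d (X + c \<cdot>\<^sub>m xm j)"
      unfolding e t using c
      by (simp add: g.U.scale_diff g.U.scale_scale g.U.scale_add_left g.U.add_diff_swap)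
    finally show ?case
      using g.add_closed[OF X(1) g.smult_closed[OF j(2)]] by blast
  qed
  then show ?thesis by blast
qed

text \<open>The product case rests on \<open>\<nu>x \<nu>y - \<chi>x \<chi>y = \<nu>x (\<nu>y -
  \<chi>y) + \<chi>y (\<nu>x - \<chi>x)\<close>, in which the left ideal is multiplied from the left
  only.\<close>

lemma lift_character:
  assumes "r \<in> carrier m.U"
  shows "\<nu> r \<ominus>\<^bsub>U\<^esub> \<chi> r \<odot>\<^bsub>U\<^esub> \<one>\<^bsub>U\<^esub> \<in> I\<^sub>y"
  using m.env_generated[OF assms]
proof induction
  note lid = g.U.left_ideal_add[OF gens_closed(2)] g.U.left_ideal_mult[OF gens_closed(2)]
    g.U.left_ideal_scale[OF gens_closed(2)]
  note nu' = calgebra_homD[OF nu(1)] and chi' = calgebra_homD[OF chi(1)]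
  have cl: "x \<in> carrier m.U" if "x \<in> generated_subalgebra m.U (m.\<iota> ` m_alg n)" for x
    by (rule m.U.generated_subalgebra_closed[OF _ that]) auto
  {
    case one
    show ?case
      by (simp add: nu' chi' a_minus_def g.U.r_neg g.U.left_ideal.zero)
  next
    case (incl h)
    then show ?case
      using m_alg_character nu(2) chi(2) by auto
  next
    case (add x y)
    have c: "\<nu> x \<in> carrier U" "\<nu> y \<in> carrier U"
      using add.hyps cl nu'(1) by auto
    have "\<nu> (x \<oplus>\<^bsub>m.U\<^esub> y) \<ominus>\<^bsub>U\<^esub> \<chi> (x \<oplus>\<^bsub>m.U\<^esub> y) \<odot>\<^bsub>U\<^esub> \<one>\<^bsub>U\<^esub>
        = (\<nu> x \<ominus>\<^bsub>U\<^esub> \<chi> x \<odot>\<^bsub>U\<^esub> \<one>\<^bsub>U\<^esub>) \<oplus>\<^bsub>U\<^esub> (\<nu> y \<ominus>\<^bsub>U\<^esub> \<chi> y \<odot>\<^bsub>U\<^esub> \<one>\<^bsub>U\<^esub>)"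
      using c cl[OF add.hyps(1)] cl[OF add.hyps(2)]
      by (simp add: nu' chi' g.U.scale_add_left g.U.add_diff_swap)
    then show ?case
      using lid(1) add.IH by simp
  next
    case (mult x y)
    have c: "\<nu> x \<in> carrier U" "\<nu> y \<in> carrier U"
      using mult.hyps cl nu'(1) by auto
    have "\<nu> x \<otimes>\<^bsub>U\<^esub> (\<nu> y \<ominus>\<^bsub>U\<^esub> \<chi> y \<odot>\<^bsub>U\<^esub> \<one>\<^bsub>U\<^esub>)
        \<oplus>\<^bsub>U\<^esub> \<chi> y \<odot>\<^bsub>U\<^esub> (\<nu> x \<ominus>\<^bsub>U\<^esub> \<chi> x \<odot>\<^bsub>U\<^esub> \<one>\<^bsub>U\<^esub>)
      = (\<nu> x \<otimes>\<^bsub>U\<^esub> \<nu> y \<ominus>\<^bsub>U\<^esub> \<chi> y \<odot>\<^bsub>U\<^esub> \<nu> x) \<oplus>\<^bsub>U\<^esub> (\<chi> y \<odot>\<^bsub>U\<^esub> \<nu> x \<ominus>\<^bsub>U\<^esub> (\<chi> y * \<chi> x) \<odot>\<^bsub>U\<^esub> \<one>\<^bsub>U\<^esub>)"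
      using c by (simp add: a_minus_def g.U.r_distr g.U.r_minus g.U.scale_mult_right g.U.scale_add_right
        g.U.scale_minus g.U.scale_scale)
    also have "\<dots> = \<nu> (x \<otimes>\<^bsub>m.U\<^esub> y) \<ominus>\<^bsub>U\<^esub> \<chi> (x \<otimes>\<^bsub>m.U\<^esub> y) \<odot>\<^bsub>U\<^esub> \<one>\<^bsub>U\<^esub>"
      using c cl[OF mult.hyps(1)] cl[OF mult.hyps(2)]
      by (simp add: nu' chi' g.U.diff_trans mult.commute)
    finally show ?case
      by (rule subst[where P = "\<lambda>z. z \<in> I\<^sub>y"]) (rule lid(1)[OF lid(3)[OF mult.IH(1)] lid(2)[OF c(1) mult.IH(2)]])
  next
    case (smult x c)
    have "\<nu> x \<in> carrier U"
      using smult.hyps cl nu'(1) by auto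
    then have "\<nu> (c \<odot>\<^bsub>m.U\<^esub> x) \<ominus>\<^bsub>U\<^esub> \<chi> (c \<odot>\<^bsub>m.U\<^esub> x) \<odot>\<^bsub>U\<^esub> \<one>\<^bsub>U\<^esub>
        = c \<odot>\<^bsub>U\<^esub> (\<nu> x \<ominus>\<^bsub>U\<^esub> \<chi> x \<odot>\<^bsub>U\<^esub> \<one>\<^bsub>U\<^esub>)"
      using cl[OF smult.hyps] by (simp add: nu' chi' g.U.scale_diff g.U.scale_scale)
    then show ?case
      using lid(3)[OF smult.IH] by simp
  }
qed

end

lemma (in calg) add_diff_diff: "p \<in> carrier A \<Longrightarrow> q \<in> carrier A \<Longrightarrow> (p \<oplus> q) \<ominus> p \<ominus> q = \<zero>"
  by (simp add: a_minus_def a_comm[of p q] a_assoc r_neg)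

context symplectic
begin

section \<open>The induced module\<close>

abbreviation "Fab \<equiv> free_Abelian_group (carrier U \<times> (UNIV :: complex set))"

abbreviation "ra \<equiv> \<lambda>u r. u \<otimes>\<^bsub>U\<^esub> \<nu> r"
abbreviation "la \<equiv> \<lambda>r z. \<chi> r * z"

definition rels :: "((env \<times> complex) \<Rightarrow>\<^sub>0 int) set" where
  "rels = tensor_relations m.U U ra complex_algebra la"

definition ker :: "((env \<times> complex) \<Rightarrow>\<^sub>0 int) set" where
  "ker = tensor_kernel m.U U ra complex_algebra la"

abbreviation "Q \<equiv> Q_module n"

definition cls :: "((env \<times> complex) \<Rightarrow>\<^sub>0 int) \<Rightarrow> ((env \<times> complex) \<Rightarrow>\<^sub>0 int) set" where
  "cls F = ker #>\<^bsub>Fab\<^esub> F"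

definition act :: "env \<Rightarrow> ((env \<times> complex) \<Rightarrow>\<^sub>0 int) \<Rightarrow> ((env \<times> complex) \<Rightarrow>\<^sub>0 int)" where
  "act u = frag_extend (\<lambda>(x, z). frag_of (u \<otimes>\<^bsub>U\<^esub> x, z))"

lemma ker_generate: "ker = generate Fab rels"
  by (simp add: ker_def rels_def tensor_kernel_def)

lemma nu_closed [simp]: "r \<in> carrier m.U \<Longrightarrow> \<nu> r \<in> carrier U"
  by (rule calgebra_homD(1)[OF nu(1)])

lemma rels_cases [consumes 1, case_names left right balanced]:
  assumes "F \<in> rels"
    and "\<And>x y z. x \<in> carrier U \<Longrightarrow> y \<in> carrier U
      \<Longrightarrow> F = frag_of (x \<oplus>\<^bsub>U\<^esub> y, z) - frag_of (x, z) - frag_of (y, z) \<Longrightarrow> P"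
    and "\<And>x y z. x \<in> carrier U \<Longrightarrow> F = frag_of (x, y + z) - frag_of (x, y) - frag_of (x, z) \<Longrightarrow> P"
    and "\<And>x r z. x \<in> carrier U \<Longrightarrow> r \<in> carrier m.U
      \<Longrightarrow> F = frag_of (x \<otimes>\<^bsub>U\<^esub> \<nu> r, z) - frag_of (x, \<chi> r * z) \<Longrightarrow> P"
  shows P
  using assms(1) unfolding rels_def tensor_relations_def complex_algebra_simps
  using assms(2-4) by blast

lemma rels_left: "x \<in> carrier U \<Longrightarrow> y \<in> carrier U
    \<Longrightarrow> frag_of (x \<oplus>\<^bsub>U\<^esub> y, z) - frag_of (x, z) - frag_of (y, z) \<in> rels"
  and rels_right: "x \<in> carrier U \<Longrightarrow> frag_of (x, a + b) - frag_of (x, a) - frag_of (x, b) \<in> rels"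
  and rels_balanced: "x \<in> carrier U \<Longrightarrow> r \<in> carrier m.U
    \<Longrightarrow> frag_of (x \<otimes>\<^bsub>U\<^esub> \<nu> r, z) - frag_of (x, \<chi> r * z) \<in> rels"
  unfolding rels_def tensor_relations_def complex_algebra_simps by blast+

lemma keys_diff_subset: "Poly_Mapping.keys a \<subseteq> K \<Longrightarrow> Poly_Mapping.keys b \<subseteq> K
    \<Longrightarrow> Poly_Mapping.keys (a - b :: 'x \<Rightarrow>\<^sub>0 int) \<subseteq> K"
  using keys_diff[of a b] by blast

lemma Fab_frag_of [simp]: "x \<in> carrier U \<Longrightarrow> frag_of (x, z) \<in> carrier Fab"
  by simp

lemma Fab_diff [simp]: "a \<in> carrier Fab \<Longrightarrow> b \<in> carrier Fab \<Longrightarrow> a - b \<in> carrier Fab"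
  and Fab_add [simp]: "a \<in> carrier Fab \<Longrightarrow> b \<in> carrier Fab \<Longrightarrow> a + b \<in> carrier Fab"
  and Fab_zero [simp]: "0 \<in> carrier Fab"
  using keys_diff_subset[of a _ b] Poly_Mapping.keys_add[of a b] by auto

lemma rels_closed: "rels \<subseteq> carrier Fab"
proof
  fix F assume "F \<in> rels"
  then show "F \<in> carrier Fab"
    by (cases rule: rels_cases) (auto intro!: Fab_diff simp del: carrier_free_Abelian_group_iff)
qed

lemma ker_subgroup: "subgroup ker Fab"
  unfolding ker_generate by (rule group.generate_is_subgroup[OF group_free_Abelian_group rels_closed])

lemma ker_closed: "F \<in> ker \<Longrightarrow> F \<in> carrier Fab"
  using subgroup.subset[OF ker_subgroup] by blast

lemma ker_zero: "0 \<in> ker"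
  using subgroup.one_closed[OF ker_subgroup] by simp

lemma ker_add: "a \<in> ker \<Longrightarrow> b \<in> ker \<Longrightarrow> a + b \<in> ker"
  using subgroup.m_closed[OF ker_subgroup] by simp

lemma ker_minus: "a \<in> ker \<Longrightarrow> - a \<in> ker"
  using subgroup.m_inv_closed[OF ker_subgroup, of a] ker_closed[of a] by simp

lemma ker_diff: "a \<in> ker \<Longrightarrow> b \<in> ker \<Longrightarrow> a - b \<in> ker"
  using ker_add[of a "- b"] ker_minus[of b] by simp

lemma rels_ker: "F \<in> rels \<Longrightarrow> F \<in> ker"
  unfolding ker_generate by (rule generate.incl)

lemma ker_induct [consumes 1, case_names zero rel minus add]:
  assumes "F \<in> ker" "P 0" "\<And>F. F \<in> rels \<Longrightarrow> P F" "\<And>F. F \<in> rels \<Longrightarrow> P (- F)"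
    "\<And>F G. F \<in> ker \<Longrightarrow> G \<in> ker \<Longrightarrow> P F \<Longrightarrow> P G \<Longrightarrow> P (F + G)"
  shows "P F"
  using assms(1) unfolding ker_generate
proof induction
  case (inv F)
  then show ?case
    using assms(4)[OF inv] subsetD[OF rels_closed inv] by simp
next
  case (eng F G)
  then show ?case
    using assms(5)[unfolded ker_generate] by simp
qed (use assms in auto)

lemma cls_eq: "cls F = {H + F | H. H \<in> ker}"
  by (auto simp: cls_def r_coset_def)

lemma cls_eq_iff: "cls F = cls G \<longleftrightarrow> F - G \<in> ker"
proof
  assume "cls F = cls G"
  moreover have "F \<in> cls F"
    using ker_zero by (force simp: cls_eq)
  ultimately obtain H where "H \<in> ker" "F = H + G"
    by (auto simp: cls_eq)
  then show "F - G \<in> ker" by simp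
next
  assume *: "F - G \<in> ker"
  have "H + F = (H + (F - G)) + G" "H + G = (H - (F - G)) + F" for H
    by (simp_all add: algebra_simps)
  then show "cls F = cls G"
    unfolding cls_eq using ker_add[OF _ *] ker_diff[OF _ *] by blast
qed

text \<open>Left multiplication on the first factor commutes with the right action of U(m), so each
  relation goes to one of the same kind.\<close>

lemma act_rels: assumes u: "u \<in> carrier U" and F: "F \<in> rels" shows "act u F \<in> rels"
  using F
proof (cases rule: rels_cases)
  case (left x y z)
  then show ?thesis
    using u rels_left[of "u \<otimes>\<^bsub>U\<^esub> x" "u \<otimes>\<^bsub>U\<^esub> y" z]
    by (simp add: act_def frag_extend_diff g.U.r_distr)
next
  case (right x y z)
  then show ?thesis
    using u rels_right[of "u \<otimes>\<^bsub>U\<^esub> x" y z] by (simp add: act_def frag_extend_diff)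
next
  case (balanced x r z)
  then show ?thesis
    using u rels_balanced[of "u \<otimes>\<^bsub>U\<^esub> x" r z] by (simp add: act_def frag_extend_diff g.U.m_assoc)
qed

lemma act_ker: assumes u: "u \<in> carrier U" shows "F \<in> ker \<Longrightarrow> act u F \<in> ker"
proof (induction rule: ker_induct)
  case zero
  then show ?case by (simp add: act_def ker_zero)
next
  case (rel F)
  then show ?case using act_rels[OF u] rels_ker by blast
next
  case (minus F)
  then show ?case
    using ker_minus[OF rels_ker[OF act_rels[OF u]]] by (simp add: act_def frag_extend_minus)
next
  case (add F G)
  then show ?case using ker_add by (simp add: act_def frag_extend_add)
qed

lemma Q_carrier: "carrier Q = cls ` carrier Fab"
  by (auto simp: Q_module_def induced_module_def tensor_product_def FactGroup_def RCOSETS_def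
    cls_def ker_def)

lemma Q_add: "F \<in> carrier Fab \<Longrightarrow> G \<in> carrier Fab \<Longrightarrow> cls F \<oplus>\<^bsub>Q\<^esub> cls G = cls (F + G)"
proof -
  interpret Fab: comm_group Fab
    by (rule abelian_free_Abelian_group)
  interpret N: normal ker Fab
    by (rule Fab.subgroup_imp_normal[OF ker_subgroup])
  show "F \<in> carrier Fab \<Longrightarrow> G \<in> carrier Fab \<Longrightarrow> cls F \<oplus>\<^bsub>Q\<^esub> cls G = cls (F + G)"
    using N.rcos_sum[of F G]
    by (simp add: Q_module_def induced_module_def tensor_product_def FactGroup_def cls_def ker_def)
qed

lemma Q_zero: "\<zero>\<^bsub>Q\<^esub> = cls 0"
proof -
  have "\<zero>\<^bsub>Q\<^esub> = ker"
    by (simp add: Q_module_def induced_module_def tensor_product_def FactGroup_def ker_def)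
  then show ?thesis by (simp add: cls_eq)
qed

text \<open>The image of a coset under \<open>act u\<close> may fall short of a coset; adding
  \<open>ker\<close>, as the definition does, completes it.\<close>

lemma Q_smult: assumes u: "u \<in> carrier U" shows "u \<odot>\<^bsub>Q\<^esub> cls F = cls (act u F)"
proof -
  have step: "act u (H + F) = act u H + act u F" for H
    by (simp add: act_def frag_extend_add)
  have "u \<odot>\<^bsub>Q\<^esub> cls F = {H + act u G | H G. H \<in> ker \<and> G \<in> cls F}"
    by (auto simp: Q_module_def induced_module_def set_mult_def act_def ker_def)
  also have "\<dots> = {H + act u (H' + F) | H H'. H \<in> ker \<and> H' \<in> ker}"
    unfolding cls_eq by blast
  also have "\<dots> = {(H + act u H') + act u F | H H'. H \<in> ker \<and> H' \<in> ker}"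
    by (simp only: step add.assoc)
  also have "\<dots> = cls (act u F)"
  proof
    show "{(H + act u H') + act u F | H H'. H \<in> ker \<and> H' \<in> ker} \<subseteq> cls (act u F)"
      unfolding cls_eq using ker_add act_ker[OF u] by blast
    have "H + act u F = (H + act u 0) + act u F" for H
      by (simp add: act_def)
    then show "cls (act u F) \<subseteq> {(H + act u H') + act u F | H H'. H \<in> ker \<and> H' \<in> ker}"
      unfolding cls_eq using ker_zero by blast
  qed
  finally show ?thesis .
qed

definition e :: "env \<Rightarrow> ((env \<times> complex) \<Rightarrow>\<^sub>0 int) set" where
  "e u = cls (frag_of (u, 1))"

lemma e_closed: "u \<in> carrier U \<Longrightarrow> e u \<in> carrier Q"
  unfolding e_def Q_carrier by (rule imageI) simp

lemma e_add: "u \<in> carrier U \<Longrightarrow> v \<in> carrier U \<Longrightarrow> e u \<oplus>\<^bsub>Q\<^esub> e v = e (u \<oplus>\<^bsub>U\<^esub> v)"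
proof -
  assume u: "u \<in> carrier U" and v: "v \<in> carrier U"
  have "(frag_of (u, 1) + frag_of (v, 1)) - frag_of (u \<oplus>\<^bsub>U\<^esub> v, 1)
      = - (frag_of (u \<oplus>\<^bsub>U\<^esub> v, 1) - frag_of (u, 1) - frag_of (v, 1 :: complex))"
    by (simp add: algebra_simps)
  then have "(frag_of (u, 1) + frag_of (v, 1)) - frag_of (u \<oplus>\<^bsub>U\<^esub> v, 1) \<in> ker"
    using ker_minus[OF rels_ker[OF rels_left[OF u v, of 1]]] by (simp only:)
  then show ?thesis
    unfolding e_def by (simp only: Q_add[OF Fab_frag_of[OF u] Fab_frag_of[OF v]] cls_eq_iff)
qed

lemma e_smult: "u \<in> carrier U \<Longrightarrow> v \<in> carrier U \<Longrightarrow> u \<odot>\<^bsub>Q\<^esub> e v = e (u \<otimes>\<^bsub>U\<^esub> v)"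
  unfolding e_def by (simp add: Q_smult act_def)

text \<open>The scalar \<open>z\<close> crosses the tensor sign as the element
  \<open>z \<odot> \<one>\<close> of U(m), whose value under \<open>\<chi>\<close> is
  \<open>z\<close>.\<close>

lemma cls_frag_of: assumes "u \<in> carrier U" shows "cls (frag_of (u, z)) = e (z \<odot>\<^bsub>U\<^esub> u)"
proof -
  let ?r = "z \<odot>\<^bsub>m.U\<^esub> \<one>\<^bsub>m.U\<^esub>"
  have "\<nu> ?r = z \<odot>\<^bsub>U\<^esub> \<one>\<^bsub>U\<^esub>" "\<chi> ?r = z"
    using calgebra_homD(4,5)[OF nu(1)] calgebra_homD(4,5)[OF chi(1)] by simp_all
  then have "frag_of (z \<odot>\<^bsub>U\<^esub> u, 1) - frag_of (u, z) \<in> rels"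
    using rels_balanced[OF assms, of ?r 1] assms by (simp add: g.U.scale_mult_right)
  then show ?thesis
    unfolding e_def using rels_ker cls_eq_iff by metis
qed

lemma e_surj: assumes "q \<in> carrier Q" obtains u where "u \<in> carrier U" "q = e u"
proof -
  obtain F where F: "Poly_Mapping.keys F \<subseteq> carrier U \<times> UNIV" "q = cls F"
    using assms by (auto simp: Q_carrier)
  have "\<exists>u \<in> carrier U. cls F = e u"
    using F(1)
  proof (induction F rule: frag_induction)
    case zero
    have "- frag_of (\<zero>\<^bsub>U\<^esub>, 1) \<in> ker"
      using rels_ker[OF rels_left[of "\<zero>\<^bsub>U\<^esub>" "\<zero>\<^bsub>U\<^esub>" 1]] by simp
    then have "cls 0 = e \<zero>\<^bsub>U\<^esub>"
      by (simp add: e_def cls_eq_iff)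
    then show ?case by blast
  next
    case (one p)
    then show ?case
      using cls_frag_of by (cases p) auto
  next
    case (diff a b)
    then obtain u v where u: "u \<in> carrier U" "cls a = e u" and v: "v \<in> carrier U" "cls b = e v"
      by blast
    then have a: "a - frag_of (u, 1) \<in> ker" and b: "b - frag_of (v, 1) \<in> ker"
      by (simp_all add: e_def cls_eq_iff)
    have c: "frag_of (u, 1) - frag_of (u \<ominus>\<^bsub>U\<^esub> v, 1) - frag_of (v, 1) \<in> ker"
      using rels_ker[OF rels_left[of "u \<ominus>\<^bsub>U\<^esub> v" v 1]] u v by simp
    have "(a - frag_of (u, 1)) - (b - frag_of (v, 1))
        + (frag_of (u, 1) - frag_of (u \<ominus>\<^bsub>U\<^esub> v, 1) - frag_of (v, 1)) \<in> ker"
      by (rule ker_add[OF ker_diff[OF a b] c])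
    then have "(a - b) - frag_of (u \<ominus>\<^bsub>U\<^esub> v, 1) \<in> ker"
      by (simp add: algebra_simps)
    then show ?case
      using u v by (intro bexI[of _ "u \<ominus>\<^bsub>U\<^esub> v"]) (simp_all add: e_def cls_eq_iff)
  qed
  then show ?thesis
    using that F(2) by blast
qed

lemma e_zero: "\<zero>\<^bsub>Q\<^esub> = e \<zero>\<^bsub>U\<^esub>"
  using rels_ker[OF rels_left[of "\<zero>\<^bsub>U\<^esub>" "\<zero>\<^bsub>U\<^esub>" 1]] by (simp add: Q_zero e_def cls_eq_iff)

text \<open>The homomorphism from the free abelian group on pairs that sends (u, z) to
  \<open>z \<odot> u\<close>. Modulo \<open>I\<^sub>y\<close> it will invert
  \<open>e\<close>.\<close>

lemma ker_evaluation:
  obtains G where "\<And>a b. a \<in> carrier Fab \<Longrightarrow> b \<in> carrier Fab \<Longrightarrow> G (a + b) = G a \<oplus>\<^bsub>U\<^esub> G b"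
    and "\<And>a. a \<in> carrier Fab \<Longrightarrow> G a \<in> carrier U"
    and "\<And>u z. u \<in> carrier U \<Longrightarrow> G (frag_of (u, z)) = z \<odot>\<^bsub>U\<^esub> u"
proof -
  obtain G where "G \<in> hom Fab (add_monoid U)" "\<And>p. p \<in> carrier U \<times> UNIV \<Longrightarrow> G (frag_of p) = snd p \<odot>\<^bsub>U\<^esub> fst p"
    by (rule g.U.add.free_Abelian_group_universal[of "\<lambda>p. snd p \<odot>\<^bsub>U\<^esub> fst p" "carrier U \<times> UNIV"]) auto
  then show ?thesis
    by (intro that[of G]) (auto simp: hom_def Pi_iff)
qed

text \<open>Under the evaluation the additive relations become zero and the balanced ones become
  \<open>(z x) (\<nu> r - \<chi> r)\<close>, an element of \<open>I\<^sub>y\<close> by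
  \<open>lift_character\<close>.\<close>

lemma e_eq_imp: assumes "u \<in> carrier U" "v \<in> carrier U" "e u = e v" shows "u \<ominus>\<^bsub>U\<^esub> v \<in> I\<^sub>y"
proof -
  obtain G where add: "\<And>a b. a \<in> carrier Fab \<Longrightarrow> b \<in> carrier Fab \<Longrightarrow> G (a + b) = G a \<oplus>\<^bsub>U\<^esub> G b"
    and cl: "\<And>a. a \<in> carrier Fab \<Longrightarrow> G a \<in> carrier U"
    and gen: "\<And>u z. u \<in> carrier U \<Longrightarrow> G (frag_of (u, z)) = z \<odot>\<^bsub>U\<^esub> u"
    by (rule ker_evaluation) blast
  have zero: "G 0 = \<zero>\<^bsub>U\<^esub>"
    using add[of 0 0] cl[of 0] g.U.add.l_cancel_one[of "G 0" "G 0"] by simp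
  have diff: "G (a - b) = G a \<ominus>\<^bsub>U\<^esub> G b" if "a \<in> carrier Fab" "b \<in> carrier Fab" for a b
    using add[OF Fab_diff[OF that] that(2)] g.U.add.inv_solve_right[of "G (a - b)" "G a" "G b"]
      cl[OF that(1)] cl[OF that(2)] cl[OF Fab_diff[OF that]] by (simp add: a_minus_def)
  note lid = g.U.left_ideal_add[OF gens_closed(2)] g.U.left_ideal_mult[OF gens_closed(2)]
    g.U.left_ideal_scale[OF gens_closed(2)] g.U.left_ideal_diff[OF gens_closed(2)]
  have rel: "G F \<in> I\<^sub>y" if "F \<in> rels" for F
    using that
  proof (cases rule: rels_cases)
    case (left x y z)
    have "G F = (z \<odot>\<^bsub>U\<^esub> (x \<oplus>\<^bsub>U\<^esub> y) \<ominus>\<^bsub>U\<^esub> z \<odot>\<^bsub>U\<^esub> x) \<ominus>\<^bsub>U\<^esub> z \<odot>\<^bsub>U\<^esub> y"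
      using left by (simp add: diff gen del: carrier_free_Abelian_group_iff)
    also have "\<dots> = \<zero>\<^bsub>U\<^esub>"
      using left by (simp add: g.U.scale_add_right g.U.add_diff_diff)
    finally show ?thesis by (simp add: g.U.left_ideal.zero)
  next
    case (right x y z)
    have "G F = ((y + z) \<odot>\<^bsub>U\<^esub> x \<ominus>\<^bsub>U\<^esub> y \<odot>\<^bsub>U\<^esub> x) \<ominus>\<^bsub>U\<^esub> z \<odot>\<^bsub>U\<^esub> x"
      using right by (simp add: diff gen del: carrier_free_Abelian_group_iff)
    also have "\<dots> = \<zero>\<^bsub>U\<^esub>"
      using right by (simp add: g.U.scale_add_left g.U.add_diff_diff)
    finally show ?thesis by (simp add: g.U.left_ideal.zero)
  next
    case (balanced x r z)
    have "G F = z \<odot>\<^bsub>U\<^esub> (x \<otimes>\<^bsub>U\<^esub> \<nu> r) \<ominus>\<^bsub>U\<^esub> (\<chi> r * z) \<odot>\<^bsub>U\<^esub> x"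
      using balanced by (simp add: diff gen del: carrier_free_Abelian_group_iff)
    also have "\<dots> = (z \<odot>\<^bsub>U\<^esub> x) \<otimes>\<^bsub>U\<^esub> (\<nu> r \<ominus>\<^bsub>U\<^esub> \<chi> r \<odot>\<^bsub>U\<^esub> \<one>\<^bsub>U\<^esub>)"
      using balanced by (simp add: a_minus_def g.U.r_distr g.U.r_minus g.U.scale_mult_right
        g.U.scale_mult_left g.U.scale_scale g.U.scale_add_right mult.commute)
    finally show ?thesis
      using lid(2)[OF _ lift_character] balanced by simp
  qed
  have "G F \<in> I\<^sub>y" if "F \<in> ker" for F
    using that
  proof (induction rule: ker_induct)
    case zero
    then show ?case using \<open>G 0 = \<zero>\<^bsub>U\<^esub>\<close> by (simp add: g.U.left_ideal.zero)
  next
    case (rel F)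
    then show ?case using \<open>\<And>F. F \<in> rels \<Longrightarrow> G F \<in> I\<^sub>y\<close> by blast
  next
    case (minus F)
    have "G (0 - F) = G 0 \<ominus>\<^bsub>U\<^esub> G F"
      using diff[OF Fab_zero subsetD[OF rels_closed minus]] .
    then show ?case
      using lid(4)[OF g.U.left_ideal.zero rel[OF minus]] zero by simp
  next
    case (add F G')
    then show ?case
      using lid(1) \<open>\<And>a b. a \<in> carrier Fab \<Longrightarrow> b \<in> carrier Fab \<Longrightarrow> G (a + b) = G a \<oplus>\<^bsub>U\<^esub> G b\<close> ker_closed
      by metis
  qed
  moreover have "frag_of (u, 1) - frag_of (v, 1) \<in> ker"
    using assms(3) by (simp add: e_def cls_eq_iff)
  ultimately have "G (frag_of (u, 1) - frag_of (v, 1)) \<in> I\<^sub>y" by blast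
  then show ?thesis
    using assms(1,2) by (simp add: diff gen del: carrier_free_Abelian_group_iff)
qed

text \<open>The balanced relation for the element of U(m) given by \<open>ym j\<close> identifies
  the classes of \<open>a y\<^sub>j\<close> and \<open>a\<close>, because \<theta> is 1 on
  \<open>ym j\<close>.\<close>

lemma e_I: assumes "y \<in> I\<^sub>y" shows "e y = \<zero>\<^bsub>Q\<^esub>"
  using assms
proof induction
  case zero
  then show ?case by (simp add: e_zero)
next
  case (add y a w)
  then obtain j where j: "j \<in> {1..n}" "w = \<iota> (ym j) \<ominus>\<^bsub>U\<^esub> \<one>\<^bsub>U\<^esub>"
    by auto
  have c: "y \<in> carrier U" "\<iota> (ym j) \<in> carrier U" "w \<in> carrier U"
    using add.hyps(1) g.U.left_ideal_closed[OF gens_closed(2)] ym_sp[OF j(1)] j(2) by auto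
  have "\<nu> (m.\<iota> (ym j)) = \<iota> (ym j)" "\<chi> (m.\<iota> (ym j)) = 1"
    using nu(2) chi(2) ym_m_alg[OF j(1)] theta_ym[OF j(1)] by auto
  then have "frag_of (a \<otimes>\<^bsub>U\<^esub> \<iota> (ym j), 1) - frag_of (a, 1) \<in> rels"
    using rels_balanced[OF add.hyps(2) m.env_of_closed[OF ym_m_alg[OF j(1)]], of 1] by simp
  then have ea: "e (a \<otimes>\<^bsub>U\<^esub> \<iota> (ym j)) = e a"
    unfolding e_def using rels_ker cls_eq_iff by metis
  have "a \<otimes>\<^bsub>U\<^esub> w \<oplus>\<^bsub>U\<^esub> a = a \<otimes>\<^bsub>U\<^esub> \<iota> (ym j)"
    using c add.hyps(2) by (simp add: j(2) a_minus_def g.U.r_distr g.U.r_minus g.U.a_assoc g.U.l_neg)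
  then have aw: "e (a \<otimes>\<^bsub>U\<^esub> w) \<oplus>\<^bsub>Q\<^esub> e a = e a"
    using ea e_add[of "a \<otimes>\<^bsub>U\<^esub> w" a] c add.hyps(2) by simp
  have "e (a \<otimes>\<^bsub>U\<^esub> w) = e \<zero>\<^bsub>U\<^esub>"
  proof -
    have "e (a \<otimes>\<^bsub>U\<^esub> w) = e (a \<otimes>\<^bsub>U\<^esub> w) \<oplus>\<^bsub>Q\<^esub> e (a \<oplus>\<^bsub>U\<^esub> \<ominus>\<^bsub>U\<^esub> a)"
      using c add.hyps(2) e_add[of "a \<otimes>\<^bsub>U\<^esub> w" "\<zero>\<^bsub>U\<^esub>"] by (simp add: g.U.r_neg)
    also have "\<dots> = e (a \<otimes>\<^bsub>U\<^esub> w \<oplus>\<^bsub>U\<^esub> a) \<oplus>\<^bsub>Q\<^esub> e (\<ominus>\<^bsub>U\<^esub> a)"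
      using c add.hyps(2) by (simp add: e_add g.U.a_assoc)
    also have "e (a \<otimes>\<^bsub>U\<^esub> w \<oplus>\<^bsub>U\<^esub> a) = e a"
      using aw e_add[of "a \<otimes>\<^bsub>U\<^esub> w" a] c add.hyps(2) by simp
    also have "e a \<oplus>\<^bsub>Q\<^esub> e (\<ominus>\<^bsub>U\<^esub> a) = e \<zero>\<^bsub>U\<^esub>"
      using add.hyps(2) by (simp add: e_add g.U.r_neg)
    finally show ?thesis .
  qed
  then show ?case
    using add.IH e_add[of y "a \<otimes>\<^bsub>U\<^esub> w"] e_add[of "\<zero>\<^bsub>U\<^esub>" "\<zero>\<^bsub>U\<^esub>"] c add.hyps(2) by (simp add: e_zero)
qed

text \<open>With \<open>e_surj\<close> this identifies the induced module with the quotient of U(sp)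
  by \<open>I\<^sub>y\<close>.\<close>

lemma e_eq_iff: assumes "u \<in> carrier U" "v \<in> carrier U" shows "e u = e v \<longleftrightarrow> u \<ominus>\<^bsub>U\<^esub> v \<in> I\<^sub>y"
proof
  assume "u \<ominus>\<^bsub>U\<^esub> v \<in> I\<^sub>y"
  then have "e (u \<ominus>\<^bsub>U\<^esub> v) = e \<zero>\<^bsub>U\<^esub>"
    using e_I e_zero by simp
  then have "e (u \<ominus>\<^bsub>U\<^esub> v) \<oplus>\<^bsub>Q\<^esub> e v = e \<zero>\<^bsub>U\<^esub> \<oplus>\<^bsub>Q\<^esub> e v"
    by simp
  then show "e u = e v"
    using assms by (simp add: e_add)
qed (use e_eq_imp assms in blast)

end

context symplectic
begin

section \<open>Endomorphisms of the induced module\<close>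

lemmas whittaker_def = T.whittaker_def[unfolded set_indices]

lemma whittaker_closed: "u \<in> T.whittaker \<Longrightarrow> u \<in> carrier U"
  by (simp add: whittaker_def)

text \<open>This links the two forms of the Whittaker condition: the last summand lies in
  \<open>I\<^sub>x\<close> for every \<open>u\<close>.\<close>

lemma xm_diff_mult:
  assumes "u \<in> carrier U" "j \<in> {1..n}"
  shows "(\<iota> (xm j) \<ominus>\<^bsub>U\<^esub> \<one>\<^bsub>U\<^esub>) \<otimes>\<^bsub>U\<^esub> u
    = g.U.comm (\<iota> (xm j)) u \<oplus>\<^bsub>U\<^esub> u \<otimes>\<^bsub>U\<^esub> (\<iota> (xm j) \<ominus>\<^bsub>U\<^esub> \<one>\<^bsub>U\<^esub>)"
proof -
  have x: "\<iota> (xm j) \<in> carrier U"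
    using xm_sp assms(2) by blast
  have "(\<iota> (xm j) \<ominus>\<^bsub>U\<^esub> \<one>\<^bsub>U\<^esub>) \<otimes>\<^bsub>U\<^esub> u = \<iota> (xm j) \<otimes>\<^bsub>U\<^esub> u \<ominus>\<^bsub>U\<^esub> u"
    using x assms(1) by (simp add: a_minus_def g.U.l_distr g.U.l_minus)
  also have "\<dots> = (\<iota> (xm j) \<otimes>\<^bsub>U\<^esub> u \<ominus>\<^bsub>U\<^esub> u \<otimes>\<^bsub>U\<^esub> \<iota> (xm j)) \<oplus>\<^bsub>U\<^esub> (u \<otimes>\<^bsub>U\<^esub> \<iota> (xm j) \<ominus>\<^bsub>U\<^esub> u)"
    using x assms(1) by (simp add: g.U.diff_trans)
  also have "u \<otimes>\<^bsub>U\<^esub> \<iota> (xm j) \<ominus>\<^bsub>U\<^esub> u = u \<otimes>\<^bsub>U\<^esub> (\<iota> (xm j) \<ominus>\<^bsub>U\<^esub> \<one>\<^bsub>U\<^esub>)"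
    using x assms(1) by (simp add: a_minus_def g.U.r_distr g.U.r_minus)
  finally show ?thesis
    by (simp add: g.U.comm_def)
qed

text \<open>The generators of \<open>I\<^sub>x\<close> times a Whittaker vector stay in
  \<open>I\<^sub>x\<close>, and \<open>tau 1\<close> transports this to \<open>I\<^sub>y\<close>. It
  makes right multiplication by \<open>tau 1 u\<close> well defined on the induced module.\<close>

lemma I_y_right_mult:
  assumes u: "u \<in> T.whittaker" and y: "y \<in> I\<^sub>y"
  shows "y \<otimes>\<^bsub>U\<^esub> tau 1 u \<in> I\<^sub>y"
proof (rule g.U.left_ideal_right_mult[OF gens_closed(2) _ _ y])
  note uc = whittaker_closed[OF u]
  show "tau 1 u \<in> carrier U"
    using tau_hom(1) uc by blast
  fix w assume "w \<in> (\<lambda>j. \<iota> (ym j) \<ominus>\<^bsub>U\<^esub> \<one>\<^bsub>U\<^esub>) ` {1..n}"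
  then obtain j where j: "j \<in> {1..n}" "w = \<iota> (ym j) \<ominus>\<^bsub>U\<^esub> \<one>\<^bsub>U\<^esub>"
    by auto
  have x: "\<iota> (xm j) \<in> carrier U"
    using xm_sp j(1) by blast
  have "w \<otimes>\<^bsub>U\<^esub> tau 1 u = tau 1 ((\<iota> (xm j) \<ominus>\<^bsub>U\<^esub> \<one>\<^bsub>U\<^esub>) \<otimes>\<^bsub>U\<^esub> u)"
    using x uc j by (simp add: tau_hom(2,4) tau_diff tau_xm)
  moreover have "(\<iota> (xm j) \<ominus>\<^bsub>U\<^esub> \<one>\<^bsub>U\<^esub>) \<otimes>\<^bsub>U\<^esub> u \<in> I\<^sub>x"
    unfolding xm_diff_mult[OF uc j(1)]
    by (rule g.U.left_ideal_add[OF gens_closed(1) g.U.left_ideal_gen[OF gens_closed(1)]])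
      (use u uc j in \<open>auto simp: whittaker_def\<close>)
  ultimately show "w \<otimes>\<^bsub>U\<^esub> tau 1 u \<in> I\<^sub>y"
    using tau_I by simp
qed

text \<open>Right multiplication by \<open>tau 1 u\<close>; the twist lets \<open>u\<close> be a
  Whittaker vector for the weight vectors \<open>xm j\<close>, although the module is built from the
  \<open>ym j\<close>. Right multiplications compose in the order prescribed by the product of
  \<open>W_alg\<close>.\<close>

definition Phi where
  "Phi u = (\<lambda>q \<in> carrier Q. e ((SOME v. v \<in> carrier U \<and> q = e v) \<otimes>\<^bsub>U\<^esub> tau 1 u))"

lemma Phi_e:
  assumes u: "u \<in> T.whittaker" and v: "v \<in> carrier U"
  shows "Phi u (e v) = e (v \<otimes>\<^bsub>U\<^esub> tau 1 u)"
proof -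
  let ?v = "SOME w. w \<in> carrier U \<and> e v = e w"
  have w: "?v \<in> carrier U" "e v = e ?v"
    using someI[of "\<lambda>w. w \<in> carrier U \<and> e v = e w" v] v by auto
  have t: "tau 1 u \<in> carrier U"
    using tau_hom(1) whittaker_closed[OF u] by blast
  have "?v \<ominus>\<^bsub>U\<^esub> v \<in> I\<^sub>y"
    using e_eq_iff[OF w(1) v] w(2) by simp
  then have "(?v \<ominus>\<^bsub>U\<^esub> v) \<otimes>\<^bsub>U\<^esub> tau 1 u \<in> I\<^sub>y"
    by (rule I_y_right_mult[OF u])
  then have "?v \<otimes>\<^bsub>U\<^esub> tau 1 u \<ominus>\<^bsub>U\<^esub> v \<otimes>\<^bsub>U\<^esub> tau 1 u \<in> I\<^sub>y"
    using w v t by (simp add: a_minus_def g.U.l_distr g.U.l_minus)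
  then have "e (?v \<otimes>\<^bsub>U\<^esub> tau 1 u) = e (v \<otimes>\<^bsub>U\<^esub> tau 1 u)"
    using e_eq_iff w v t by simp
  then show ?thesis
    using e_closed[OF v] by (simp add: Phi_def)
qed

lemma scalar_e: "v \<in> carrier U \<Longrightarrow> module_scalar (sp n) Q c (e v) = e (c \<odot>\<^bsub>U\<^esub> v)"
  by (simp add: module_scalar_def e_smult g.U.scale_mult_left)

lemma W_simps:
  "carrier (W_alg n) = lie_endomorphisms (sp n) Q"
  "f \<otimes>\<^bsub>W_alg n\<^esub> f' = compose (carrier Q) f' f"
  "\<one>\<^bsub>W_alg n\<^esub> = (\<lambda>q \<in> carrier Q. q)" "\<zero>\<^bsub>W_alg n\<^esub> = (\<lambda>q \<in> carrier Q. \<zero>\<^bsub>Q\<^esub>)"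
  "f \<oplus>\<^bsub>W_alg n\<^esub> f' = (\<lambda>q \<in> carrier Q. f q \<oplus>\<^bsub>Q\<^esub> f' q)"
  "c \<odot>\<^bsub>W_alg n\<^esub> f = (\<lambda>q \<in> carrier Q. module_scalar (sp n) Q c (f q))"
  by (simp_all add: W_alg_def op_endomorphism_algebra_def)

lemma Q_ext:
  assumes "f \<in> extensional (carrier Q)" "f' \<in> extensional (carrier Q)"
    and "\<And>v. v \<in> carrier U \<Longrightarrow> f (e v) = f' (e v)"
  shows "f = f'"
proof (rule extensionalityI[OF assms(1,2)])
  fix q assume "q \<in> carrier Q"
  then show "f q = f' q"
    using e_surj assms(3) by metis
qed

lemma Phi_extensional: "Phi u \<in> extensional (carrier Q)"
  by (simp add: Phi_def)

lemma Phi_lie: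
  assumes u: "u \<in> T.whittaker" shows "Phi u \<in> lie_endomorphisms (sp n) Q"
proof -
  have t: "tau 1 u \<in> carrier U"
    using tau_hom(1) whittaker_closed[OF u] by blast
  have "Phi u q \<in> carrier Q" if "q \<in> carrier Q" for q
    using e_surj[OF that] Phi_e[OF u] e_closed t by (metis g.U.m_closed)
  moreover have "Phi u (p \<oplus>\<^bsub>Q\<^esub> q) = Phi u p \<oplus>\<^bsub>Q\<^esub> Phi u q" if pq: "p \<in> carrier Q" "q \<in> carrier Q" for p q
  proof -
    obtain v w where "v \<in> carrier U" "w \<in> carrier U" "p = e v" "q = e w"
      using e_surj pq by metis
    then show ?thesis
      using t u by (simp add: e_add Phi_e g.U.l_distr)
  qed
  moreover have "Phi u (module_scalar (sp n) Q c q) = module_scalar (sp n) Q c (Phi u q)"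
    if q: "q \<in> carrier Q" for c q
  proof -
    obtain v where "v \<in> carrier U" "q = e v"
      by (rule e_surj[OF q])
    then show ?thesis
      using t u by (simp add: scalar_e Phi_e g.U.scale_mult_left)
  qed
  moreover have "Phi u (\<iota> X \<odot>\<^bsub>Q\<^esub> q) = \<iota> X \<odot>\<^bsub>Q\<^esub> Phi u q" if X: "X \<in> sp n" and q: "q \<in> carrier Q" for X q
  proof -
    obtain v where "v \<in> carrier U" "q = e v"
      by (rule e_surj[OF q])
    then show ?thesis
      using t u X by (simp add: e_smult Phi_e g.U.m_assoc)
  qed
  ultimately show ?thesis
    unfolding lie_endomorphisms_def using Phi_extensional by (auto simp: PiE_iff)
qed

text \<open>Commuting with scalars and with sp means commuting with generators of U(sp), so the map
  is determined by the image of the cyclic generator \<open>e \<one>\<close>.\<close>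

lemma lie_endomorphism_U_linear:
  assumes f: "f \<in> lie_endomorphisms (sp n) Q" and w: "w \<in> carrier U" "f (e \<one>\<^bsub>U\<^esub>) = e w"
    and v: "v \<in> carrier U"
  shows "f (e v) = e (v \<otimes>\<^bsub>U\<^esub> w)"
proof -
  have add: "f (e (a \<oplus>\<^bsub>U\<^esub> b)) = f (e a) \<oplus>\<^bsub>Q\<^esub> f (e b)" if "a \<in> carrier U" "b \<in> carrier U" for a b
    using f e_closed that unfolding lie_endomorphisms_def by (simp flip: e_add)
  have scale: "f (e (c \<odot>\<^bsub>U\<^esub> a)) = module_scalar (sp n) Q c (f (e a))" if "a \<in> carrier U" for a c
    using f e_closed that unfolding lie_endomorphisms_def by (simp flip: scalar_e)
  have lie: "f (e (\<iota> X \<otimes>\<^bsub>U\<^esub> a)) = \<iota> X \<odot>\<^bsub>Q\<^esub> f (e a)" if "X \<in> sp n" "a \<in> carrier U" for X a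
    using f e_closed that unfolding lie_endomorphisms_def by (simp flip: e_smult)
  have cl: "b \<in> carrier U" if "b \<in> generated_subalgebra U (\<iota> ` sp n)" for b
    by (rule g.U.generated_subalgebra_closed[OF _ that]) auto
  have fe: "\<exists>b \<in> carrier U. f (e a) = e b" if "a \<in> carrier U" for a
    using f e_closed[OF that] e_surj unfolding lie_endomorphisms_def by (metis (no_types, lifting) PiE_mem mem_Collect_eq)
  \<comment> \<open>The quantification over all \<open>a\<close> and \<open>b\<close> serves the
    product case: the hypothesis for the left factor is applied to classes already multiplied by the
    right one.\<close>
  have "\<forall>a b. a \<in> carrier U \<longrightarrow> b \<in> carrier U \<longrightarrow> f (e a) = e b \<longrightarrow> f (e (v \<otimes>\<^bsub>U\<^esub> a)) = e (v \<otimes>\<^bsub>U\<^esub> b)"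
    using g.env_generated[OF v]
  proof induction
    case one
    show ?case by simp
  next
    case (incl x)
    then show ?case using lie by (auto simp: e_smult)
  next
    case (add x y)
    then show ?case
      using cl[OF add.hyps(1)] cl[OF add.hyps(2)] \<open>\<And>a b. a \<in> carrier U \<Longrightarrow> b \<in> carrier U \<Longrightarrow> f (e (a \<oplus>\<^bsub>U\<^esub> b)) = f (e a) \<oplus>\<^bsub>Q\<^esub> f (e b)\<close>
      by (simp add: g.U.l_distr e_add)
  next
    case (mult x y)
    then show ?case
      using cl[OF mult.hyps(1)] cl[OF mult.hyps(2)] by (simp add: g.U.m_assoc)
  next
    case (smult x c)
    then show ?case
      using cl[OF smult.hyps(1)] scale by (simp add: g.U.scale_mult_left scalar_e)
  qed
  then have "f (e (v \<otimes>\<^bsub>U\<^esub> \<one>\<^bsub>U\<^esub>)) = e (v \<otimes>\<^bsub>U\<^esub> w)"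
    using w g.U.one_closed by blast
  then show ?thesis
    using v by simp
qed

text \<open>Each \<open>ym j - 1\<close> annihilates the cyclic generator and therefore also its
  image \<open>e w\<close>. Undoing \<open>tau 1\<close>, this is the Whittaker condition for
  \<open>tau (- 1) w\<close>.\<close>

lemma Phi_surj:
  assumes f: "f \<in> lie_endomorphisms (sp n) Q"
  shows "\<exists>u \<in> T.whittaker. f = Phi u"
proof -
  have "f (e \<one>\<^bsub>U\<^esub>) \<in> carrier Q"
    using f e_closed[OF g.U.one_closed] by (auto simp: lie_endomorphisms_def)
  then obtain w where w: "w \<in> carrier U" "f (e \<one>\<^bsub>U\<^esub>) = e w"
    by (rule e_surj)
  note lin = lie_endomorphism_U_linear[OF f w]
  define u where "u = tau (- 1) w"
  have u: "u \<in> carrier U" "tau 1 u = w"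
    using tau_hom(1) w(1) tau_inverse[OF w(1), of 1] by (auto simp: u_def)
  have "g.U.comm (\<iota> (xm j)) u \<in> I\<^sub>x" if j: "j \<in> {1..n}" for j
  proof -
    have x: "\<iota> (xm j) \<in> carrier U" and y: "\<iota> (ym j) \<in> carrier U"
      using xm_sp ym_sp j by auto
    let ?y = "\<iota> (ym j) \<ominus>\<^bsub>U\<^esub> \<one>\<^bsub>U\<^esub>"
    have "?y \<in> I\<^sub>y"
      using g.U.left_ideal_gen[OF gens_closed(2) g.U.one_closed, of ?y] j y by auto
    then have "e ?y = e \<zero>\<^bsub>U\<^esub>"
      using e_I e_zero by simp
    then have "e (?y \<otimes>\<^bsub>U\<^esub> w) = e (\<zero>\<^bsub>U\<^esub> \<otimes>\<^bsub>U\<^esub> w)"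
      using lin[of ?y] lin[of "\<zero>\<^bsub>U\<^esub>"] y by simp
    then have "?y \<otimes>\<^bsub>U\<^esub> w \<in> I\<^sub>y"
      using e_eq_iff[of "?y \<otimes>\<^bsub>U\<^esub> w" "\<zero>\<^bsub>U\<^esub>"] y w(1) by (simp add: a_minus_def)
    then have "tau (- 1) (?y \<otimes>\<^bsub>U\<^esub> w) \<in> I\<^sub>x"
      by (rule tau_I')
    then have "(\<iota> (xm j) \<ominus>\<^bsub>U\<^esub> \<one>\<^bsub>U\<^esub>) \<otimes>\<^bsub>U\<^esub> u \<in> I\<^sub>x"
      using y w(1) j by (simp add: tau_hom(2,4) tau_diff tau_ym u_def)
    moreover have "u \<otimes>\<^bsub>U\<^esub> (\<iota> (xm j) \<ominus>\<^bsub>U\<^esub> \<one>\<^bsub>U\<^esub>) \<in> I\<^sub>x"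
      by (rule g.U.left_ideal_gen[OF gens_closed(1) u(1)]) (use j in blast)
    ultimately have "(g.U.comm (\<iota> (xm j)) u \<oplus>\<^bsub>U\<^esub> u \<otimes>\<^bsub>U\<^esub> (\<iota> (xm j) \<ominus>\<^bsub>U\<^esub> \<one>\<^bsub>U\<^esub>))
        \<ominus>\<^bsub>U\<^esub> u \<otimes>\<^bsub>U\<^esub> (\<iota> (xm j) \<ominus>\<^bsub>U\<^esub> \<one>\<^bsub>U\<^esub>) \<in> I\<^sub>x"
      unfolding xm_diff_mult[OF u(1) j] by (rule g.U.left_ideal_diff[OF gens_closed(1)])
    moreover have "(a \<oplus>\<^bsub>U\<^esub> b) \<ominus>\<^bsub>U\<^esub> b = a" if "a \<in> carrier U" "b \<in> carrier U" for a b
      using that by (simp add: a_minus_def g.U.a_assoc g.U.r_neg)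
    ultimately show ?thesis
      using x u(1) by simp
  qed
  then have uw: "u \<in> T.whittaker"
    using u(1) by (simp add: whittaker_def)
  have "f = Phi u"
  proof (rule Q_ext)
    show "f \<in> extensional (carrier Q)"
      using f by (auto simp: lie_endomorphisms_def PiE_def)
  qed (use lin Phi_e[OF uw] u(2) Phi_extensional in auto)
  then show ?thesis
    using uw by blast
qed

text \<open>One direction evaluates both maps at the cyclic generator, the other multiplies a
  congruence modulo \<open>I\<^sub>y\<close> from the left.\<close>

lemma Phi_eq_iff:
  assumes "u \<in> T.whittaker" "v \<in> T.whittaker"
  shows "Phi u = Phi v \<longleftrightarrow> u \<ominus>\<^bsub>U\<^esub> v \<in> I\<^sub>x"
proof -
  note c = whittaker_closed[OF assms(1)] whittaker_closed[OF assms(2)]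
  have t: "tau 1 u \<in> carrier U" "tau 1 v \<in> carrier U"
    using tau_hom(1) c by auto
  have inv: "tau (- 1) (tau 1 w) = w" if "w \<in> carrier U" for w
    using tau_inverse[OF that, of "- 1"] by simp
  show ?thesis
  proof
    assume "Phi u = Phi v"
    then have "Phi u (e \<one>\<^bsub>U\<^esub>) = Phi v (e \<one>\<^bsub>U\<^esub>)"
      by simp
    then have "e (tau 1 u) = e (tau 1 v)"
      using assms t by (simp add: Phi_e)
    then have "tau 1 u \<ominus>\<^bsub>U\<^esub> tau 1 v \<in> I\<^sub>y"
      using e_eq_iff t by simp
    then show "u \<ominus>\<^bsub>U\<^esub> v \<in> I\<^sub>x"
      using tau_I'[of "tau 1 u \<ominus>\<^bsub>U\<^esub> tau 1 v"] inv c t by (simp add: tau_diff)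
  next
    assume "u \<ominus>\<^bsub>U\<^esub> v \<in> I\<^sub>x"
    then have *: "tau 1 u \<ominus>\<^bsub>U\<^esub> tau 1 v \<in> I\<^sub>y"
      using tau_I tau_diff[OF c] by metis
    show "Phi u = Phi v"
    proof (rule Q_ext[OF Phi_extensional Phi_extensional])
      fix w assume w: "w \<in> carrier U"
      have "w \<otimes>\<^bsub>U\<^esub> (tau 1 u \<ominus>\<^bsub>U\<^esub> tau 1 v) \<in> I\<^sub>y"
        by (rule g.U.left_ideal_mult[OF gens_closed(2) w *])
      then have "w \<otimes>\<^bsub>U\<^esub> tau 1 u \<ominus>\<^bsub>U\<^esub> w \<otimes>\<^bsub>U\<^esub> tau 1 v \<in> I\<^sub>y"
        using w t by (simp add: a_minus_def g.U.r_distr g.U.r_minus)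
      then show "Phi u (e w) = Phi v (e w)"
        using e_eq_iff w t by (simp add: Phi_e[OF assms(1)] Phi_e[OF assms(2)])
    qed
  qed
qed

text \<open>For products, \<open>[x, u v] = [x, u] v + u [x, v]\<close>, and the first summand stays
  in \<open>I\<^sub>x\<close> because right multiplication by the Whittaker vector \<open>v\<close>
  preserves it.\<close>

lemma whittaker_ops:
  assumes "u \<in> T.whittaker" "v \<in> T.whittaker"
  shows "u \<oplus>\<^bsub>U\<^esub> v \<in> T.whittaker" "u \<otimes>\<^bsub>U\<^esub> v \<in> T.whittaker" "c \<odot>\<^bsub>U\<^esub> u \<in> T.whittaker"
proof -
  note cl = whittaker_closed[OF assms(1)] whittaker_closed[OF assms(2)]
  have x: "\<iota> (xm j) \<in> carrier U" if "j \<in> {1..n}" for j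
    using xm_sp that by blast
  note lid = g.U.left_ideal_add[OF gens_closed(1)] g.U.left_ideal_mult[OF gens_closed(1)]
    g.U.left_ideal_scale[OF gens_closed(1)]
  show "u \<oplus>\<^bsub>U\<^esub> v \<in> T.whittaker" "c \<odot>\<^bsub>U\<^esub> u \<in> T.whittaker"
    using assms cl x lid(1,3) by (auto simp: whittaker_def g.U.comm_add g.U.comm_scale)
  have "y \<otimes>\<^bsub>U\<^esub> v \<in> I\<^sub>x" if "y \<in> I\<^sub>x" for y
  proof (rule g.U.left_ideal_right_mult[OF gens_closed(1) cl(2) _ that])
    fix w assume "w \<in> (\<lambda>j. \<iota> (xm j) \<ominus>\<^bsub>U\<^esub> \<one>\<^bsub>U\<^esub>) ` {1..n}"
    then obtain j where j: "j \<in> {1..n}" "w = \<iota> (xm j) \<ominus>\<^bsub>U\<^esub> \<one>\<^bsub>U\<^esub>"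
      by auto
    show "w \<otimes>\<^bsub>U\<^esub> v \<in> I\<^sub>x"
      unfolding j(2) xm_diff_mult[OF cl(2) j(1)]
      by (rule g.U.left_ideal_add[OF gens_closed(1) g.U.left_ideal_gen[OF gens_closed(1)]])
        (use assms(2) cl j in \<open>auto simp: whittaker_def\<close>)
  qed
  then show "u \<otimes>\<^bsub>U\<^esub> v \<in> T.whittaker"
    using assms cl x lid by (auto simp: whittaker_def g.U.comm_mult)
qed

text \<open>The list \<open>indices\<close> begins with 1, which stands for
  \<open>X_sum n 1 1\<close>, and continues with the \<open>X_diff n 1 j\<close> in the order used
  by \<open>ore_set\<close>. The monomials of both descriptions are therefore the same
  products.\<close>

lemma C_alg_eq: "C_alg n = centralizer T.L (generated_subalgebra T.L T.torus_generators)"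
proof -
  have upt: "indices = 1 # [2..<Suc n]"
    using n_ge_2 by (simp add: indices_def upt_conv_Cons numeral_2_eq_2 del: upt_Suc)
  have "foldr (\<otimes>\<^bsub>U\<^esub>) (map (\<lambda>j. \<iota> (X_diff n 1 j) [^]\<^bsub>U\<^esub> k j) [2..<Suc n]) \<one>\<^bsub>U\<^esub>
      = foldr (\<otimes>\<^bsub>U\<^esub>) (map (\<lambda>j. \<iota> (xm j) [^]\<^bsub>U\<^esub> k j) [2..<Suc n]) \<one>\<^bsub>U\<^esub>" for k :: "nat \<Rightarrow> nat"
    by (rule arg_cong[of _ _ "\<lambda>xs. foldr _ xs _"]) (auto simp: xm_def)
  note X_diff = this
  have X_sum: "X_sum n 1 1 = xm 1"
    by (simp add: xm_def)
  have mon: "T.mon k = \<iota> (X_sum n 1 1) [^]\<^bsub>U\<^esub> k 1 \<otimes>\<^bsub>U\<^esub>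
      foldr (\<otimes>\<^bsub>U\<^esub>) (map (\<lambda>j. \<iota> (X_diff n 1 j) [^]\<^bsub>U\<^esub> k j) [2..<Suc n]) \<one>\<^bsub>U\<^esub>" for k
    unfolding X_diff X_sum T.mon_def by (simp only: upt list.map foldr.simps o_apply)
  have "ore_set n = {T.mon k | k. True}"
    by (simp only: ore_set_def mon)
  then have S: "ore_set n = T.S"
    by (auto simp: T.S_def)
  have loc: "loc_of n X = T.frac \<one>\<^bsub>U\<^esub> (\<iota> X)" for X
    by (simp add: loc_of_def S T.to_localization_frac)
  have J: "{1..n} = insert 1 {2..n}"
    using n_ge_2 by auto
  have image: "(\<lambda>j. G (xm j)) ` {1..n} = insert (G (X_sum n 1 1)) {G (X_diff n 1 j) | j. j \<in> {2..n}}"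
    for G :: "complex mat \<Rightarrow> (env \<times> env) set"
  proof -
    have "(\<lambda>j. G (xm j)) ` {2..n} = (\<lambda>j. G (X_diff n 1 j)) ` {2..n}"
      by (rule image_cong) (auto simp: xm_def)
    then show ?thesis
      by (simp only: J image_insert X_sum Setcompr_eq_image)
  qed
  have "{loc_of n (h_mat n i) | i. i \<in> {1..n}}
    \<union> {loc_of n (X_diff n 1 j) | j. j \<in> {2..n}}
    \<union> {inv\<^bsub>T.L\<^esub> (loc_of n (X_diff n 1 j)) | j. j \<in> {2..n}}
    \<union> {loc_of n (X_sum n 1 1), inv\<^bsub>T.L\<^esub> (loc_of n (X_sum n 1 1))} = T.torus_generators"
    unfolding T.torus_generators_def set_indices
      image[of "\<lambda>X. T.frac \<one>\<^bsub>U\<^esub> (\<iota> X)"] image[of "\<lambda>X. inv\<^bsub>T.L\<^esub> (T.frac \<one>\<^bsub>U\<^esub> (\<iota> X))"]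
    by (simp only: loc Setcompr_eq_image) blast
  then have "B_alg n = generated_subalgebra T.L T.torus_generators"
    by (simp only: B_alg_def U_loc_def S)
  then show ?thesis
    by (simp add: C_alg_def U_loc_def S)
qed

lemma W_alg_isomorphic_C_alg: "calgebra_isomorphic (W_alg n) (C_alg n)"
  unfolding C_alg_eq
proof (rule T.whittaker_isomorphic_centralizer[of Phi])
  fix u assume u: "u \<in> T.whittaker"
  note uc = whittaker_closed[OF u]
  have t: "tau 1 u \<in> carrier U"
    using tau_hom(1) uc by blast
  show "Phi u \<in> carrier (W_alg n)"
    using Phi_lie[OF u] by (simp add: W_simps)
  show "Phi (c \<odot>\<^bsub>U\<^esub> u) = c \<odot>\<^bsub>W_alg n\<^esub> Phi u" for c
    by (rule Q_ext) (use u uc t whittaker_ops(3)[OF u u] in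
      \<open>auto simp: W_simps Phi_extensional Phi_e e_closed scalar_e tau_hom(5) g.U.scale_mult_right\<close>)
  fix v assume v: "v \<in> T.whittaker"
  note vc = whittaker_closed[OF v]
  have t': "tau 1 v \<in> carrier U"
    using tau_hom(1) vc by blast
  show "Phi u = Phi v \<longleftrightarrow> u \<ominus>\<^bsub>U\<^esub> v \<in> T.I"
    unfolding set_indices by (rule Phi_eq_iff[OF u v])
  show "Phi (u \<oplus>\<^bsub>U\<^esub> v) = Phi u \<oplus>\<^bsub>W_alg n\<^esub> Phi v"
    by (rule Q_ext) (use u v uc vc t t' whittaker_ops(1)[OF u v] in
      \<open>auto simp: W_simps Phi_extensional Phi_e e_closed e_add tau_hom(3) g.U.r_distr\<close>)
  show "Phi (u \<otimes>\<^bsub>U\<^esub> v) = Phi u \<otimes>\<^bsub>W_alg n\<^esub> Phi v"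
    by (rule Q_ext) (use u v uc vc t t' whittaker_ops(2)[OF u v] in
      \<open>auto simp: W_simps Phi_extensional Phi_e e_closed compose_def tau_hom(2) g.U.m_assoc\<close>)
next
  fix f assume "f \<in> carrier (W_alg n)"
  then show "\<exists>u \<in> T.whittaker. f = Phi u"
    using Phi_surj by (simp add: W_simps)
next
  have w: "\<one>\<^bsub>U\<^esub> \<in> T.whittaker" "\<zero>\<^bsub>U\<^esub> \<in> T.whittaker"
    using xm_sp by (auto simp: whittaker_def g.U.left_ideal.zero)
  show "Phi \<one>\<^bsub>U\<^esub> = \<one>\<^bsub>W_alg n\<^esub>"
    by (rule Q_ext) (use w in \<open>auto simp: W_simps Phi_extensional Phi_e e_closed tau_hom(4)\<close>)
  show "Phi \<zero>\<^bsub>U\<^esub> = \<zero>\<^bsub>W_alg n\<^esub>"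
    by (rule Q_ext) (use w in \<open>auto simp: W_simps Phi_extensional Phi_e e_closed tau_zero e_zero\<close>)
qed

end

theorem theorem3p4:
  fixes n :: nat
  assumes "n \<ge> 2"
  shows "calgebra_isomorphic (W_alg n) (C_alg n)"
proof -
  interpret symplectic n
    using assms by unfold_locales
  show ?thesis
    by (rule W_alg_isomorphic_C_alg)
qed

end
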